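(* Let $\nu>0$ and let $n\ge 2$ be an integer. With $\xi$, $\beta$, $\mathrm{E}_s$, $\alpha_j$, $Z_j$, $\Phi_{n,j}$, $\Psi_{n,j}$ as defined in the context, there are functions $\eta_{n,j}(\nu,z)$ ($j=0,\pm1$) such that $$K_{i\nu}(\nu z)=\left(\frac{\pi}{2\nu}\right)^{1/2}\frac{1}{(z^2-1)^{1/4}}\exp\left\{-\nu\xi-\frac{\pi\nu}{2}+\sum_{s=1}^{n-1}(-1)^s\frac{\mathrm{E}_s(\beta)}{\nu^s}\right\}\{1+\eta_{n,0}(\nu,z)\}\quad(z\in Z_0),$$ $$I_{i\nu}(\nu z)=\left(\frac{1}{2\pi\nu}\right)^{1/2}\frac{1}{(z^2-1)^{1/4}}\exp\left\{\nu\xi+\frac{\pi\nu}{2}+\sum_{s=1}^{n-1}\frac{\mathrm{E}_s(\beta)}{\nu^s}\right\}\frac{1+\eta_{n,1}(\nu,z)}{1+\eta_{n,1}(\nu,\infty)}\quad(z\in Z_1),$$ $$I_{-i\nu}(\nu z)=i\left(\frac{1}{2\pi\nu}\right)^{1/2}\frac{1}{(z^2-1)^{1/4}}\exp\left\{-\nu\xi+\frac{\pi\nu}{2}+\sum_{s=1}^{n-1}(-1)^s\frac{\mathrm{E}_s(\beta)}{\nu^s}\right\}\frac{1+\eta_{n,-1}(\nu,z)}{1+\eta_{n,-1}(\nu,\infty e^{\pi i})}\quad(z\in Z_{-1}),$$ where, uniformly for $z\in Z_j$ ($j=0,\pm1$), $$|\eta_{n,j}(\nu,z)|\le\frac{1}{\nu^n}\Phi_{n,j}(\nu,z)\exp\left\{\frac1\nu\Psi_{n,j}(\nu,z)+\frac1{\nu^n}\Phi_{n,j}(\nu,z)\right\},$$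 and consequently $\eta_{n,j}(\nu,z)=\mathcal{O}(\nu^{-n})$ as $\nu\to\infty$ in these regions. Moreover, extension to the conjugates of these domains lying in the lower half $z$ plane follows from employing these expansions in the reflection relations $$I_{\pm i\nu}(\nu\bar z)=\overline{I_{\mp i\nu}(\nu z)},\qquad K_{i\nu}(\nu\bar z)=\overline{K_{i\nu}(\nu z)}.$$
   Context: $I_\mu$, $K_\mu$ are the modified Bessel functions (principal branches, continued continuously to the boundary $\arg z=\pi$). Variables: $\xi=\int_1^z\frac{(t^2-1)^{1/2}}{t}\,dt=(z^2-1)^{1/2}-\mathrm{arcsec}(z)$ and $\beta=(z^2-1)^{-1/2}$. Here $\xi\ge0$ for $z\in[1,\infty)$, and $\xi$ is continuous in the $z$ plane cut along $(-\infty,1]$; $\beta>0$ for $z>1$, with $\beta$ continuous in the plane cut along $[-1,1]$. The root $(z^2-1)^{1/4}$ is positive for $z>1$ and extended by continuity in the plane cut along $(-\infty,1]$. Points of the cut are regarded as boundary points approached from the upper half plane ($z=x+i0$) when working in $0\le\arg z\le\pi$; e.g. for $z=x+i0$, $0<x\le1$, $\xi=-i\ln\{(1+(1-x^2)^{1/2})/x\}+i(1-x^2)^{1/2}$. Coefficients: $\mathrm{E}_1(\beta)=\frac1{24}\beta(5\beta^2+3)$, $\mathrm{E}_2(\beta)=\frac1{16}\beta^2(5\beta^2+1)(\beta^2+1)$, and for $s=2,3,4,\ldots$ $$\mathrm{E}_{s+1}(\beta)=\tfrac12\beta^2(\beta^2+1)\mathrm{E}_s'(\beta)+\tfrac12\int_0^\beta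 p^2(p^2+1)\sum_{j=1}^{s-1}\mathrm{E}_j'(p)\mathrm{E}_{s-j}'(p)\,dp.$$ Let $\mathrm{F}_s(z)=\frac{d\mathrm{E}_s(\beta)}{d\xi}=-\frac{z^2\mathrm{E}_s'(\beta)}{(z^2-1)^2}$, where the prime is differentiation with respect to $\beta$. Reference points: $\alpha_0=\infty$ ($\arg z=0$); $\alpha_1$ corresponds to $\xi=-\frac12\pi-i\infty$, i.e. $z\to0$ along the positive imaginary axis; $\alpha_{-1}$ corresponds to $\xi=-i\infty$, i.e. $z\to0$ along the positive real axis (from above). Error-bound quantities, for $j=0,\pm1$: $$\Phi_{n,j}(\nu,z)=2\int_{\alpha_j}^z\left|t^{-1}(t^2-1)^{1/2}\mathrm{F}_n(t)\,dt\right|+\sum_{s=1}^{n-1}\frac1{\nu^s}\sum_{k=s}^{n-1}\int_{\alpha_j}^z\left|t^{-1}(t^2-1)^{1/2}\mathrm{F}_k(t)\mathrm{F}_{s+n-k-1}(t)\,dt\right|,$$ $$\Psi_{n,j}(\nu,z)=4\sum_{s=0}^{n-2}\frac1{\nu^s}\int_{\alpha_j}^z\left|t^{-1}(t^2-1)^{1/2}\mathrm{F}_{s+1}(t)\,dt\right|.$$ The integration paths (the same path in all integrals) satisfy: (i) they consist of a finite chain of $R_2$ arcs (an $R_2$ arc is one with a parametrization $t(\tau)$ having $t''$ continuous and $t'$ nonvanishing); (ii) as $v$ passes along the path from $\alpha_j$ to $z$, $\Re\{\xi(v)\}$ is monotonic (nonincreasing for $j=0,-1$, nondecreasing for $j=1$).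 $Z_j$ is the set of all points $z$ that can be linked to $\alpha_j$ by such a path and for which the integrals converge. (They converge at $z=\infty$ but not at the turning points $z=\pm1$. $Z_0$ and $Z_1$ include all points of the first quadrant $0\le\arg z\le\frac12\pi$ except the interval $[0,1]$ for $Z_0$ and $z=1$ for $Z_1$. $Z_{-1}$ includes the points of $0\le\arg z\le\pi$ lying to the left of the curve emanating from $z=1$ into the first quadrant on which $\Re\xi=0$, excluding points on this curve and $z=-1$.) $\eta_{n,1}(\nu,\infty)$ is the limit of $\eta_{n,1}(\nu,z)$ as $z\to\infty$ along $\arg z=0$, and $\eta_{n,-1}(\nu,\infty e^{\pi i})$ is the limit of $\eta_{n,-1}(\nu,z)$ as $z\to\infty$ along $\arg z=\pi$. *)

theory Defs
  imports "HOL-Complex_Analysis.Complex_Analysis" "HOL-Library.Landau_Symbols"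
begin

text \<open>
  Modified Bessel functions on their principal branches.  Since \<^const>\<open>Ln\<close> (hence \<^const>\<open>powr\<close>)
  takes its values on the negative real axis from \<open>arg z = \<pi>\<close>, both functions are, on
  \<open>0 \<le> arg z \<le> \<pi>\<close>, the continuous extensions from the open upper half plane.
\<close>

definition besselI :: "complex \<Rightarrow> complex \<Rightarrow> complex" where
  "besselI \<mu> z = (z / 2) powr \<mu> *
     (\<Sum>k. (z\<^sup>2 / 4) ^ k * rGamma (\<mu> + of_nat k + 1) / fact k)"

definition besselK :: "complex \<Rightarrow> complex \<Rightarrow> complex" where
  "besselK \<mu> z =
     (let q = (\<lambda>m. of_real pi / 2 * (besselI (- m) z - besselI m z) / sin (m * of_real pi))
      in if \<mu> \<in> \<int> then Lim (at \<mu>) q else q \<mu>)"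

text \<open>
  The branches.  The principal values of \<open>(z - 1)\<^sup>1\<^sup>/\<^sup>2\<close>, \<open>(z + 1)\<^sup>1\<^sup>/\<^sup>2\<close>, \<open>(z - 1)\<^sup>1\<^sup>/\<^sup>4\<close>, \<open>(z + 1)\<^sup>1\<^sup>/\<^sup>4\<close> are
  continuous on \<open>0 \<le> arg z \<le> \<pi>\<close>: on their cuts they are the limits from above.  The product of
  the square roots is analytic off \<open>[-1,1]\<close>, that of the fourth roots off \<open>(-\<infinity>,1]\<close>.
\<close>

definition sqrt_z2m1 :: "complex \<Rightarrow> complex" where
  "sqrt_z2m1 z = csqrt (z - 1) * csqrt (z + 1)"

definition root4_z2m1 :: "complex \<Rightarrow> complex" where
  "root4_z2m1 z = (z - 1) powr (1 / 4) * (z + 1) powr (1 / 4)"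

text \<open>
  The branch of \<open>arcsec\<close> that vanishes at \<open>1\<close> and is continuous off \<open>(-\<infinity>,1]\<close>, with values from
  above on the cut: if \<open>cos w = 1 / z\<close> then \<open>exp (\<i> w) = (1 + \<i> (z\<^sup>2 - 1)\<^sup>1\<^sup>/\<^sup>2) / z\<close>.
  For \<open>Im z > 0\<close> it is \<open>Arccos (1 / z)\<close>, but on \<open>(-1,0)\<close> the convention of \<^const>\<open>Arccos\<close>
  on its cut would give the limit from below instead.
\<close>

definition arcsec :: "complex \<Rightarrow> complex" where
  "arcsec z = - \<i> * Ln ((1 + \<i> * sqrt_z2m1 z) / z)"

definition xi :: "complex \<Rightarrow> complex" where
  "xi z = sqrt_z2m1 z - arcsec z"

definition beta :: "complex \<Rightarrow> complex" where
  "beta z = 1 / sqrt_z2m1 z"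

fun LG_E :: "nat \<Rightarrow> complex \<Rightarrow> complex" where
  "LG_E 0 = (\<lambda>b. 0)"
| "LG_E (Suc 0) = (\<lambda>b. 1 / 24 * b * (5 * b\<^sup>2 + 3))"
| "LG_E (Suc (Suc 0)) = (\<lambda>b. 1 / 16 * b\<^sup>2 * (5 * b\<^sup>2 + 1) * (b\<^sup>2 + 1))"
| "LG_E (Suc (Suc (Suc m))) = (\<lambda>b.
     1 / 2 * b\<^sup>2 * (b\<^sup>2 + 1) * deriv (LG_E (m + 2)) b +
     1 / 2 * contour_integral (linepath 0 b) (\<lambda>p. p\<^sup>2 * (p\<^sup>2 + 1) *
       (\<Sum>j = 1..m + 1. deriv (LG_E j) p * deriv (LG_E (m + 2 - j)) p)))"

definition LG_F :: "nat \<Rightarrow> complex \<Rightarrow> complex" where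
  "LG_F s z = - (z\<^sup>2 * deriv (LG_E s) (beta z)) / (z\<^sup>2 - 1)\<^sup>2"

text \<open>
  A path from a reference point to \<open>z\<close> is parametrized by \<open>(0,1]\<close>: the reference points
  \<open>\<alpha>\<^sub>j\<close> all lie at \<open>\<xi> = \<infinity>\<close> and are approached as the parameter tends to \<open>0\<close>.
\<close>

definition R2_arc_on :: "(real \<Rightarrow> complex) \<Rightarrow> real set \<Rightarrow> bool" where
  "R2_arc_on g T \<longleftrightarrow> (\<exists>g' g''.
     (\<forall>\<tau>\<in>T. (g has_vector_derivative g' \<tau>) (at \<tau> within T) \<and>
            (g' has_vector_derivative g'' \<tau>) (at \<tau> within T) \<and> g' \<tau> \<noteq> 0) \<and>
     continuous_on T g'')"

text \<open>Consecutive pieces share a closed end point, so a chain is continuous on \<open>(0,1]\<close>.\<close>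

definition R2_chain :: "(real \<Rightarrow> complex) \<Rightarrow> bool" where
  "R2_chain g \<longleftrightarrow> (\<exists>m (p :: nat \<Rightarrow> real). p 0 = 0 \<and> p m = 1 \<and>
     (\<forall>i<m. p i < p (Suc i) \<and> R2_arc_on g ({p i..p (Suc i)} - {0})))"

definition starts_at_ref :: "int \<Rightarrow> (real \<Rightarrow> complex) \<Rightarrow> bool" where
  "starts_at_ref j g \<longleftrightarrow>
     (if j = 0 then filterlim g at_infinity (at_right 0) \<and>
                    ((\<lambda>\<tau>. Arg (g \<tau>)) \<longlongrightarrow> 0) (at_right 0)
      else if j = 1 then (g \<longlongrightarrow> 0) (at_right 0) \<and> ((\<lambda>\<tau>. Arg (g \<tau>)) \<longlongrightarrow> pi / 2) (at_right 0)
      else (g \<longlongrightarrow> 0) (at_right 0) \<and> ((\<lambda>\<tau>. Arg (g \<tau>)) \<longlongrightarrow> 0) (at_right 0))"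

text \<open>
  Paths run in \<open>0 \<le> arg z \<le> \<pi>\<close>; real points stand for their upper sides.  The points \<open>0\<close> and
  \<open>\<plusminus>1\<close>, where \<open>\<xi>\<close> respectively the integrands are singular, are not on the path.
\<close>

definition linking_path :: "int \<Rightarrow> (real \<Rightarrow> complex) \<Rightarrow> complex \<Rightarrow> bool" where
  "linking_path j g z \<longleftrightarrow>
     R2_chain g \<and> starts_at_ref j g \<and> g 1 = z \<and>
     (\<forall>\<tau>\<in>{0<..1}. Im (g \<tau>) \<ge> 0 \<and> g \<tau> \<notin> {0, 1, - 1}) \<and>
     (if j = 1 then mono_on {0<..1} (\<lambda>\<tau>. Re (xi (g \<tau>)))
      else antimono_on {0<..1} (\<lambda>\<tau>. Re (xi (g \<tau>))))"

text \<open>\<open>\<integral> |f(t) dt|\<close> along the path \<open>g\<close>, and its convergence.\<close>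

definition abs_integral :: "(real \<Rightarrow> complex) \<Rightarrow> (complex \<Rightarrow> complex) \<Rightarrow> real" where
  "abs_integral g f =
     integral {0<..1} (\<lambda>\<tau>. cmod (f (g \<tau>) * vector_derivative g (at \<tau>)))"

definition abs_converges :: "(real \<Rightarrow> complex) \<Rightarrow> (complex \<Rightarrow> complex) \<Rightarrow> bool" where
  "abs_converges g f \<longleftrightarrow>
     (\<lambda>\<tau>. cmod (f (g \<tau>) * vector_derivative g (at \<tau>))) integrable_on {0<..1}"

definition Phi :: "nat \<Rightarrow> (real \<Rightarrow> complex) \<Rightarrow> real \<Rightarrow> real" where
  "Phi n g \<nu> =
     2 * abs_integral g (\<lambda>t. 1 / t * sqrt_z2m1 t * LG_F n t) +
     (\<Sum>s = 1..n - 1. 1 / \<nu> ^ s * (\<Sum>k = s..n - 1.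
        abs_integral g (\<lambda>t. 1 / t * sqrt_z2m1 t * LG_F k t * LG_F (s + n - k - 1) t)))"

definition Psi :: "nat \<Rightarrow> (real \<Rightarrow> complex) \<Rightarrow> real \<Rightarrow> real" where
  "Psi n g \<nu> =
     4 * (\<Sum>s = 0..n - 2. 1 / \<nu> ^ s *
        abs_integral g (\<lambda>t. 1 / t * sqrt_z2m1 t * LG_F (s + 1) t))"

text \<open>Convergence of all integrals occurring in \<^const>\<open>Phi\<close> and \<^const>\<open>Psi\<close>.\<close>

definition integrals_converge :: "nat \<Rightarrow> (real \<Rightarrow> complex) \<Rightarrow> bool" where
  "integrals_converge n g \<longleftrightarrow>
     (\<forall>k\<in>{1..n}. abs_converges g (\<lambda>t. 1 / t * sqrt_z2m1 t * LG_F k t)) \<and>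
     (\<forall>s\<in>{1..n - 1}. \<forall>k\<in>{s..n - 1}.
        abs_converges g (\<lambda>t. 1 / t * sqrt_z2m1 t * LG_F k t * LG_F (s + n - k - 1) t))"

definition admissible_path :: "nat \<Rightarrow> int \<Rightarrow> (real \<Rightarrow> complex) \<Rightarrow> complex \<Rightarrow> bool" where
  "admissible_path n j g z \<longleftrightarrow> linking_path j g z \<and> integrals_converge n g"

definition LG_Z :: "nat \<Rightarrow> int \<Rightarrow> complex set" where
  "LG_Z n j = {z. \<exists>g. admissible_path n j g z}"

text \<open>The three approximants without their error factors.\<close>

definition K_approx :: "nat \<Rightarrow> real \<Rightarrow> complex \<Rightarrow> complex" where
  "K_approx n \<nu> z = of_real (sqrt (pi / (2 * \<nu>))) * (1 / root4_z2m1 z) *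
     exp (- of_real \<nu> * xi z - of_real (pi * \<nu> / 2) +
          (\<Sum>s = 1..n - 1. (- 1) ^ s * LG_E s (beta z) / of_real \<nu> ^ s))"

definition Ip_approx :: "nat \<Rightarrow> real \<Rightarrow> complex \<Rightarrow> complex" where
  "Ip_approx n \<nu> z = of_real (sqrt (1 / (2 * pi * \<nu>))) * (1 / root4_z2m1 z) *
     exp (of_real \<nu> * xi z + of_real (pi * \<nu> / 2) +
          (\<Sum>s = 1..n - 1. LG_E s (beta z) / of_real \<nu> ^ s))"

definition Im_approx :: "nat \<Rightarrow> real \<Rightarrow> complex \<Rightarrow> complex" where
  "Im_approx n \<nu> z = \<i> * of_real (sqrt (1 / (2 * pi * \<nu>))) * (1 / root4_z2m1 z) *
     exp (- of_real \<nu> * xi z + of_real (pi * \<nu> / 2) +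
          (\<Sum>s = 1..n - 1. (- 1) ^ s * LG_E s (beta z) / of_real \<nu> ^ s))"

text \<open>
  \<open>l\<close> is the value of \<open>f\<close> at the conjugate of a point \<open>z\<close> with \<open>0 \<le> arg z \<le> \<pi>\<close>, the argument of
  the conjugate being \<open>- arg z\<close>.  This matters only for \<open>arg z = \<pi>\<close>: there the principal branches
  at \<open>cnj z = z\<close> would be those of \<open>arg = \<pi>\<close>, and the limit from the lower half plane is needed.
\<close>

definition value_at_conjugate :: "(complex \<Rightarrow> complex) \<Rightarrow> complex \<Rightarrow> complex \<Rightarrow> bool" where
  "value_at_conjugate f z l \<longleftrightarrow>
     (if z \<in> \<real>\<^sub>\<le>\<^sub>0 then (f \<longlongrightarrow> l) (at z within {w. Im w < 0}) else f (cnj z) = l)"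

text \<open>Checks on the definitions.\<close>

lemma LG_E_Suc:
  assumes "s \<ge> 2"
  shows "LG_E (s + 1) b = 1 / 2 * b\<^sup>2 * (b\<^sup>2 + 1) * deriv (LG_E s) b +
     1 / 2 * contour_integral (linepath 0 b) (\<lambda>p. p\<^sup>2 * (p\<^sup>2 + 1) *
       (\<Sum>j = 1..s - 1. deriv (LG_E j) p * deriv (LG_E (s - j)) p))"
proof -
  obtain m where "s = m + 2" using assms by (metis le_add_diff_inverse2)
  then show ?thesis by (simp add: numeral_2_eq_2)
qed

lemma sqrt_z2m1_power2: "sqrt_z2m1 z ^ 2 = z ^ 2 - 1"
  by (simp add: sqrt_z2m1_def power_mult_distrib algebra_simps power2_eq_square[of z])

lemma xi_1: "xi 1 = 0"
  by (simp add: xi_def arcsec_def sqrt_z2m1_def)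

lemma xi_unit_interval:
  fixes x :: real
  assumes "0 < x" "x \<le> 1"
  shows "xi (of_real x) =
    - \<i> * of_real (ln ((1 + sqrt (1 - x\<^sup>2)) / x)) + \<i> * of_real (sqrt (1 - x\<^sup>2))"
proof -
  define r where "r = sqrt (1 - x\<^sup>2)"
  have x2: "0 < x\<^sup>2" "x\<^sup>2 \<le> 1" using assms by (auto simp: power_le_one)
  have r: "0 \<le> r" "r < 1" "r\<^sup>2 = 1 - x\<^sup>2"
    using x2 by (auto simp: r_def)
  have c1: "csqrt (of_real x - 1) = \<i> * of_real (sqrt (1 - x))"
  proof -
    have "of_real x - 1 = - complex_of_real (1 - x)" by simp
    then show ?thesis using assms csqrt_of_real_nonpos[of "x - 1"] by simp
  qed
  have c2: "csqrt (of_real x + 1) = of_real (sqrt (x + 1))"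
    using assms csqrt_of_real_nonneg[of "x + 1"] by simp
  have "sqrt (1 - x) * sqrt (x + 1) = r"
    by (simp add: r_def power2_eq_square algebra_simps flip: real_sqrt_mult)
  then have s: "sqrt_z2m1 (of_real x) = \<i> * of_real r"
    unfolding sqrt_z2m1_def c1 c2 by (metis mult.assoc of_real_mult)
  have "(1 + \<i> * sqrt_z2m1 (of_real x)) / of_real x = of_real ((1 - r) / x)"
    by (simp add: s flip: mult.assoc)
  moreover have "(1 - r) / x = inverse ((1 + r) / x)"
    using assms r by (simp add: field_simps power2_eq_square)
  moreover have "(1 + r) / x > 0" using assms r by simp
  ultimately have "Ln ((1 + \<i> * sqrt_z2m1 (of_real x)) / of_real x) = of_real (- ln ((1 + r) / x))"
    by (simp only: Ln_of_real ln_inverse inverse_positive_iff_positive)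
  then show ?thesis
    unfolding xi_def arcsec_def s r_def[symmetric] by simp
qed

lemma has_field_derivative_xi:
  assumes "Im z \<noteq> 0 \<or> Re z > 1"
  shows "(xi has_field_derivative sqrt_z2m1 z / z) (at z)"
proof -
  define r where "r = sqrt_z2m1 z"
  have r2: "r ^ 2 = z ^ 2 - 1" by (simp add: r_def sqrt_z2m1_power2)
  have n: "z \<noteq> 0" "z - 1 \<notin> \<real>\<^sub>\<le>\<^sub>0" "z + 1 \<notin> \<real>\<^sub>\<le>\<^sub>0" "z \<noteq> 1" "z \<noteq> - 1"
    using assms by (auto simp: complex_nonpos_Reals_iff)
  have r0: "r \<noteq> 0"
    using n by (auto simp: r_def sqrt_z2m1_def add_eq_0_iff2)
  have cs: "csqrt (z - 1) \<noteq> 0" "csqrt (z + 1) \<noteq> 0"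
    using n by (auto simp: add_eq_0_iff2)
  have d1: "(sqrt_z2m1 has_field_derivative z / r) (at z)"
  proof -
    have "((\<lambda>w. csqrt (w - 1)) has_field_derivative inverse (2 * csqrt (z - 1)) * 1) (at z)"
      by (rule DERIV_chain2[OF has_field_derivative_csqrt])
        (use n in \<open>auto intro!: derivative_eq_intros\<close>)
    moreover have "((\<lambda>w. csqrt (w + 1)) has_field_derivative inverse (2 * csqrt (z + 1)) * 1) (at z)"
      by (rule DERIV_chain2[OF has_field_derivative_csqrt])
        (use n in \<open>auto intro!: derivative_eq_intros\<close>)
    ultimately have d: "(sqrt_z2m1 has_field_derivative
        inverse (2 * csqrt (z - 1)) * 1 * csqrt (z + 1) +
        inverse (2 * csqrt (z + 1)) * 1 * csqrt (z - 1)) (at z)"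
      unfolding sqrt_z2m1_def[abs_def] by (rule DERIV_mult)
    define a b where "a = csqrt (z - 1)" and "b = csqrt (z + 1)"
    have ab: "a \<noteq> 0" "b \<noteq> 0" "a ^ 2 = z - 1" "b ^ 2 = z + 1"
      using cs by (auto simp: a_def b_def)
    have "inverse (2 * a) * 1 * b + inverse (2 * b) * 1 * a = (a ^ 2 + b ^ 2) / (2 * (a * b))"
      using ab(1,2) by (simp add: divide_simps power2_eq_square)
    also have "\<dots> = z / (a * b)" unfolding ab(3,4) by simp
    finally show ?thesis using d by (simp add: r_def sqrt_z2m1_def a_def b_def)
  qed
  have nl: "(1 + \<i> * r) / z \<notin> \<real>\<^sub>\<le>\<^sub>0"
  proof
    assume "(1 + \<i> * r) / z \<in> \<real>\<^sub>\<le>\<^sub>0"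
    then obtain c :: real where c: "(1 + \<i> * r) / z = of_real c" "c \<le> 0"
      by (auto elim: nonpos_Reals_cases)
    then have "\<i> * r = of_real c * z - 1" using n by (simp add: field_simps)
    then have "(\<i> * r) ^ 2 = (of_real c * z - 1) ^ 2" by simp
    then have "1 - z ^ 2 = (of_real c * z - 1) ^ 2"
      by (simp add: power_mult_distrib r2)
    then have "z * (of_real (c ^ 2 + 1) * z - of_real (2 * c)) = 0"
      by (simp add: algebra_simps power2_eq_square)
    then have "of_real (c ^ 2 + 1) * z = complex_of_real (2 * c)" using n by simp
    moreover have "c ^ 2 + 1 > 0" by (simp add: add_nonneg_pos)
    ultimately have "z = of_real (2 * c / (c ^ 2 + 1))"
      by (metis less_irrefl nonzero_mult_div_cancel_left of_real_divide of_real_eq_0_iff)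
    moreover have "2 * c / (c ^ 2 + 1) \<le> 1" using c \<open>c ^ 2 + 1 > 0\<close> by (simp add: divide_simps)
    ultimately show False using assms by simp
  qed
  have nz: "1 + \<i> * r \<noteq> 0" using nl by auto
  have d2: "((\<lambda>z. (1 + \<i> * sqrt_z2m1 z) / z) has_field_derivative
      ((\<i> * (z / r)) * z - (1 + \<i> * r)) / (z * z)) (at z)"
  proof -
    have "((\<lambda>z. 1 + \<i> * sqrt_z2m1 z) has_field_derivative 0 + \<i> * (z / r)) (at z)"
      by (intro DERIV_add DERIV_const DERIV_cmult d1)
    from DERIV_divide[OF this DERIV_ident n(1)] show ?thesis by (simp add: r_def)
  qed
  have d3: "(arcsec has_field_derivative - \<i> * (inverse ((1 + \<i> * r) / z) *
      (((\<i> * (z / r)) * z - (1 + \<i> * r)) / (z * z)))) (at z)"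
    unfolding arcsec_def[abs_def]
    using DERIV_cmult[OF DERIV_chain2[OF has_field_derivative_Ln d2], of "- \<i>"] nl
    by (simp add: r_def)
  have e1: "((\<i> * (z / r)) * z - (1 + \<i> * r)) / (z * z) = (\<i> - r) / (r * (z * z))"
  proof -
    have "((\<i> * (z / r)) * z - (1 + \<i> * r)) = (\<i> * (z ^ 2 - r ^ 2) - r) / r"
      using r0 by (simp add: field_simps power2_eq_square)
    then show ?thesis by (simp add: r2)
  qed
  have "- \<i> * (inverse ((1 + \<i> * r) / z) *
      (((\<i> * (z / r)) * z - (1 + \<i> * r)) / (z * z))) = 1 / (z * r)"
  proof -
    have "\<i> - r = \<i> * (1 + \<i> * r)" by (simp add: algebra_simps)
    moreover have "- \<i> * (inverse (c / z) * (\<i> * c / (r * (z * z)))) = 1 / (z * r)"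
      if "c \<noteq> 0" for c
      using that n(1) r0 by (simp add: field_simps)
    ultimately show ?thesis unfolding e1 using nz by simp
  qed
  with d3 have "(arcsec has_field_derivative 1 / (z * r)) (at z)" by simp
  from DERIV_diff[OF d1 this] have "(xi has_field_derivative z / r - 1 / (z * r)) (at z)"
    by (simp add: xi_def[abs_def])
  moreover have "z / r - 1 / (z * r) = (z ^ 2 - 1) / (z * r)"
    using n r0 by (simp add: field_simps power2_eq_square)
  moreover have "(z ^ 2 - 1) / (z * r) = r / z"
    unfolding r2[symmetric] using n r0 by (simp add: field_simps power2_eq_square)
  ultimately show ?thesis by (simp add: r_def)
qed

end

(* A solution w of the modified Bessel equation of order i nu, divided by the Liouville-Green factor
   (z^2-1)^(-1/4) exp(N xi + sum E_s / N^s) with N = nu or N = -nu, leaves a factor h which satisfies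
   h'' + 2 (N + T) h' + R h = 0 in the variable xi. The recursion for E_s says exactly that the residual R
   has order N^(1-n), and its absolute integral along the path is the Phi term. With eta = h - 1 and
   B = h' / (2 N), monotonicity of Re (N xi) along the path turns the equation into a Gronwall inequality
   for |eta + B| + |B|, which is the error bound as soon as eta and h' vanish at the reference point.

   It remains to normalise h at the reference points. For I at z = 0 this is read off from the power
   series. For K at infinity one needs I_{i nu}(x) ~ e^x / sqrt(2 pi x), which follows on the real axis by
   comparing the power series with that of cosh: its terms concentrate around the index x/2. The
   Wronskian gives the derivative of I_{-i nu} / I_{i nu}, hence the decay of K on the real axis. *)
theory Submission
  imports Defs
begin

section \<open>The coefficients\<close>

text \<open>Adding B to \<eta> removes the stiff term: since h' = 2 N B, the part 2 N h' of the
  equation cancels in (\<eta> + B)'. Thus \<eta> + B and B share one forcing D, and B has in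
  addition the damping - 2 N B, which cannot increase its modulus where Re (N \<xi>) grows. The
  estimate 2 |D| \<le> |R h| / |N| + 4 |T B| is the origin of the constants in \<open>Phi\<close>
  and \<open>Psi\<close>. Paths may run along the real axis, where the branches are one-sided, so
  calculus is done within the closed upper half plane; \<xi> enters through d\<xi> = (z^2 - 1)^(1/2)
  dz / z and is never inverted. The two I expansions are divided by their value at infinity, so the
  limit of h at 0 only has to exist and be nonzero. For K the constant must be explicit. K is a
  difference of two solutions of equal growth, so their leading terms cancel and the difference is
  recovered from the derivative of the quotient. A path from infinity merely has argument tending to
  0, so the limit on the real axis must be spread over a sector.\<close>

lemma contour_integral_linepath_primitive:
  assumes "f holomorphic_on UNIV"
  shows "((\<lambda>b. contour_integral (linepath a b) f) has_field_derivative f b) (at b)"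
proof -
  obtain F where F: "\<And>z. (F has_field_derivative f z) (at z)"
    using holomorphic_convex_primitive'[of UNIV f] assms by auto
  have "contour_integral (linepath a b) f = F b - F a" for b
    using contour_integral_primitive[of UNIV F f "linepath a b"] F
    by (auto intro!: contour_integral_unique)
  then show ?thesis using F by (auto intro!: derivative_eq_intros)
qed

text \<open>The recursion contains \<open>deriv\<close>, which is informative only where a
  derivative exists, so analyticity is carried through the induction: the integrand is entire, hence
  so is its integral from 0.\<close>

lemma holomorphic_LG_E: "LG_E s holomorphic_on UNIV"
proof (induction s rule: less_induct)
  case (less s)
  then have hol [holomorphic_intros]: "deriv (LG_E j) holomorphic_on UNIV" if "j < s" for j
    using that by (intro holomorphic_deriv) auto
  consider "s = 0" | "s = 1" | "s = 2" | m where "s = Suc (Suc (Suc m))"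
    by (metis One_nat_def numeral_2_eq_2 old.nat.exhaust)
  then show ?case
  proof cases
    case 4
    let ?f = "\<lambda>p. p\<^sup>2 * (p\<^sup>2 + 1) * (\<Sum>j = 1..m + 1. deriv (LG_E j) p * deriv (LG_E (m + 2 - j)) p)"
    have hol: "?f holomorphic_on UNIV"
      by (intro holomorphic_intros) (auto simp: 4)
    have "(\<lambda>b. contour_integral (linepath 0 b) ?f) holomorphic_on UNIV"
      unfolding holomorphic_on_def field_differentiable_def
      using has_field_derivative_at_within[OF contour_integral_linepath_primitive[OF hol, of 0]]
      by blast
    then show ?thesis unfolding 4 LG_E.simps
      by (intro holomorphic_intros) (auto simp: 4)
  qed (auto simp: numeral_2_eq_2 intro!: holomorphic_intros)
qed

lemma LG_E_has_deriv: "(LG_E s has_field_derivative deriv (LG_E s) b) (at b)"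
  using holomorphic_derivI[OF holomorphic_LG_E] by auto

lemma LG_E_0 [simp]: "LG_E s 0 = 0"
  by (induction s rule: LG_E.induct) (auto simp: numeral_2_eq_2)

lemma holomorphic_deriv_LG_E: "deriv (LG_E s) holomorphic_on UNIV"
  by (intro holomorphic_deriv holomorphic_LG_E) auto

lemma deriv_LG_E_has_deriv:
  "(deriv (LG_E s) has_field_derivative deriv (deriv (LG_E s)) b) (at b)"
  using holomorphic_derivI[OF holomorphic_deriv_LG_E] by auto

lemma deriv_LG_E_1: "deriv (LG_E 1) b = (5 * b\<^sup>2 + 1) / 8"
  by (rule DERIV_imp_deriv) (auto intro!: derivative_eq_intros simp: power2_eq_square field_simps)

text \<open>As d\<beta>/d\<xi> = \<open>- (b\<^sup>2 * (b\<^sup>2 + 1))\<close>, this is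
  dE_s/d\<xi>, that is \<open>LG_F\<close>, written as an entire function of \<beta> alone.\<close>

definition LG_G :: "nat \<Rightarrow> complex \<Rightarrow> complex" where
  "LG_G s b = - (b\<^sup>2 * (b\<^sup>2 + 1) * deriv (LG_E s) b)"

definition LG_G' :: "nat \<Rightarrow> complex \<Rightarrow> complex" where
  "LG_G' s b = - ((4 * b ^ 3 + 2 * b) * deriv (LG_E s) b + b\<^sup>2 * (b\<^sup>2 + 1) * deriv (deriv (LG_E s)) b)"

lemma LG_G_has_deriv: "(LG_G s has_field_derivative LG_G' s b) (at b)"
  unfolding LG_G_def[abs_def] LG_G'_def
  by (rule derivative_eq_intros deriv_LG_E_has_deriv refl)+ (auto simp: power2_eq_square power3_eq_cube algebra_simps)

text \<open>This is the defining recursion read in \<xi>. Differentiating it in b removes the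
  integral, and the factor \<open>b\<^sup>2 * (b\<^sup>2 + 1)\<close> turns b-derivatives into
  \<xi>-derivatives; the left side is dG_s/d\<xi>. The outcome is a Riccati equation sorted by
  powers of N.\<close>

lemma LG_G_recursion:
  assumes "s \<ge> 1"
  shows "- (b\<^sup>2 * (b\<^sup>2 + 1) * LG_G' s b) = - 2 * LG_G (Suc s) b - (\<Sum>j = 1..<s. LG_G j b * LG_G (s - j) b)"
\<comment> \<open>\<open>LG_E 2\<close> is given in closed form and not by the recursion, so the
  case \<open>s = 1\<close> is a direct check with an empty convolution.\<close>
proof (cases "s = 1")
  case True
  have "deriv (LG_E 2) b = 1 / 2 * ((4 * b ^ 3 + 2 * b) * deriv (LG_E 1) b + b\<^sup>2 * (b\<^sup>2 + 1) * (5 * b / 4))"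
    unfolding numeral_2_eq_2 LG_E.simps deriv_LG_E_1
    by (rule DERIV_imp_deriv)
      (auto intro!: derivative_eq_intros simp: power2_eq_square power3_eq_cube field_simps)
  moreover have "deriv (deriv (LG_E 1)) b = 5 * b / 4"
    unfolding deriv_LG_E_1[abs_def]
    by (rule DERIV_imp_deriv) (auto intro!: derivative_eq_intros)
  moreover have "Suc s = 2" "{1..<s} = {}" using True by auto
  moreover have "- (d * - e) = - 2 * - (d * (1 / 2 * e)) - 0" for d e :: complex by simp
  ultimately show ?thesis unfolding LG_G_def LG_G'_def True
    by (simp only: sum.empty)
next
  case False
  with assms have s: "s \<ge> 2" by simp
  let ?S = "\<lambda>p. \<Sum>j = 1..s - 1. deriv (LG_E j) p * deriv (LG_E (s - j)) p"
  let ?f = "\<lambda>p. p\<^sup>2 * (p\<^sup>2 + 1) * ?S p"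
  note [holomorphic_intros] = holomorphic_deriv_LG_E
  have hol: "?f holomorphic_on UNIV" by (intro holomorphic_intros)
  have "deriv (LG_E (Suc s)) b = - (1 / 2) * LG_G' s b + 1 / 2 * ?f b"
  proof (rule DERIV_imp_deriv)
    have "LG_E (Suc s) = (\<lambda>b. - (1 / 2) * LG_G s b + 1 / 2 * contour_integral (linepath 0 b) ?f)"
      using LG_E_Suc[OF s] by (auto simp: LG_G_def)
    then show "(LG_E (Suc s) has_field_derivative - (1 / 2) * LG_G' s b + 1 / 2 * ?f b) (at b)"
      by (simp only:) (intro DERIV_add DERIV_cmult LG_G_has_deriv contour_integral_linepath_primitive hol)
  qed
  moreover have "- 2 * - (d * (- (1 / 2) * x + 1 / 2 * (d * y))) = - (d * x) + d\<^sup>2 * y" for d x y :: complex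
    by (simp add: power2_eq_square algebra_simps)
  ultimately have "- 2 * LG_G (Suc s) b = - (b\<^sup>2 * (b\<^sup>2 + 1) * LG_G' s b) + (b\<^sup>2 * (b\<^sup>2 + 1))\<^sup>2 * ?S b"
    unfolding LG_G_def[of "Suc s"] by (simp only:)
  moreover have "(b\<^sup>2 * (b\<^sup>2 + 1))\<^sup>2 * ?S b = (\<Sum>j = 1..s - 1. LG_G j b * LG_G (s - j) b)"
    unfolding LG_G_def sum_distrib_left by (intro sum.cong) (auto simp: power2_eq_square)
  moreover have "{1..s - 1} = {1..<s}" using s by auto
  ultimately show ?thesis by simp
qed

text \<open>With \<open>dG\<^sub>s/d\<xi>\<close> eliminated by the recursion, this is the residual of the truncated
  Riccati equation satisfied by the logarithmic derivative of the approximant.\<close>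

lemma LG_residual:
  fixes N :: complex and G :: "nat \<Rightarrow> complex"
  assumes n: "n \<ge> 1" and N: "N \<noteq> 0"
    and rec: "\<And>s. s \<ge> 1 \<Longrightarrow> G' s = - 2 * G (Suc s) - (\<Sum>j = 1..<s. G j * G (s - j))"
  shows "(\<Sum>s = 1..n - 1. G' s / N ^ s) + 2 * N * (\<Sum>s = 1..n - 1. G s / N ^ s)
           + (\<Sum>s = 1..n - 1. G s / N ^ s)\<^sup>2 - 2 * G 1
       = (- 2 * G n + (\<Sum>s = 1..n - 1. 1 / N ^ s * (\<Sum>k = s..n - 1. G k * G (s + n - k - 1)))) / N ^ (n - 1)"
proof -
  define I where "I = {1..n - 1}"
  define t where "t = (\<lambda>(i, j). G i * G j / N ^ (i + j))"
  \<comment> \<open>A pair (i, j) with i + j \<ge> n is encoded by s = i + j + 1 - n and k = i; the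
    total power of N is then s + n - 1 = i + j.\<close>
  have high: "(\<Sum>s\<in>I. 1 / N ^ s * (\<Sum>k = s..n - 1. G k * G (s + n - k - 1))) / N ^ (n - 1) =
      sum t {(i, j) \<in> I \<times> I. i + j \<ge> n}"
  proof -
    have "(\<Sum>s\<in>I. 1 / N ^ s * (\<Sum>k = s..n - 1. G k * G (s + n - k - 1))) / N ^ (n - 1)
        = (\<Sum>s\<in>I. \<Sum>k = s..n - 1. G k * G (s + n - k - 1) / N ^ (s + n - 1))"
      unfolding sum_distrib_left sum_divide_distrib using n
      by (intro sum.cong refl) (auto simp flip: power_add simp: I_def)
    also have "\<dots> = (\<Sum>(s, k)\<in>(SIGMA s:I. {s..n - 1}). G k * G (s + n - k - 1) / N ^ (s + n - 1))"
      by (rule sum.Sigma) (auto simp: I_def)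
    also have "\<dots> = sum t {(i, j) \<in> I \<times> I. i + j \<ge> n}"
      by (rule sum.reindex_bij_witness[where i = "\<lambda>(i, j). (i + j + 1 - n, i)" and
            j = "\<lambda>(s, k). (k, s + n - k - 1)"]) (use n in \<open>auto simp: I_def t_def\<close>)
    finally show ?thesis .
  qed
  \<comment> \<open>The convolutions in the recursion supply exactly the products with i + j < n, so
    they cancel the low part of the square.\<close>
  have low: "(\<Sum>s\<in>I. (\<Sum>j = 1..<s. G j * G (s - j)) / N ^ s) = sum t {(i, j) \<in> I \<times> I. i + j < n}"
  proof -
    have "(\<Sum>s\<in>I. (\<Sum>j = 1..<s. G j * G (s - j)) / N ^ s) =
        (\<Sum>(s, j)\<in>(SIGMA s:I. {1..<s}). G j * G (s - j) / N ^ s)"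
      unfolding sum_divide_distrib by (intro sum.Sigma) (auto simp: I_def)
    also have "\<dots> = sum t {(i, j) \<in> I \<times> I. i + j < n}"
      by (rule sum.reindex_bij_witness[where i = "\<lambda>(i, j). (i + j, i)" and j = "\<lambda>(s, j). (j, s - j)"])
        (use n in \<open>auto simp: I_def t_def\<close>)
    finally show ?thesis .
  qed
  have "(\<Sum>s\<in>I. G s / N ^ s)\<^sup>2 = sum t (I \<times> I)"
    by (simp add: power2_eq_square sum_product sum.cartesian_product t_def power_add)
  also have "I \<times> I = {(i, j) \<in> I \<times> I. i + j < n} \<union> {(i, j) \<in> I \<times> I. i + j \<ge> n}" by auto
  also have "sum t \<dots> = sum t {(i, j) \<in> I \<times> I. i + j < n} + sum t {(i, j) \<in> I \<times> I. i + j \<ge> n}"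
    by (intro sum.union_disjoint finite_subset[OF _ finite_cartesian_product[of I I]]) (auto simp: I_def)
  finally have square: "(\<Sum>s\<in>I. G s / N ^ s)\<^sup>2 = \<dots>" .
  \<comment> \<open>Telescoping: \<open>- 2 * G (Suc s) / N ^ s\<close> cancels the term of index
    \<open>Suc s\<close> in the second sum, and \<open>- 2 * G 1\<close> cancels its first term, so
    only the last one survives.\<close>
  have "(\<Sum>s = 1..m. - 2 * G (Suc s) / N ^ s) + 2 * N * (\<Sum>s = 1..m. G s / N ^ s) - 2 * G 1
      = - 2 * G (Suc m) / N ^ m" for m
  proof (induction m)
    case (Suc m)
    have "2 * N * (G (Suc m) / N ^ Suc m) = 2 * G (Suc m) / N ^ m" using N by simp
    then show ?case using Suc by (simp add: distrib_left del: power_Suc) algebra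
  qed simp
  from this[of "n - 1"] have tele: "(\<Sum>s\<in>I. - 2 * G (Suc s) / N ^ s) + 2 * N * (\<Sum>s\<in>I. G s / N ^ s) - 2 * G 1
      = - 2 * G n / N ^ (n - 1)" using n by (simp add: I_def)
  have "(\<Sum>s\<in>I. G' s / N ^ s) = (\<Sum>s\<in>I. - 2 * G (Suc s) / N ^ s - (\<Sum>j = 1..<s. G j * G (s - j)) / N ^ s)"
    by (intro sum.cong refl) (simp add: rec I_def diff_divide_distrib)
  also have "\<dots> = (\<Sum>s\<in>I. - 2 * G (Suc s) / N ^ s) - sum t {(i, j) \<in> I \<times> I. i + j < n}"
    by (simp only: sum_subtractf low)
  finally have G': "(\<Sum>s\<in>I. G' s / N ^ s) = \<dots>" .
  show ?thesis
    unfolding I_def[symmetric] add_divide_distrib high square G' using tele by (simp add: algebra_simps)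
qed

section \<open>A Gronwall estimate along chains of arcs\<close>

text \<open>The finite set S takes up the corners of a chain of arcs; the fundamental theorem of
  calculus for the gauge integral tolerates it as long as f is continuous.\<close>

lemma nonincreasing_off_finite:
  fixes f :: "real \<Rightarrow> real"
  assumes "finite S" "a \<le> b" "continuous_on {a..b} f"
    and "\<And>x. x \<in> {a<..<b} - S \<Longrightarrow> (f has_real_derivative f' x) (at x)"
    and "\<And>x. x \<in> {a<..<b} - S \<Longrightarrow> f' x \<le> 0"
  shows "f b \<le> f a"
proof -
  define g where "g x = (if x \<in> {a<..<b} - S then f' x else 0)" for x
  have "(g has_integral f b - f a) {a..b}"
    by (rule fundamental_theorem_of_calculus_interior_strong[OF assms(1-2) _ assms(3)])
      (use assms(4) in \<open>auto simp: g_def has_real_derivative_iff_has_vector_derivative\<close>)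
  moreover have "g x \<le> 0" for x using assms(5) by (simp add: g_def)
  ultimately have "f b - f a \<le> 0"
    using has_integral_le[of g "f b - f a" "{a..b}" "\<lambda>_. 0" 0] by auto
  then show ?thesis by simp
qed

text \<open>The modulus is not differentiable at zeros of A. The summant
  \<open>\<delta>\<^sup>2\<close> smooths it, and the Gronwall argument makes \<delta> arbitrarily
  small.\<close>

lemma has_real_derivative_regularized_norm:
  fixes A :: "real \<Rightarrow> complex"
  assumes "(A has_vector_derivative D) (at x)" "\<delta> \<noteq> 0"
  shows "((\<lambda>x. sqrt ((cmod (A x))\<^sup>2 + \<delta>\<^sup>2)) has_real_derivative
           Re (cnj (A x) * D) / sqrt ((cmod (A x))\<^sup>2 + \<delta>\<^sup>2)) (at x)"
proof -
  have "((\<lambda>x. Re (A x)) has_real_derivative Re D) (at x)" "((\<lambda>x. Im (A x)) has_real_derivative Im D) (at x)"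
    using bounded_linear.has_vector_derivative[OF bounded_linear_Re assms(1)]
      bounded_linear.has_vector_derivative[OF bounded_linear_Im assms(1)]
    unfolding has_real_derivative_iff_has_vector_derivative by blast+
  from DERIV_add[OF DERIV_add[OF DERIV_power[OF this(1), of 2] DERIV_power[OF this(2), of 2]] DERIV_const[of "\<delta>\<^sup>2"]]
  have d: "((\<lambda>x. (Re (A x))\<^sup>2 + (Im (A x))\<^sup>2 + \<delta>\<^sup>2) has_real_derivative 2 * Re (cnj (A x) * D)) (at x)"
    by (simp add: algebra_simps)
  have pos: "(Re (A x))\<^sup>2 + (Im (A x))\<^sup>2 + \<delta>\<^sup>2 > 0"
    using assms(2) by (simp add: add_nonneg_pos)
  have d': "((\<lambda>x. sqrt ((Re (A x))\<^sup>2 + (Im (A x))\<^sup>2 + \<delta>\<^sup>2)) has_real_derivative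
      inverse (sqrt ((Re (A x))\<^sup>2 + (Im (A x))\<^sup>2 + \<delta>\<^sup>2)) / 2 * (2 * Re (cnj (A x) * D))) (at x)"
    by (rule DERIV_chain2[OF DERIV_real_sqrt[OF pos] d])
  have "inverse s / 2 * (2 * y) = y / s" for s y :: real by (simp add: inverse_eq_divide)
  then show ?thesis using d' unfolding cmod_power2 by metis
qed

text \<open>The term \<open>c x * B x\<close> has no counterpart in the bound: with
  \<open>Re (c x) \<ge> 0\<close> it points inwards and can only shrink the modulus of B, however
  large c is. What remains is that the sum of the moduli grows at most at rate 2 |D|.\<close>

lemma gronwall_pair:
  fixes A B :: "real \<Rightarrow> complex" and f k :: "real \<Rightarrow> real"
  assumes ab: "a \<le> b" and S: "finite S"
    and cont: "continuous_on {a..b} A" "continuous_on {a..b} B"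
    and int: "f integrable_on {a..b}" "k integrable_on {a..b}"
    and nonneg: "\<And>x. x \<in> {a..b} \<Longrightarrow> f x \<ge> 0" "\<And>x. x \<in> {a..b} \<Longrightarrow> k x \<ge> 0"
    and isCont: "\<And>x. x \<in> {a<..<b} - S \<Longrightarrow> isCont f x" "\<And>x. x \<in> {a<..<b} - S \<Longrightarrow> isCont k x"
    and A: "\<And>x. x \<in> {a<..<b} - S \<Longrightarrow> (A has_vector_derivative D x) (at x)"
    and B: "\<And>x. x \<in> {a<..<b} - S \<Longrightarrow> (B has_vector_derivative D x - c x * B x) (at x)"
    and c: "\<And>x. x \<in> {a<..<b} - S \<Longrightarrow> Re (c x) \<ge> 0"
    and D: "\<And>x. x \<in> {a<..<b} - S \<Longrightarrow> 2 * cmod (D x) \<le>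
              f x * (1 + cmod (A x) + cmod (B x)) + k x * (cmod (A x) + cmod (B x))"
  shows "cmod (A b) + cmod (B b) \<le>
    (cmod (A a) + cmod (B a) + integral {a..b} f) * exp (integral {a..b} f + integral {a..b} k)"
proof (rule field_le_epsilon)
  fix e :: real assume e: "e > 0"
  define F K where "F x = integral {a..x} f" and "K x = integral {a..x} k" for x
  define G where "G x = F x + K x" for x
  \<comment> \<open>Smoothing costs at most \<open>2 * \<delta>\<close> at the left end, which the
    factor \<open>exp (G b)\<close> enlarges to exactly e.\<close>
  define \<delta> where "\<delta> = e / (2 * exp (G b))"
  have \<delta>: "\<delta> > 0" using e by (simp add: \<delta>_def)
  define m where "m z = sqrt ((cmod z)\<^sup>2 + \<delta>\<^sup>2)" for z
  have m: "cmod z \<le> m z" "m z \<le> cmod z + \<delta>" "0 < m z" for z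
    using \<delta> by (auto simp: m_def real_le_rsqrt add_nonneg_pos intro!: real_le_lsqrt)
      (simp add: power2_eq_square algebra_simps)
  define u where "u x = m (A x) + m (B x)" for x
  \<comment> \<open>Integrating factor \<open>exp (- G)\<close> for the homogeneous part;
    subtracting F pays for the inhomogeneous term f, since \<open>exp (- G) \<le> 1\<close>.\<close>
  define \<Phi> where "\<Phi> x = u x * exp (- G x) - F x" for x
  have FK0: "F x \<ge> 0" "K x \<ge> 0" if "x \<in> {a..b}" for x
    using that nonneg unfolding F_def K_def by (auto intro!: integral_nonneg integrable_subinterval_real[OF int(1)] integrable_subinterval_real[OF int(2)])
  have contFK: "continuous_on {a..b} F" "continuous_on {a..b} K"
    unfolding F_def K_def by (auto intro!: indefinite_integral_continuous_1 int)
  have "\<Phi> b \<le> \<Phi> a"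
  proof (rule nonincreasing_off_finite[OF S ab])
    show "continuous_on {a..b} \<Phi>"
      unfolding \<Phi>_def u_def m_def G_def by (intro continuous_intros contFK cont)
  next
    fix x assume x: "x \<in> {a<..<b} - S"
    then have xab: "x \<in> {a..b}" and xo: "x \<in> {a<..<b}" by auto
    define u' where "u' = Re (cnj (A x) * D x) / m (A x) + Re (cnj (B x) * (D x - c x * B x)) / m (B x)"
    have u: "(u has_real_derivative u') (at x)"
      unfolding u_def u'_def m_def using \<delta>
      by (intro DERIV_add has_real_derivative_regularized_norm A B x) auto
    have F: "(F has_real_derivative f x) (at x)" and K: "(K has_real_derivative k x) (at x)"
      using integral_has_vector_derivative_continuous_at[OF int(1), of x "{}"]
        integral_has_vector_derivative_continuous_at[OF int(2), of x "{}"] isCont x xo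
      by (auto simp: F_def[abs_def] K_def[abs_def] has_real_derivative_iff_has_vector_derivative at_within_Icc_at
          continuous_at_imp_continuous_at_within)
    show "(\<Phi> has_real_derivative u' * exp (- G x) - u x * (f x + k x) * exp (- G x) - f x) (at x)"
      unfolding \<Phi>_def G_def by (auto intro!: derivative_eq_intros u F K simp: algebra_simps)
    have aux: "Re (cnj z * w) / m z \<le> cmod w" for z w
    proof -
      have "Re (cnj z * w) \<le> cmod z * cmod w" by (metis complex_Re_le_cmod norm_mult complex_mod_cnj)
      also have "\<dots> \<le> m z * cmod w" by (intro mult_right_mono m) auto
      finally show ?thesis using m(3)[of z] by (simp add: field_simps)
    qed
    \<comment> \<open>The damping contributes - Re c |B|^2 to half the derivative of |B|^2, so it
      may be dropped.\<close>
    have "Re (cnj (B x) * (D x - c x * B x)) = Re (cnj (B x) * D x) - Re (c x) * (cmod (B x))\<^sup>2"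
      unfolding cmod_power2 by (simp add: algebra_simps power2_eq_square)
    also have "\<dots> \<le> Re (cnj (B x) * D x)" using c[OF x] by simp
    finally have "Re (cnj (B x) * (D x - c x * B x)) / m (B x) \<le> Re (cnj (B x) * D x) / m (B x)"
      using m(3) by (intro divide_right_mono) (auto intro: less_imp_le)
    then have "u' \<le> 2 * cmod (D x)" unfolding u'_def using aux[of "A x" "D x"] aux[of "B x" "D x"] by linarith
    also have "\<dots> \<le> f x * (1 + u x) + k x * u x"
    proof -
      have "f x * (1 + cmod (A x) + cmod (B x)) \<le> f x * (1 + u x)"
        using nonneg[OF xab] m[of "A x"] m[of "B x"] by (intro mult_left_mono) (auto simp: u_def)
      moreover have "k x * (cmod (A x) + cmod (B x)) \<le> k x * u x"
        using nonneg[OF xab] m[of "A x"] m[of "B x"] by (intro mult_left_mono) (auto simp: u_def)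
      ultimately show ?thesis using D[OF x] by linarith
    qed
    finally have "u' - u x * (f x + k x) \<le> f x" by (simp add: algebra_simps)
    then have "(u' - u x * (f x + k x)) * exp (- G x) \<le> f x * exp (- G x)" by (intro mult_right_mono) auto
    also have "\<dots> \<le> f x" using nonneg[OF xab] FK0[OF xab] by (intro mult_left_le) (auto simp: G_def)
    finally show "u' * exp (- G x) - u x * (f x + k x) * exp (- G x) - f x \<le> 0" by (simp add: algebra_simps)
  qed
  moreover have "F a = 0" "G a = 0" by (auto simp: F_def K_def G_def)
  ultimately have "u b * exp (- G b) \<le> u a + F b" by (simp add: \<Phi>_def)
  then have "u b \<le> (u a + F b) * exp (G b)" by (simp add: exp_minus field_simps)
  moreover have "cmod (A b) + cmod (B b) \<le> u b" using m by (simp add: u_def add_mono)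
  moreover have "u a \<le> cmod (A a) + cmod (B a) + 2 * \<delta>" using m(2)[of "A a"] m(2)[of "B a"] by (simp add: u_def)
  ultimately have "cmod (A b) + cmod (B b) \<le> (cmod (A a) + cmod (B a) + 2 * \<delta> + F b) * exp (G b)"
    by (smt (verit) exp_gt_zero mult_right_mono)
  also have "\<dots> = (cmod (A a) + cmod (B a) + F b) * exp (G b) + e"
    by (simp add: \<delta>_def field_simps)
  finally show "cmod (A b) + cmod (B b) \<le>
    (cmod (A a) + cmod (B a) + integral {a..b} f) * exp (integral {a..b} f + integral {a..b} k) + e"
    by (simp add: F_def K_def G_def)
qed

section \<open>Regularity of chains of arcs\<close>

lemma R2_chain_continuous:
  assumes "R2_chain g"
  shows "continuous_on {0<..1} g"
proof -
  obtain m and p :: "nat \<Rightarrow> real" where p: "p 0 = 0" "p m = 1"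
    "\<And>i. i < m \<Longrightarrow> p i < p (Suc i) \<and> R2_arc_on g ({p i..p (Suc i)} - {0})"
    using assms unfolding R2_chain_def by auto
  have "0 \<le> p j \<and> continuous_on {0<..p j} g" if "j \<le> m" for j
    using that
  proof (induction j)
    case 0
    then show ?case by (simp add: p)
  next
    case (Suc j)
    have le: "0 \<le> p j" "p j < p (Suc j)" using Suc p(3)[of j] by auto
    have "R2_arc_on g ({p j..p (Suc j)} - {0})" using Suc.prems p(3)[of j] by simp
    then obtain g' where "\<And>x. x \<in> {p j..p (Suc j)} - {0} \<Longrightarrow>
        (g has_vector_derivative g' x) (at x within {p j..p (Suc j)} - {0})"
      unfolding R2_arc_on_def by blast
    from continuous_on_vector_derivative[OF this]
    have cont: "continuous_on {0<..p j} g" "continuous_on ({p j..p (Suc j)} - {0}) g"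
      using Suc by auto
    have "{0<..p (Suc j)} = {0<..p j} \<union> ({p j..p (Suc j)} - {0})" using le by auto
    moreover have "continuous_on ({0<..p j} \<union> ({p j..p (Suc j)} - {0})) g"
    proof (rule continuous_on_Un_local[OF _ _ cont])
      show "closedin (top_of_set ({0<..p j} \<union> ({p j..p (Suc j)} - {0}))) {0<..p j}"
        unfolding closedin_closed by (intro exI[of _ "{..p j}"]) (use le in auto)
      show "closedin (top_of_set ({0<..p j} \<union> ({p j..p (Suc j)} - {0}))) ({p j..p (Suc j)} - {0})"
        unfolding closedin_closed by (intro exI[of _ "{p j..}"]) (use le in auto)
    qed
    ultimately show ?case using le by auto
  qed
  from this[of m] show ?thesis by (simp add: p)
qed

text \<open>\<open>Phi\<close> and \<open>Psi\<close> integrate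
  \<open>vector_derivative g (at t)\<close>, which says nothing useful at a corner. Off the finitely
  many break points the derivatives of \<open>R2_arc_on\<close>, taken within a piece, are two-sided
  and agree with it.\<close>

lemma R2_chain_regular:
  assumes "R2_chain g"
  obtains S where "finite S"
    "\<And>t. t \<in> {0<..<1} - S \<Longrightarrow> (g has_vector_derivative vector_derivative g (at t)) (at t)"
    "\<And>t. t \<in> {0<..<1} - S \<Longrightarrow> isCont (\<lambda>t. vector_derivative g (at t)) t"
proof -
  obtain m and p :: "nat \<Rightarrow> real" where p: "p 0 = 0" "p m = 1"
    "\<And>i. i < m \<Longrightarrow> p i < p (Suc i) \<and> R2_arc_on g ({p i..p (Suc i)} - {0})"
    using assms unfolding R2_chain_def by auto
  have mono: "0 \<le> p j" if "j \<le> m" for j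
    using that
  proof (induction j)
    case (Suc j)
    then show ?case using p(3)[of j] by simp
  qed (simp add: p)
  have "\<exists>i<j. t \<in> {p i<..<p (Suc i)}" if t: "0 < t" "t \<notin> p ` {..m}" and "t < p j" "j \<le> m" for t j
    using that(3,4)
  proof (induction j)
    case 0
    then show ?case using t by (simp add: p)
  next
    case (Suc j)
    then have "t \<noteq> p j" using t(2) by auto
    then consider "t < p j" | "p j < t" by linarith
    then show ?case
    proof cases
      case 1
      then show ?thesis using Suc by (meson Suc_leD less_SucI)
    next
      case 2
      then show ?thesis using Suc.prems by (intro exI[of _ j]) simp
    qed
  qed
  from this[of _ m] have ex: "\<exists>i<m. t \<in> {p i<..<p (Suc i)}" if "0 < t" "t < 1" "t \<notin> p ` {..m}" for t
    using that p(2) by simp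
  have *: "(g has_vector_derivative vector_derivative g (at t)) (at t) \<and> isCont (\<lambda>t. vector_derivative g (at t)) t"
    if t: "t \<in> {0<..<1} - p ` {..m}" for t
  proof -
    obtain i where i: "i < m" "t \<in> {p i<..<p (Suc i)}" using ex t by auto
    define T U where "T = {p i..p (Suc i)} - {0}" and "U = {p i<..<p (Suc i)}"
    have "U \<subseteq> T" "open U" using mono[of i] i by (auto simp: T_def U_def)
    then have UT: "at x within T = at x" if "x \<in> U" for x
      using that by (meson at_within_interior interiorI)
    obtain g' g'' where g: "\<And>x. x \<in> T \<Longrightarrow> (g has_vector_derivative g' x) (at x within T)"
      "\<And>x. x \<in> T \<Longrightarrow> (g' has_vector_derivative g'' x) (at x within T)"
      using p(3)[OF i(1)] unfolding R2_arc_on_def T_def[symmetric] by blast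
    have vd: "vector_derivative g (at x) = g' x" if "x \<in> U" for x
      using g(1)[of x] UT[OF that] \<open>U \<subseteq> T\<close> that by (auto intro: vector_derivative_at)
    have tU: "t \<in> U" "t \<in> T" using i \<open>U \<subseteq> T\<close> by (auto simp: U_def)
    have "isCont g' t" using g(2)[OF tU(2)] UT[OF tU(1)] by (auto intro: has_vector_derivative_continuous)
    moreover have "eventually (\<lambda>x. x \<in> U) (nhds t)" using \<open>open U\<close> tU by (simp add: eventually_nhds_in_open)
    then have "eventually (\<lambda>x. vector_derivative g (at x) = g' x) (nhds t)" by eventually_elim (rule vd)
    ultimately have "isCont (\<lambda>t. vector_derivative g (at t)) t" by (simp add: isCont_cong)
    then show ?thesis using g(1)[OF tU(2)] UT[OF tU(1)] vd[OF tU(1)] by simp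
  qed
  show ?thesis by (rule that[of "p ` {..m}"]) (use * in auto)
qed

section \<open>Branches on the closed upper half plane\<close>

text \<open>On the cuts the branches are limits from above. Derivatives
  \<open>at z within upper\<close> treat interior points and the upper side of the cuts at
  once.\<close>

definition upper :: "complex set" where "upper = {z. Im z \<ge> 0}"

text \<open>Multiplication by \<open>- \<i>\<close> carries the punctured closed upper half plane
  into the closed right half plane, away from the cut of \<open>Ln\<close>; adding \<i> \<pi> / 2
  gives back \<open>Ln w\<close>, also for arg w = \<pi>.\<close>

lemma has_field_derivative_Ln_upper:
  assumes "z \<in> upper" "z \<noteq> 0"
  shows "(Ln has_field_derivative 1 / z) (at z within upper)"
proof (rule has_field_derivative_transform_within)
  have "- \<i> * z \<notin> \<real>\<^sub>\<le>\<^sub>0"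
    using assms by (auto simp: upper_def complex_nonpos_Reals_iff complex_eq_iff)
  then show "((\<lambda>w. Ln (- \<i> * w) + \<i> * pi / 2) has_field_derivative 1 / z) (at z within upper)"
    using assms(2) by (auto intro!: derivative_eq_intros simp: field_simps)
  show "Ln (- \<i> * w) + \<i> * pi / 2 = Ln w" if "w \<in> upper" "dist w z < dist 0 z" for w
    using that Ln_times_ii[of "- \<i> * w"] by (cases "w = 0") (auto simp: upper_def)
qed (use assms in auto)

lemma has_field_derivative_powr_upper:
  assumes "z \<in> upper" "z \<noteq> 0"
  shows "((\<lambda>w. w powr a) has_field_derivative a * z powr a / z) (at z within upper)"
proof (rule has_field_derivative_transform_within)
  show "((\<lambda>w. exp (a * Ln w)) has_field_derivative a * z powr a / z) (at z within upper)"
    using DERIV_chain'[OF DERIV_cmult[OF has_field_derivative_Ln_upper[OF assms], of a] DERIV_exp] assms(2)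
    by (simp add: powr_def mult_ac)
  show "exp (a * Ln w) = w powr a" if "w \<in> upper" "dist w z < dist 0 z" for w
    using that by (cases "w = 0") (auto simp: powr_def)
qed (use assms in auto)

lemma has_field_derivative_csqrt_upper:
  assumes "z \<in> upper" "z \<noteq> 0"
  shows "(csqrt has_field_derivative 1 / (2 * csqrt z)) (at z within upper)"
proof (rule has_field_derivative_transform_within)
  have "csqrt z / (2 * z) = 1 / (2 * csqrt z)"
    using assms power2_csqrt[of z] by (simp add: field_simps power2_eq_square)
  then show "((\<lambda>w. exp (Ln w / 2)) has_field_derivative 1 / (2 * csqrt z)) (at z within upper)"
    using DERIV_chain'[OF DERIV_cdivide[OF has_field_derivative_Ln_upper[OF assms], of 2] DERIV_exp] assms(2)
    by (simp add: csqrt_exp_Ln mult_ac)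
  show "exp (Ln w / 2) = csqrt w" if "w \<in> upper" "dist w z < dist 0 z" for w
    using that by (cases "w = 0") (auto simp: csqrt_exp_Ln)
qed (use assms in auto)

lemma has_field_derivative_shift_upper:
  assumes "(f has_field_derivative D) (at (z + c) within upper)" "c \<in> \<real>"
  shows "((\<lambda>w. f (w + c)) has_field_derivative D) (at z within upper)"
proof -
  have "(\<lambda>w. w + c) ` upper \<subseteq> upper" using assms(2) by (auto simp: upper_def complex_is_Real_iff)
  from has_field_derivative_subset[OF assms(1) this]
  have "(f \<circ> (\<lambda>w. w + c) has_field_derivative D * 1) (at z within upper)"
    by (rule DERIV_image_chain) (auto intro!: derivative_eq_intros)
  then show ?thesis by (simp add: o_def)
qed

lemma upper_shift: "z \<in> upper \<Longrightarrow> c \<in> \<real> \<Longrightarrow> z + c \<in> upper"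
  by (auto simp: upper_def complex_is_Real_iff)

lemma sqrt_z2m1_eq_0_iff [simp]: "sqrt_z2m1 z = 0 \<longleftrightarrow> z = 1 \<or> z = -1"
  by (auto simp: sqrt_z2m1_def add_eq_0_iff2)

lemma root4_z2m1_eq_0_iff [simp]: "root4_z2m1 z = 0 \<longleftrightarrow> z = 1 \<or> z = -1"
  by (auto simp: root4_z2m1_def add_eq_0_iff2)

lemma has_field_derivative_sqrt_z2m1:
  assumes "z \<in> upper" "z \<noteq> 1" "z \<noteq> -1"
  shows "(sqrt_z2m1 has_field_derivative z / sqrt_z2m1 z) (at z within upper)"
proof -
  define a b where "a = csqrt (z - 1)" and "b = csqrt (z + 1)"
  have ab: "a \<noteq> 0" "b \<noteq> 0" "a ^ 2 = z - 1" "b ^ 2 = z + 1"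
    using assms by (auto simp: a_def b_def add_eq_0_iff2)
  have "((\<lambda>w. csqrt (w + -1)) has_field_derivative 1 / (2 * a)) (at z within upper)"
    "((\<lambda>w. csqrt (w + 1)) has_field_derivative 1 / (2 * b)) (at z within upper)"
    unfolding a_def b_def diff_conv_add_uminus
    by (rule has_field_derivative_shift_upper[OF has_field_derivative_csqrt_upper];
        use assms upper_shift[OF assms(1), of 1] upper_shift[OF assms(1), of "-1"] in
          \<open>simp add: add_eq_0_iff2\<close>)+
  from DERIV_mult[OF this] have "(sqrt_z2m1 has_field_derivative 1 / (2 * a) * b + 1 / (2 * b) * a) (at z within upper)"
    by (simp add: sqrt_z2m1_def[abs_def] a_def b_def)
  moreover have "1 / (2 * a) * b + 1 / (2 * b) * a = (a ^ 2 + b ^ 2) / (2 * (a * b))"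
    using ab(1,2) by (simp add: divide_simps power2_eq_square)
  moreover have "\<dots> = z / (a * b)" unfolding ab(3,4) by simp
  ultimately show ?thesis by (simp add: sqrt_z2m1_def a_def b_def)
qed

lemma has_field_derivative_root4_z2m1:
  assumes "z \<in> upper" "z \<noteq> 1" "z \<noteq> -1"
  shows "(root4_z2m1 has_field_derivative root4_z2m1 z * z / (2 * (z\<^sup>2 - 1))) (at z within upper)"
proof -
  have nz: "z - 1 \<noteq> 0" "z + 1 \<noteq> 0" using assms by (auto simp: add_eq_0_iff2)
  define a b where "a = (z - 1) powr (1 / 4)" and "b = (z + 1) powr (1 / 4)"
  have "((\<lambda>w. (w + -1) powr (1 / 4)) has_field_derivative 1 / 4 * a / (z - 1)) (at z within upper)"
    "((\<lambda>w. (w + 1) powr (1 / 4)) has_field_derivative 1 / 4 * b / (z + 1)) (at z within upper)"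
    unfolding a_def b_def diff_conv_add_uminus
    by (rule has_field_derivative_shift_upper[OF has_field_derivative_powr_upper];
        use nz upper_shift[OF assms(1), of 1] upper_shift[OF assms(1), of "-1"] in simp)+
  from DERIV_mult[OF this]
  have "(root4_z2m1 has_field_derivative 1 / 4 * a / (z - 1) * b + 1 / 4 * b / (z + 1) * a) (at z within upper)"
    by (simp add: root4_z2m1_def[abs_def] a_def b_def)
  moreover have "1 / 4 * a / (z - 1) * b + 1 / 4 * b / (z + 1) * a = a * b * z / (2 * ((z - 1) * (z + 1)))"
  proof -
    have "1 / 4 * a / u * b + 1 / 4 * b / v * a = a * b * ((u + v) / 2) / (2 * (u * v))"
      if "u \<noteq> 0" "v \<noteq> 0" for u v using that by (simp add: field_simps)
    moreover have "((z - 1) + (z + 1)) / 2 = z" by simp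
    ultimately show ?thesis using nz by metis
  qed
  moreover have "(z - 1) * (z + 1) = z\<^sup>2 - 1" by (simp add: power2_eq_square algebra_simps)
  ultimately show ?thesis by (simp add: root4_z2m1_def a_def b_def)
qed

lemma has_field_derivative_beta:
  assumes "z \<in> upper" "z \<noteq> 1" "z \<noteq> -1"
  shows "(beta has_field_derivative - (z / sqrt_z2m1 z ^ 3)) (at z within upper)"
  unfolding beta_def[abs_def] using assms
  by (auto intro!: derivative_eq_intros has_field_derivative_sqrt_z2m1 simp: power3_eq_cube)

lemma Im_csqrt_nonneg: "w \<in> upper \<Longrightarrow> Im (csqrt w) \<ge> 0"
  by (auto simp: upper_def csqrt.simps complex_Re_le_cmod)

text \<open>Both square roots lie in the closed first quadrant, so the imaginary part of their
  product is nonnegative. The sign of the real part comes from Re r Im r = Re z Im z, the imaginary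
  part of r^2 = z^2 - 1; it serves the comparison of arguments in \<open>xi_upper\<close>.\<close>

lemma sqrt_z2m1_in_upper:
  assumes "z \<in> upper"
  shows "sqrt_z2m1 z \<in> upper" and "Re z < 0 \<Longrightarrow> Re (sqrt_z2m1 z) \<le> 0"
proof -
  define a b r where "a = csqrt (z - 1)" and "b = csqrt (z + 1)" and "r = sqrt_z2m1 z"
  have ab: "Im a \<ge> 0" "Im b \<ge> 0" "Re a \<ge> 0" "Re b \<ge> 0" "r = a * b"
    using Im_csqrt_nonneg[OF upper_shift[OF assms, of 1]] Im_csqrt_nonneg[OF upper_shift[OF assms, of "-1"]]
      Re_csqrt[of "z - 1"] Re_csqrt[of "z + 1"]
    unfolding a_def b_def r_def sqrt_z2m1_def diff_conv_add_uminus by (simp_all del: csqrt.simps)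
  then have "Im r \<ge> 0" by simp
  then show "sqrt_z2m1 z \<in> upper" by (simp add: r_def upper_def)
  assume "Re z < 0"
  have "Im (r ^ 2) = Im (z ^ 2)" by (simp add: r_def sqrt_z2m1_power2)
  then have *: "Re r * Im r = Re z * Im z" by (simp add: Im_power2)
  have "Re r \<le> 0"
  proof (cases "Im r = 0")
    case False
    have "Re r * Im r \<le> 0" using * assms \<open>Re z < 0\<close> by (simp add: upper_def mult_le_0_iff)
    then show ?thesis using False \<open>Im r \<ge> 0\<close> by (simp add: mult_le_0_iff)
  next
    case True
    with * \<open>Re z < 0\<close> have "Im z = 0" by simp
    then have z: "z - 1 = - of_real (1 - Re z)" by (simp add: complex_eq_iff)
    have "a = \<i> * sqrt (1 - Re z)"
      unfolding a_def z using \<open>Re z < 0\<close> csqrt_of_real_nonpos[of "Re z - 1"] by simp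
    then show ?thesis using ab by simp
  qed
  then show "Re (sqrt_z2m1 z) \<le> 0" by (simp add: r_def)
qed

lemma one_minus_i_sqrt_z2m1:
  assumes "z \<in> upper"
  shows "Re (1 - \<i> * sqrt_z2m1 z) \<ge> 1"
  using sqrt_z2m1_in_upper(1)[OF assms] by (simp add: upper_def)

text \<open>For -1 < z < 0 the argument of the logarithm in \<open>arcsec\<close> lies on the cut.
  With c = 1 - \<i> r one has (1 + \<i> r) c = z^2, so that argument is z / c. Since Re c \<ge> 1,
  splitting the logarithm leaves all boundary trouble in \<open>Ln z\<close>, which is
  differentiable within \<open>upper\<close>. It also isolates the logarithmic singularity of \<xi>
  at 0.\<close>

lemma xi_upper:
  assumes "z \<in> upper" "z \<noteq> 0"
  shows "xi z = sqrt_z2m1 z + \<i> * Ln z - \<i> * Ln (1 - \<i> * sqrt_z2m1 z)"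
proof -
  define r c where "r = sqrt_z2m1 z" and "c = 1 - \<i> * r"
  have c: "Re c \<ge> 1" using one_minus_i_sqrt_z2m1[OF assms(1)] by (simp add: c_def r_def)
  then have c0: "c \<noteq> 0" by auto
  have "(1 + \<i> * r) * c = 1 + r\<^sup>2" by (simp add: c_def power2_eq_square algebra_simps)
  also have "\<dots> = z\<^sup>2" by (simp add: r_def sqrt_z2m1_power2)
  finally have q: "(1 + \<i> * r) / z = z / c"
    using assms(2) c0 by (simp add: field_simps power2_eq_square)
  have Arg_c: "\<bar>Arg c\<bar> < pi / 2"
    using Re_Ln_pos_lt_imp[of c] c c0 by (simp add: Arg_eq_Im_Ln)
  have "Ln (z / c) = Ln z - Ln c"
  proof (rule Ln_unique)
    show "exp (Ln z - Ln c) = z / c" using assms(2) c0 by (simp add: exp_diff)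
    have z: "0 \<le> Arg z" "Arg z \<le> pi" using assms by (auto simp: upper_def Arg_le_pi Arg_less_0)
    then show "- pi < Im (Ln z - Ln c)" using Arg_c assms(2) c0 by (simp flip: Arg_eq_Im_Ln)
    \<comment> \<open>The bound is in danger only for Re z < 0, and there Im c = - Re r \<ge> 0
      makes Arg c nonnegative.\<close>
    have "Arg z - Arg c \<le> pi"
    proof (cases "Re z < 0")
      case True
      then have "Im c \<ge> 0" using sqrt_z2m1_in_upper(2)[OF assms(1)] by (simp add: c_def r_def)
      then have "0 \<le> Arg c" by (simp add: Arg_less_0)
      with z show ?thesis by simp
    next
      case False
      then have "Arg z \<le> pi / 2" using Re_Ln_pos_le[OF assms(2)] assms(2) by (simp add: Arg_eq_Im_Ln)
      with Arg_c show ?thesis by simp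
    qed
    then show "Im (Ln z - Ln c) \<le> pi" using assms(2) c0 by (simp flip: Arg_eq_Im_Ln)
  qed
  then show ?thesis by (simp add: xi_def arcsec_def q flip: r_def c_def) (simp add: algebra_simps)
qed

lemma has_field_derivative_xi_upper:
  assumes "z \<in> upper" "z \<notin> {0, 1, -1}"
  shows "(xi has_field_derivative sqrt_z2m1 z / z) (at z within upper)"
proof (rule has_field_derivative_transform_within)
  define r c where "r = sqrt_z2m1 z" and "c = 1 - \<i> * r"
  have nz: "r \<noteq> 0" "z \<noteq> 0" using assms by (auto simp: r_def)
  have c: "Re c \<ge> 1" using one_minus_i_sqrt_z2m1[OF assms(1)] by (simp add: c_def r_def)
  then have c0: "c \<noteq> 0" "c \<notin> \<real>\<^sub>\<le>\<^sub>0" by (auto simp: complex_nonpos_Reals_iff)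
  have D: "((\<lambda>z. sqrt_z2m1 z + \<i> * Ln z - \<i> * Ln (1 - \<i> * sqrt_z2m1 z)) has_field_derivative
      (z / r) + \<i> * (1 / z) - \<i> * (- (\<i> * (z / r)) / c)) (at z within upper)"
  proof (intro DERIV_diff DERIV_add DERIV_cmult)
    have sq: "(sqrt_z2m1 has_field_derivative z / r) (at z within upper)"
      using has_field_derivative_sqrt_z2m1 assms by (simp add: r_def)
    then show "(sqrt_z2m1 has_field_derivative z / r) (at z within upper)" .
    show "(Ln has_field_derivative 1 / z) (at z within upper)"
      using has_field_derivative_Ln_upper assms by simp
    show "((\<lambda>z. Ln (1 - \<i> * sqrt_z2m1 z)) has_field_derivative - (\<i> * (z / r)) / c) (at z within upper)"
      using c0 unfolding c_def r_def
      by (auto intro!: derivative_eq_intros sq[unfolded r_def] simp: divide_inverse)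
  qed
  have "(1 + \<i> * r) * c = z\<^sup>2"
    by (simp add: c_def r_def power2_eq_square algebra_simps) (simp add: sqrt_z2m1_power2 flip: power2_eq_square)
  have "(z / r) + \<i> * (1 / z) - \<i> * (- (\<i> * (z / r)) / c) = (z\<^sup>2 * (c - 1) + \<i> * r * c) / (z * r * c)"
    using nz c0 by (simp add: divide_simps power2_eq_square) (simp add: algebra_simps)
  also have "z\<^sup>2 * (c - 1) + \<i> * r * c = r\<^sup>2 * c"
    unfolding \<open>_ = z\<^sup>2\<close>[symmetric] by (simp add: c_def power2_eq_square algebra_simps)
  also have "r\<^sup>2 * c / (z * r * c) = r / z" using nz c0 by (simp add: power2_eq_square)
  finally show "((\<lambda>z. sqrt_z2m1 z + \<i> * Ln z - \<i> * Ln (1 - \<i> * sqrt_z2m1 z)) has_field_derivative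
      sqrt_z2m1 z / z) (at z within upper)" using D by (simp add: r_def)
  show "sqrt_z2m1 w + \<i> * Ln w - \<i> * Ln (1 - \<i> * sqrt_z2m1 w) = xi w"
    if "w \<in> upper" "dist w z < dist 0 z" for w
    using that xi_upper[of w] by (cases "w = 0") auto
qed (use assms in auto)

lemma beta_sqrt:
  assumes "z \<noteq> 1" "z \<noteq> -1"
  shows "beta z ^ 2 * (beta z ^ 2 + 1) = z\<^sup>2 / (z\<^sup>2 - 1)\<^sup>2"
proof -
  have b: "beta z ^ 2 = 1 / (z\<^sup>2 - 1)" by (simp add: beta_def power_divide sqrt_z2m1_power2)
  have "z\<^sup>2 - 1 \<noteq> 0" using assms by (simp add: power2_eq_1_iff)
  then show ?thesis unfolding b by (simp add: field_simps power2_eq_square)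
qed

section \<open>The differential equation of the error factor\<close>

lemma LG_F_eq:
  assumes "z \<noteq> 1" "z \<noteq> -1"
  shows "LG_F s z = LG_G s (beta z)"
  unfolding LG_F_def LG_G_def beta_sqrt[OF assms] by simp

text \<open>The z-derivative is written as d\<xi>/dz = \<open>sqrt_z2m1 z / z\<close> times a
  \<xi>-derivative. Keeping this shape everywhere allows calculation in \<xi> with z as the actual
  variable.\<close>

lemma has_field_derivative_LG_beta:
  assumes "z \<in> upper" "z \<notin> {0, 1, -1}"
  assumes f: "(f has_field_derivative f') (at (beta z))"
  shows "((\<lambda>z. f (beta z)) has_field_derivative sqrt_z2m1 z / z * - ((beta z)\<^sup>2 * ((beta z)\<^sup>2 + 1) * f')) (at z within upper)"
proof -
  define r where "r = sqrt_z2m1 z"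
  have r: "r \<noteq> 0" "z \<noteq> 0" "z\<^sup>2 - 1 = r\<^sup>2" using assms by (auto simp: r_def sqrt_z2m1_power2)
  have "sqrt_z2m1 z / z * - ((beta z)\<^sup>2 * ((beta z)\<^sup>2 + 1) * f') = - (z / r ^ 3) * f'"
    using assms(2) r by (simp add: beta_sqrt r(3) flip: r_def)
      (simp add: field_simps eval_nat_numeral)
  moreover have "((\<lambda>z. f (beta z)) has_field_derivative f' * - (z / r ^ 3)) (at z within upper)"
    using DERIV_chain'[OF has_field_derivative_beta f] assms(1,2) by (auto simp: r_def mult.commute)
  ultimately show ?thesis by (simp add: mult.commute)
qed

text \<open>The \<xi>-derivative of the truncated sum of E_s / N^s; \<open>N + LG_T n N z\<close> is
  the logarithmic derivative of the exponential in the Liouville-Green factor.\<close>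

definition LG_T :: "nat \<Rightarrow> complex \<Rightarrow> complex \<Rightarrow> complex" where
  "LG_T n N z = (\<Sum>s = 1..n - 1. LG_G s (beta z) / N ^ s)"

text \<open>The reciprocal of the Liouville-Green factor, so that the error factor h is the product
  \<open>w z * LG_V n N z\<close>.\<close>

definition LG_V :: "nat \<Rightarrow> complex \<Rightarrow> complex \<Rightarrow> complex" where
  "LG_V n N z = root4_z2m1 z * exp (- (N * xi z) - (\<Sum>s = 1..n - 1. LG_E s (beta z) / N ^ s))"

definition LG_R :: "nat \<Rightarrow> complex \<Rightarrow> complex \<Rightarrow> complex" where
  "LG_R n N z = (- 2 * LG_G n (beta z) + (\<Sum>s = 1..n - 1. 1 / N ^ s *
     (\<Sum>k = s..n - 1. LG_G k (beta z) * LG_G (s + n - k - 1) (beta z)))) / N ^ (n - 1)"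

text \<open>This is dh/d\<xi>, where w1 is the z-derivative of w:
  \<open>z / sqrt_z2m1 z * w1 z\<close> is dw/d\<xi>, and
  \<open>z\<^sup>2 / (2 * sqrt_z2m1 z ^ 3)\<close> is the logarithmic \<xi>-derivative of
  \<open>root4_z2m1\<close>.\<close>

definition LG_p :: "nat \<Rightarrow> complex \<Rightarrow> (complex \<Rightarrow> complex) \<Rightarrow> (complex \<Rightarrow> complex) \<Rightarrow> complex \<Rightarrow> complex" where
  "LG_p n N w w1 z = LG_V n N z * (z / sqrt_z2m1 z * w1 z +
     w z * (z\<^sup>2 / (2 * sqrt_z2m1 z ^ 3) - (N + LG_T n N z)))"

lemma LG_V_nonzero: "z \<noteq> 1 \<Longrightarrow> z \<noteq> -1 \<Longrightarrow> LG_V n N z \<noteq> 0"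
  by (simp add: LG_V_def)

lemma has_field_derivative_LG_V:
  assumes "z \<in> upper" "z \<notin> {0, 1, -1}"
  shows "(LG_V n N has_field_derivative LG_V n N z *
     (sqrt_z2m1 z / z * (z\<^sup>2 / (2 * sqrt_z2m1 z ^ 3) - (N + LG_T n N z)))) (at z within upper)"
proof -
  define r where "r = sqrt_z2m1 z"
  have r: "r \<noteq> 0" "z \<noteq> 0" "z\<^sup>2 - 1 = r\<^sup>2" using assms by (auto simp: r_def sqrt_z2m1_power2)
  have E: "((\<lambda>z. LG_E s (beta z)) has_field_derivative r / z * LG_G s (beta z)) (at z within upper)" for s
    using has_field_derivative_LG_beta[OF assms LG_E_has_deriv] by (simp add: LG_G_def r_def)
  have "((\<lambda>z. \<Sum>s = 1..n - 1. LG_E s (beta z) / N ^ s) has_field_derivative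
      (\<Sum>s = 1..n - 1. r / z * LG_G s (beta z) / N ^ s)) (at z within upper)"
    by (intro DERIV_sum DERIV_cdivide E)
  then have "((\<lambda>z. \<Sum>s = 1..n - 1. LG_E s (beta z) / N ^ s) has_field_derivative
      r / z * LG_T n N z) (at z within upper)"
    by (simp add: LG_T_def sum_distrib_left)
  moreover have "(xi has_field_derivative r / z) (at z within upper)"
    using has_field_derivative_xi_upper[OF assms] by (simp add: r_def)
  ultimately have "((\<lambda>z. - (N * xi z) - (\<Sum>s = 1..n - 1. LG_E s (beta z) / N ^ s)) has_field_derivative
      - (N * (r / z)) - r / z * LG_T n N z) (at z within upper)"
    by (intro DERIV_diff DERIV_minus DERIV_cmult)
  from DERIV_mult[OF has_field_derivative_root4_z2m1 DERIV_chain'[OF this DERIV_exp]]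
  have "(LG_V n N has_field_derivative (root4_z2m1 z * z / (2 * r\<^sup>2)) * exp (- (N * xi z) - (\<Sum>s = 1..n - 1. LG_E s (beta z) / N ^ s))
     + exp (- (N * xi z) - (\<Sum>s = 1..n - 1. LG_E s (beta z) / N ^ s)) * (- (N * (r / z)) - r / z * LG_T n N z) * root4_z2m1 z) (at z within upper)"
    unfolding LG_V_def[abs_def] using assms r(3) by simp
  moreover have "r / z * (z\<^sup>2 / (2 * r ^ 3)) = z / (2 * r\<^sup>2)"
    using r by (simp add: power2_eq_square power3_eq_cube)
  then have "x * z / (2 * r\<^sup>2) * e + e * (- (N * (r / z)) - r / z * T) * x =
     x * e * (r / z * (z\<^sup>2 / (2 * r ^ 3) - (N + T)))" for x e T
    unfolding right_diff_distrib by (simp add: algebra_simps add_divide_distrib)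
  ultimately show ?thesis by (simp add: LG_V_def r_def)
qed

text \<open>The equation of w(z) = I(\<nu> z) for order \<plusminus> \<i> \<nu>, as a first-order
  system. The derivative w1 is carried explicitly because at boundary points it is one-sided. Only
  the square of N occurs, so one solution can be studied with N = \<nu> and with N = -
  \<nu>.\<close>

definition bessel_system :: "complex \<Rightarrow> (complex \<Rightarrow> complex) \<Rightarrow> (complex \<Rightarrow> complex) \<Rightarrow> bool" where
  "bessel_system N w w1 \<longleftrightarrow> (\<forall>z\<in>upper - {0}. (w has_field_derivative w1 z) (at z within upper) \<and>
     (w1 has_field_derivative N\<^sup>2 * (1 - 1 / z\<^sup>2) * w z - w1 z / z) (at z within upper))"

lemma has_field_derivative_LG_h:
  assumes "bessel_system N w w1" "z \<in> upper" "z \<notin> {0, 1, -1}"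
  shows "((\<lambda>z. w z * LG_V n N z) has_field_derivative sqrt_z2m1 z / z * LG_p n N w w1 z) (at z within upper)"
proof -
  have "(w has_field_derivative w1 z) (at z within upper)"
    using assms by (auto simp: bessel_system_def)
  from DERIV_mult[OF this has_field_derivative_LG_V[OF assms(2,3)]]
  show ?thesis
  proof (rule DERIV_cong)
    have "sqrt_z2m1 z / z * (z / sqrt_z2m1 z) = 1" using assms(3) by auto
    then show "w1 z * LG_V n N z + LG_V n N z * (sqrt_z2m1 z / z * (z\<^sup>2 / (2 * sqrt_z2m1 z ^ 3) - (N + LG_T n N z))) * w z
      = sqrt_z2m1 z / z * LG_p n N w w1 z"
      unfolding LG_p_def by algebra
  qed
qed

text \<open>In \<xi> the product W of \<open>root4_z2m1\<close> and w satisfies W'' = (N^2 + 2 G_1)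
  W. The function N + T solves the Riccati equation of W up to the residual R, and dividing W by the
  exponential leaves the stated equation for h.\<close>

lemma has_field_derivative_LG_p:
  assumes w: "bessel_system N w w1" and z: "z \<in> upper" "z \<notin> {0, 1, -1}" and n: "n \<ge> 1" and N: "N \<noteq> 0"
  shows "(LG_p n N w w1 has_field_derivative sqrt_z2m1 z / z *
     (- 2 * (N + LG_T n N z) * LG_p n N w w1 z - LG_R n N z * (w z * LG_V n N z))) (at z within upper)"
proof -
  define r where "r = sqrt_z2m1 z"
  have r: "r \<noteq> 0" "z \<noteq> 0" "r\<^sup>2 = z\<^sup>2 - 1" using z by (auto simp: r_def sqrt_z2m1_power2)
  define q zr c V T where "q = r / z" and "zr = z / r" and "c = z\<^sup>2 / (2 * r ^ 3)"
    and "V = LG_V n N z" and "T = LG_T n N z"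
  define G where "G s = LG_G s (beta z)" for s
  define G' where "G' s = - ((beta z)\<^sup>2 * ((beta z)\<^sup>2 + 1) * LG_G' s (beta z))" for s
  define T' where "T' = (\<Sum>s = 1..n - 1. G' s / N ^ s)"
  have dr: "(sqrt_z2m1 has_field_derivative zr) (at z within upper)"
    using has_field_derivative_sqrt_z2m1 z by (simp add: zr_def r_def)
  have dw: "(w has_field_derivative w1 z) (at z within upper)"
     "(w1 has_field_derivative N\<^sup>2 * (1 - 1 / z\<^sup>2) * w z - w1 z / z) (at z within upper)"
    using w z by (auto simp: bessel_system_def)
  have dG: "((\<lambda>z. LG_G s (beta z)) has_field_derivative q * G' s) (at z within upper)" for s
    using has_field_derivative_LG_beta[OF z LG_G_has_deriv] by (simp add: G'_def q_def r_def)
  have dT: "(LG_T n N has_field_derivative q * T') (at z within upper)"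
  proof -
    have "(LG_T n N has_field_derivative (\<Sum>s = 1..n - 1. q * G' s / N ^ s)) (at z within upper)"
      unfolding LG_T_def[abs_def] by (intro DERIV_sum DERIV_cdivide dG)
    then show ?thesis by (simp add: T'_def sum_distrib_left)
  qed
  have dzr: "((\<lambda>z. z / sqrt_z2m1 z) has_field_derivative - 1 / r ^ 3) (at z within upper)"
  proof (rule DERIV_cong)
    show "((\<lambda>z. z / sqrt_z2m1 z) has_field_derivative (1 * sqrt_z2m1 z - z * zr) / (sqrt_z2m1 z * sqrt_z2m1 z)) (at z within upper)"
      by (intro DERIV_divide DERIV_ident dr) (use r in \<open>simp add: r_def\<close>)
    have "(r - z * (z / r)) / (r * r) = (r\<^sup>2 - z\<^sup>2) / r ^ 3"
      using r by (simp add: field_simps power2_eq_square power3_eq_cube)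
    also have "r\<^sup>2 - z\<^sup>2 = - 1" using r by simp
    finally show "(1 * sqrt_z2m1 z - z * zr) / (sqrt_z2m1 z * sqrt_z2m1 z) = - 1 / r ^ 3"
      by (simp add: zr_def flip: r_def)
  qed
  have dc: "((\<lambda>z. z\<^sup>2 / (2 * sqrt_z2m1 z ^ 3)) has_field_derivative z / r ^ 3 - 3 * z ^ 3 / (2 * r ^ 5)) (at z within upper)"
  proof (rule DERIV_cong)
    have a: "((\<lambda>z. z\<^sup>2) has_field_derivative 2 * z) (at z within upper)"
      by (auto intro!: derivative_eq_intros)
    have b: "((\<lambda>z. 2 * sqrt_z2m1 z ^ 3) has_field_derivative 2 * (3 * r\<^sup>2 * zr)) (at z within upper)"
      using DERIV_cmult[OF DERIV_power[OF dr, of 3], of 2] by (simp add: r_def mult_ac)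
    have "2 * sqrt_z2m1 z ^ 3 \<noteq> 0" using r by (simp add: r_def)
    from DERIV_divide[OF a b this] show "((\<lambda>z. z\<^sup>2 / (2 * sqrt_z2m1 z ^ 3)) has_field_derivative
      (2 * z * (2 * sqrt_z2m1 z ^ 3) - z\<^sup>2 * (2 * (3 * r\<^sup>2 * zr))) / ((2 * sqrt_z2m1 z ^ 3) * (2 * sqrt_z2m1 z ^ 3))) (at z within upper)"
      .
    show "(2 * z * (2 * sqrt_z2m1 z ^ 3) - z\<^sup>2 * (2 * (3 * r\<^sup>2 * zr))) / ((2 * sqrt_z2m1 z ^ 3) * (2 * sqrt_z2m1 z ^ 3))
        = z / r ^ 3 - 3 * z ^ 3 / (2 * r ^ 5)"
      unfolding zr_def r_def[symmetric] using r(1) by (simp add: field_simps eval_nat_numeral)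
  qed
  have dV: "(LG_V n N has_field_derivative V * (q * (c - (N + T)))) (at z within upper)"
    using has_field_derivative_LG_V[OF z] by (simp add: V_def q_def c_def T_def r_def)
  have G1: "2 * G 1 = - (z\<^sup>2 * (z\<^sup>2 + 4) / (4 * r ^ 6))"
  proof -
    have "(beta z)\<^sup>2 = 1 / r\<^sup>2" by (simp add: beta_def power_divide r_def)
    then have "2 * G 1 = - (1 / r\<^sup>2 * (1 / r\<^sup>2 + 1) * (5 * (1 / r\<^sup>2) + 1) / 4)"
      unfolding G_def LG_G_def deriv_LG_E_1 by simp
    also have "\<dots> = - ((r\<^sup>2 + 1) * (5 + r\<^sup>2) / (4 * r ^ 6))"
      using r(1) by (simp add: field_simps eval_nat_numeral)
    also have "(r\<^sup>2 + 1) * (5 + r\<^sup>2) = z\<^sup>2 * (z\<^sup>2 + 4)" unfolding r(3) by (simp add: algebra_simps)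
    finally show ?thesis .
  qed
  \<comment> \<open>The defect of N + T in the Riccati equation y' + y^2 = N^2 + 2 G_1.\<close>
  have "T' + 2 * N * T + T\<^sup>2 - 2 * G 1 = LG_R n N z"
    unfolding T'_def T_def LG_T_def LG_R_def G_def[symmetric]
    by (rule LG_residual[OF n N]) (simp only: G'_def G_def LG_G_recursion)
  then have R: "LG_R n N z = T' + (N + T)\<^sup>2 - N\<^sup>2 - 2 * G 1"
    by (simp add: power2_eq_square algebra_simps)
  have zrq: "zr * q = 1" using r by (simp add: zr_def q_def)
  \<comment> \<open>In \<xi> this reads c' + c^2 = 2 G_1, c being the logarithmic derivative of
    \<open>root4_z2m1\<close>. Hence 2 G_1 is the potential of the Liouville normal form, which is
    how E_1 is determined.\<close>
  have k: "z / r ^ 3 - 3 * z ^ 3 / (2 * r ^ 5) = q * (2 * G 1 - c\<^sup>2)"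
  proof -
    have "q * (2 * G 1 - c\<^sup>2) = - (z * (2 * z\<^sup>2 + 4) / (4 * r ^ 5))"
      unfolding G1 q_def c_def using r(1,2) by (simp add: field_simps eval_nat_numeral)
    also have "\<dots> = - z / r ^ 5 - z ^ 3 / (2 * r ^ 5)"
      using r(1) by (simp add: field_simps eval_nat_numeral)
    also have "- z = z * (r\<^sup>2 - z\<^sup>2)" using r(3) by algebra
    also have "z * (r\<^sup>2 - z\<^sup>2) / r ^ 5 - z ^ 3 / (2 * r ^ 5) = z / r ^ 3 - 3 * z ^ 3 / (2 * r ^ 5)"
      using r(1) by (simp add: field_simps eval_nat_numeral)
    finally show ?thesis by simp
  qed
  \<comment> \<open>This makes - 2 c the coefficient of dw/d\<xi> in the equation for w, the amount
    that the factor \<open>root4_z2m1\<close> removes.\<close>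
  have w1c: "- 1 / r ^ 3 - 1 / r + 2 * c = 0"
  proof -
    have "- 1 / r ^ 3 - 1 / r + 2 * c = (- 1 - r\<^sup>2 + z\<^sup>2) / r ^ 3"
      unfolding c_def using r(1) by (simp add: field_simps eval_nat_numeral)
    then show ?thesis using r(3) by simp
  qed
  have q2: "1 - 1 / z\<^sup>2 = q\<^sup>2"
    using r by (simp add: q_def power_divide diff_divide_distrib)
  have "(LG_p n N w w1 has_field_derivative V * (q * (c - (N + T))) * (zr * w1 z + w z * (c - (N + T))) +
      (- 1 / r ^ 3 * w1 z + (N\<^sup>2 * (1 - 1 / z\<^sup>2) * w z - w1 z / z) * zr +
        (w1 z * (c - (N + T)) + (z / r ^ 3 - 3 * z ^ 3 / (2 * r ^ 5) - (0 + q * T')) * w z)) * V) (at z within upper)"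
    unfolding LG_p_def[abs_def] V_def zr_def c_def T_def r_def[symmetric]
    unfolding r_def zr_def[symmetric]
    using DERIV_mult[OF dV DERIV_add[OF DERIV_mult[OF dzr dw(2)] DERIV_mult[OF dw(1) DERIV_diff[OF dc DERIV_add[OF DERIV_const dT]]]]]
    by (simp add: V_def c_def T_def r_def zr_def)
  then show ?thesis
  proof (rule DERIV_cong)
    have "w1 z / z * zr = w1 z / r" using r by (simp add: zr_def)
    then have e: "- 1 / r ^ 3 * w1 z + (N\<^sup>2 * q\<^sup>2 * w z - w1 z / z) * zr = - 2 * c * w1 z + N\<^sup>2 * q * w z"
      using w1c zrq by algebra
    show "V * (q * (c - (N + T))) * (zr * w1 z + w z * (c - (N + T))) +
      (- 1 / r ^ 3 * w1 z + (N\<^sup>2 * (1 - 1 / z\<^sup>2) * w z - w1 z / z) * zr +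
        (w1 z * (c - (N + T)) + (z / r ^ 3 - 3 * z ^ 3 / (2 * r ^ 5) - (0 + q * T')) * w z)) * V =
      sqrt_z2m1 z / z * (- 2 * (N + LG_T n N z) * LG_p n N w w1 z - LG_R n N z * (w z * LG_V n N z))"
      unfolding q2 e k LG_p_def R r_def[symmetric]
      unfolding c_def[symmetric] q_def[symmetric] zr_def[symmetric] T_def[symmetric] V_def[symmetric]
      using zrq by algebra
  qed
qed

section \<open>Propagation of the error bound along a curve\<close>

definition LG_domain :: "complex set" where "LG_domain = upper - {0, 1, -1}"

text \<open>At the point z of a path with velocity v this is the integrand of \<open>Phi\<close>
  including the prefactor of the bound; \<open>psi_density\<close> plays the same role for
  \<open>Psi\<close>.\<close>

definition phi_density :: "nat \<Rightarrow> real \<Rightarrow> complex \<Rightarrow> complex \<Rightarrow> real" where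
  "phi_density n \<nu> z v = 1 / \<nu> ^ n *
     (2 * cmod (1 / z * sqrt_z2m1 z * LG_F n z * v) +
      (\<Sum>s = 1..n - 1. 1 / \<nu> ^ s * (\<Sum>k = s..n - 1.
        cmod (1 / z * sqrt_z2m1 z * LG_F k z * LG_F (s + n - k - 1) z * v))))"

definition psi_density :: "nat \<Rightarrow> real \<Rightarrow> complex \<Rightarrow> complex \<Rightarrow> real" where
  "psi_density n \<nu> z v = 1 / \<nu> *
     (4 * (\<Sum>s = 0..n - 2. 1 / \<nu> ^ s * cmod (1 / z * sqrt_z2m1 z * LG_F (s + 1) z * v)))"

text \<open>With B = \<open>LG_p n N w w1 z / (2 * N)\<close> this is |h - 1 + B| + |B|; it
  dominates |h - 1| and vanishes in the limit exactly when h tends to 1 and dh/d\<xi> to 0, for N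
  nonzero.\<close>

definition LG_u :: "nat \<Rightarrow> complex \<Rightarrow> (complex \<Rightarrow> complex) \<Rightarrow> (complex \<Rightarrow> complex) \<Rightarrow> complex \<Rightarrow> real" where
  "LG_u n N w w1 z = cmod (w z * LG_V n N z - 1 + LG_p n N w w1 z / (2 * N)) + cmod (LG_p n N w w1 z / (2 * N))"

lemma density_nonneg:
  assumes "\<nu> > 0"
  shows "phi_density n \<nu> z v \<ge> 0" "psi_density n \<nu> z v \<ge> 0"
  using assms unfolding phi_density_def psi_density_def
  by (intro mult_nonneg_nonneg add_nonneg_nonneg sum_nonneg; simp)+

lemma continuous_on_sqrt_z2m1: "continuous_on LG_domain sqrt_z2m1"
  unfolding continuous_on_eq_continuous_within
  by (auto simp: LG_domain_def intro: has_field_derivative_sqrt_z2m1[THEN DERIV_continuous, THEN continuous_within_subset])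

lemma continuous_on_LG_F: "continuous_on LG_domain (LG_F s)"
proof (subst continuous_on_cong[OF refl])
  show "LG_F s z = LG_G s (beta z)" if "z \<in> LG_domain" for z
    using that by (intro LG_F_eq) (auto simp: LG_domain_def)
  show "continuous_on LG_domain (\<lambda>z. LG_G s (beta z))"
    unfolding continuous_on_eq_continuous_within LG_domain_def
    using has_field_derivative_LG_beta[OF _ _ LG_G_has_deriv, THEN DERIV_continuous, THEN continuous_within_subset]
    by blast
qed

lemma has_vector_derivative_chain_upper:
  assumes "(g has_vector_derivative g') (at t)" "(f has_field_derivative f') (at (g t) within upper)"
    and "open U" "t \<in> U" "\<And>t. t \<in> U \<Longrightarrow> g t \<in> upper"
  shows "((\<lambda>t. f (g t)) has_vector_derivative g' * f') (at t)"
proof -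
  have "g ` U \<subseteq> upper" using assms(5) by auto
  then have "((f \<circ> g) has_vector_derivative g' * f') (at t within U)"
    by (intro field_vector_diff_chain_within[OF has_vector_derivative_at_within[OF assms(1)]
          has_field_derivative_subset[OF assms(2)]])
  then show ?thesis unfolding at_within_open[OF assms(4,3)] o_def .
qed

lemma norm_LG_R_le:
  assumes "z \<in> LG_domain" "N \<noteq> 0"
  shows "1 / cmod N * cmod (LG_R n N z * (sqrt_z2m1 z / z * v)) \<le> phi_density n (cmod N) z v"
\<comment> \<open>At n = 0 the truncated \<open>n - 1\<close> spoils the count of powers of N, but
  both sides vanish there because \<open>LG_E 0\<close> is zero.\<close>
proof (cases "n = 0")
  case True
  then show ?thesis by (simp add: LG_R_def phi_density_def LG_G_def LG_F_def)
next
  case False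
  have F: "LG_G s (beta z) = LG_F s z" for s using assms(1) by (subst LG_F_eq) (auto simp: LG_domain_def)
  define x where "x = 1 / z * sqrt_z2m1 z"
  have "cmod ((- 2 * LG_F n z + (\<Sum>s = 1..n - 1. 1 / N ^ s *
     (\<Sum>k = s..n - 1. LG_F k z * LG_F (s + n - k - 1) z))) * (x * v)) =
     cmod (- 2 * (x * LG_F n z * v) + (\<Sum>s = 1..n - 1. 1 / N ^ s *
     (\<Sum>k = s..n - 1. x * LG_F k z * LG_F (s + n - k - 1) z * v)))"
    unfolding distrib_right sum_distrib_right sum_distrib_left by (simp add: mult_ac)
  also have "\<dots> \<le> 2 * cmod (x * LG_F n z * v) + (\<Sum>s = 1..n - 1. 1 / cmod N ^ s *
     (\<Sum>k = s..n - 1. cmod (x * LG_F k z * LG_F (s + n - k - 1) z * v)))"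
    by (intro norm_triangle_le add_mono order.trans[OF norm_sum] sum_mono)
      (auto simp: norm_mult norm_divide norm_power intro!: divide_right_mono mult_left_mono order.trans[OF norm_sum])
  finally show ?thesis
    unfolding phi_density_def LG_R_def F x_def[symmetric] using assms(2) False
    by (cases n) (auto simp: norm_mult norm_divide norm_power x_def field_simps)
qed

lemma norm_LG_T_le:
  assumes "z \<in> LG_domain" "N \<noteq> 0" "n \<ge> 2"
  shows "4 * cmod (LG_T n N z * (sqrt_z2m1 z / z * v)) \<le> psi_density n (cmod N) z v"
proof -
  have F: "LG_G s (beta z) = LG_F s z" for s using assms(1) by (subst LG_F_eq) (auto simp: LG_domain_def)
  define x where "x = 1 / z * sqrt_z2m1 z"
  have "LG_T n N z * (x * v) = (\<Sum>s = 1..n - 1. 1 / N ^ s * (x * LG_F s z * v))"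
    unfolding LG_T_def F sum_distrib_right by (simp add: mult_ac)
  also have "cmod \<dots> \<le> (\<Sum>s = 1..n - 1. 1 / cmod N ^ s * cmod (x * LG_F s z * v))"
    by (intro order.trans[OF norm_sum] sum_mono) (simp add: norm_mult norm_divide norm_power)
  also have "{1..n - 1} = Suc ` {0..n - 2}" using assms(3) by (auto simp: image_Suc_atLeastAtMost)
  also have "(\<Sum>s\<in>Suc ` {0..n - 2}. 1 / cmod N ^ s * cmod (x * LG_F s z * v)) =
     1 / cmod N * (\<Sum>s = 0..n - 2. 1 / cmod N ^ s * cmod (x * LG_F (s + 1) z * v))"
    by (subst sum.reindex) (auto simp: sum_distrib_left)
  finally show ?thesis unfolding psi_density_def x_def by simp
qed

text \<open>An instance of \<open>gronwall_pair\<close> with B = p / (2 N) and A = h - 1 + B. Its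
  damping coefficient is 2 N times the velocity of \<xi>, so the sign condition is precisely the
  monotonicity of N Re \<xi>.\<close>

lemma LG_curve_bound:
  fixes N :: real and g :: "real \<Rightarrow> complex"
  assumes n: "n \<ge> 2" and N: "N \<noteq> 0" and w: "bessel_system N w w1"
    and ab: "a \<le> b" and S: "finite S" and g: "continuous_on {a..b} g" "\<And>t. t \<in> {a..b} \<Longrightarrow> g t \<in> LG_domain"
    and g': "\<And>t. t \<in> {a<..<b} - S \<Longrightarrow> (g has_vector_derivative g' t) (at t)"
      "\<And>t. t \<in> {a<..<b} - S \<Longrightarrow> isCont g' t"
    and mono: "\<And>t. t \<in> {a<..<b} - S \<Longrightarrow> N * Re (sqrt_z2m1 (g t) / g t * g' t) \<ge> 0"
    and int: "(\<lambda>t. phi_density n \<bar>N\<bar> (g t) (g' t)) integrable_on {a..b}"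
      "(\<lambda>t. psi_density n \<bar>N\<bar> (g t) (g' t)) integrable_on {a..b}"
  shows "LG_u n N w w1 (g b) \<le>
     (LG_u n N w w1 (g a) + integral {a..b} (\<lambda>t. phi_density n \<bar>N\<bar> (g t) (g' t))) *
     exp (integral {a..b} (\<lambda>t. phi_density n \<bar>N\<bar> (g t) (g' t)) + integral {a..b} (\<lambda>t. psi_density n \<bar>N\<bar> (g t) (g' t)))"
proof -
  define q where "q z = sqrt_z2m1 z / z" for z
  define h p where "h z = w z * LG_V n N z" and "p = LG_p n N w w1" for z
  define B A where "B t = p (g t) / (2 * N)" and "A t = h (g t) - 1 + B t" for t
  \<comment> \<open>In \<xi>, D = - (2 T h' + R h) / (2 N): what is left of A' once h' has cancelled
    against the leading part of h'' / (2 N).\<close>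
  define D where "D t = - (g' t * q (g t) / (2 * N) * (2 * LG_T n N (g t) * p (g t) + LG_R n N (g t) * h (g t)))" for t
  have dom: "z \<in> upper" "z \<notin> {0, 1, -1}" if "z \<in> LG_domain" for z using that by (auto simp: LG_domain_def)
  have N': "complex_of_real N \<noteq> 0" using N by simp
  have dh: "(h has_field_derivative q z * p z) (at z within upper)"
    and dp: "(p has_field_derivative q z * (- 2 * (N + LG_T n N z) * p z - LG_R n N z * h z)) (at z within upper)"
    if "z \<in> LG_domain" for z
    using has_field_derivative_LG_h[OF w dom[OF that]] has_field_derivative_LG_p[OF w dom[OF that] _ N'] n
    by (auto simp: h_def[abs_def] p_def q_def)
  have cont: "continuous_on LG_domain f" if "\<And>z. z \<in> LG_domain \<Longrightarrow> (f has_field_derivative f' z) (at z within upper)" for f f'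
    using that unfolding continuous_on_eq_continuous_within LG_domain_def
    by (meson DERIV_continuous Diff_subset continuous_within_subset)
  have comp: "continuous_on {a..b} (\<lambda>t. f (g t))" if "continuous_on LG_domain f" for f :: "complex \<Rightarrow> complex"
    using continuous_on_compose2[OF that g(1)] g(2) by blast
  have isC: "isCont (\<lambda>t. f (g t)) t" if "continuous_on LG_domain f" "t \<in> {a<..<b}" for f :: "complex \<Rightarrow> complex" and t
  proof -
    have "{a<..<b} \<subseteq> {a..b}" by auto
    from continuous_on_subset[OF comp[OF that(1)] this] that(2) show ?thesis
      by (simp add: continuous_on_eq_continuous_at)
  qed
  have cont_g: "isCont (\<lambda>t. LG_F s (g t)) t" "isCont (\<lambda>t. sqrt_z2m1 (g t)) t" "isCont g t" "g t \<noteq> 0"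
    if "t \<in> {a<..<b}" for s t
    using isC[OF continuous_on_LG_F that] isC[OF continuous_on_sqrt_z2m1 that] isC[OF continuous_on_id that]
      g(2)[of t] that by (auto simp: LG_domain_def)
  have hg: "((\<lambda>t. h (g t)) has_vector_derivative g' t * (q (g t) * p (g t))) (at t)"
    and pg: "((\<lambda>t. p (g t)) has_vector_derivative g' t * (q (g t) * (- 2 * (N + LG_T n N (g t)) * p (g t) - LG_R n N (g t) * h (g t)))) (at t)"
    if "t \<in> {a<..<b} - S" for t
  proof -
    have "g s \<in> LG_domain" "g s \<in> upper" if "s \<in> {a<..<b}" for s using that g(2)[of s] dom by auto
    note * = has_vector_derivative_chain_upper[OF g'(1)[OF that] _ open_greaterThanLessThan[of a b] _ this(2)]
    have "t \<in> {a<..<b}" using that by simp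
    with \<open>\<And>s. s \<in> {a<..<b} \<Longrightarrow> g s \<in> LG_domain\<close>
    show "((\<lambda>t. h (g t)) has_vector_derivative g' t * (q (g t) * p (g t))) (at t)"
      "((\<lambda>t. p (g t)) has_vector_derivative g' t * (q (g t) * (- 2 * (N + LG_T n N (g t)) * p (g t) - LG_R n N (g t) * h (g t)))) (at t)"
      by (blast intro: * dh dp)+
  qed
  have "cmod (A b) + cmod (B b) \<le>
    (cmod (A a) + cmod (B a) + integral {a..b} (\<lambda>t. phi_density n \<bar>N\<bar> (g t) (g' t))) *
     exp (integral {a..b} (\<lambda>t. phi_density n \<bar>N\<bar> (g t) (g' t)) + integral {a..b} (\<lambda>t. psi_density n \<bar>N\<bar> (g t) (g' t)))"
  proof (rule gronwall_pair[OF ab S _ _ int, where c = "\<lambda>t. 2 * N * (q (g t) * g' t)" and D = D])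
    show "continuous_on {a..b} A" "continuous_on {a..b} B"
      unfolding A_def B_def using N by (auto intro!: continuous_intros comp cont[OF dh] cont[OF dp])
    show "0 \<le> phi_density n \<bar>N\<bar> (g t) (g' t)" "0 \<le> psi_density n \<bar>N\<bar> (g t) (g' t)" for t
      using density_nonneg N by auto
  next
    fix t assume t: "t \<in> {a<..<b} - S"
    then have t': "t \<in> {a<..<b}" "t \<in> {a..b}" by auto
    show "isCont (\<lambda>t. phi_density n \<bar>N\<bar> (g t) (g' t)) t" "isCont (\<lambda>t. psi_density n \<bar>N\<bar> (g t) (g' t)) t"
      unfolding phi_density_def psi_density_def using N
      by (intro continuous_intros cont_g[OF t'(1)] g'(2)[OF t]; simp)+
    have B': "(B has_vector_derivative g' t * (q (g t) * (- 2 * (N + LG_T n N (g t)) * p (g t) - LG_R n N (g t) * h (g t))) / (2 * N)) (at t)"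
      unfolding B_def by (rule has_vector_derivative_divide[OF pg[OF t]])
    then show "(B has_vector_derivative D t - 2 * N * (q (g t) * g' t) * B t) (at t)"
      by (rule has_vector_derivative_eq_rhs) (use N in \<open>simp add: D_def B_def field_simps\<close>)
    have "(A has_vector_derivative g' t * (q (g t) * p (g t)) - 0 + (D t - 2 * N * (q (g t) * g' t) * B t)) (at t)"
      unfolding A_def by (intro has_vector_derivative_add has_vector_derivative_diff hg t has_vector_derivative_const) fact
    then show "(A has_vector_derivative D t) (at t)"
      by (rule has_vector_derivative_eq_rhs) (use N in \<open>simp add: B_def field_simps\<close>)
    have "Re (of_real (2 * N) * y) = 2 * (N * Re y)" for y by simp
    from this[of "q (g t) * g' t"] show "0 \<le> Re (2 * N * (q (g t) * g' t))"
      using mono[OF t] unfolding q_def by linarith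
    define x where "x = q (g t) * g' t"
    have "2 * cmod (D t) = 1 / \<bar>N\<bar> * cmod (2 * LG_T n N (g t) * x * p (g t) + LG_R n N (g t) * x * h (g t))"
    proof -
      have "2 * cmod (- (1 / (2 * of_real N) * y)) = 1 / \<bar>N\<bar> * cmod y" for y
        by (simp add: norm_mult norm_divide)
      moreover have "D t = - (1 / (2 * of_real N) * (2 * LG_T n N (g t) * x * p (g t) + LG_R n N (g t) * x * h (g t)))"
        unfolding D_def x_def by (simp add: distrib_left mult_ac)
      ultimately show ?thesis by metis
    qed
    also have "\<dots> \<le> 1 / \<bar>N\<bar> * (cmod (2 * LG_T n N (g t) * x * p (g t)) + cmod (LG_R n N (g t) * x * h (g t)))"
      by (intro mult_left_mono norm_triangle_ineq) auto
    \<comment> \<open>Inserting p = 2 N B turns the coefficient 2 / |N| of T p into the constant 4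
      of \<open>Psi\<close>.\<close>
    also have "\<dots> = 4 * cmod (LG_T n N (g t) * x) * cmod (B t) + 1 / \<bar>N\<bar> * cmod (LG_R n N (g t) * x) * cmod (h (g t))"
      using N by (simp add: B_def norm_mult norm_divide field_simps)
    also have "\<dots> \<le> psi_density n \<bar>N\<bar> (g t) (g' t) * (cmod (A t) + cmod (B t)) + phi_density n \<bar>N\<bar> (g t) (g' t) * (1 + cmod (A t) + cmod (B t))"
    proof (intro add_mono mult_mono)
      show "4 * cmod (LG_T n N (g t) * x) \<le> psi_density n \<bar>N\<bar> (g t) (g' t)"
        using norm_LG_T_le[OF g(2)[OF t'(2)] N' n] by (simp add: x_def q_def)
      show "1 / \<bar>N\<bar> * cmod (LG_R n N (g t) * x) \<le> phi_density n \<bar>N\<bar> (g t) (g' t)"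
        using norm_LG_R_le[OF g(2)[OF t'(2)] N', of n] by (simp add: x_def q_def)
      \<comment> \<open>This splits h into the 1 that drives the error and the two quantities being
        estimated, as \<open>gronwall_pair\<close> requires.\<close>
      have "h (g t) = 1 + A t - B t" by (simp add: A_def)
      also have "cmod \<dots> \<le> 1 + cmod (A t) + cmod (B t)"
        using norm_triangle_ineq4[of "1 + A t" "B t"] norm_triangle_ineq[of 1 "A t"] by simp
      finally show "cmod (h (g t)) \<le> 1 + cmod (A t) + cmod (B t)" .
    qed (use density_nonneg N in auto)
    finally show "2 * cmod (D t) \<le> phi_density n \<bar>N\<bar> (g t) (g' t) * (1 + cmod (A t) + cmod (B t)) +
        psi_density n \<bar>N\<bar> (g t) (g' t) * (cmod (A t) + cmod (B t))" by simp
  qed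
  then show ?thesis by (simp add: LG_u_def A_def B_def h_def p_def)
qed

lemma phi_density_has_integral:
  assumes "integrals_converge n g" "n \<ge> 1"
  shows "((\<lambda>t. phi_density n \<nu> (g t) (vector_derivative g (at t))) has_integral 1 / \<nu> ^ n * Phi n g \<nu>) {0<..1}"
  unfolding phi_density_def Phi_def abs_integral_def
  using assms unfolding integrals_converge_def abs_converges_def
  by (intro has_integral_mult_right has_integral_add has_integral_sum integrable_integral) auto

lemma psi_density_has_integral:
  assumes "integrals_converge n g" "n \<ge> 2"
  shows "((\<lambda>t. psi_density n \<nu> (g t) (vector_derivative g (at t))) has_integral 1 / \<nu> * Psi n g \<nu>) {0<..1}"
  unfolding psi_density_def Psi_def abs_integral_def
  using assms unfolding integrals_converge_def abs_converges_def
  by (intro has_integral_mult_right has_integral_sum integrable_integral) auto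

definition LG_bound :: "nat \<Rightarrow> (real \<Rightarrow> complex) \<Rightarrow> real \<Rightarrow> real" where
  "LG_bound n g \<nu> = 1 / \<nu> ^ n * Phi n g \<nu> * exp (1 / \<nu> * Psi n g \<nu> + 1 / \<nu> ^ n * Phi n g \<nu>)"

text \<open>The reference point lies outside the path, where \<xi> is infinite. The curve bound is
  therefore applied on [a, 1] with the integrals enlarged to the whole path, and a tends to 0, where
  \<open>LG_u\<close> vanishes.\<close>

lemma LG_path_bound:
  fixes N :: real
  assumes n: "n \<ge> 2" and N: "N \<noteq> 0" and w: "bessel_system N w w1"
    and g: "R2_chain g" "\<And>t. t \<in> {0<..1} \<Longrightarrow> g t \<in> LG_domain"
    and mono: "mono_on {0<..1} (\<lambda>t. N * Re (xi (g t)))"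
    and conv: "integrals_converge n g"
    and lim: "((\<lambda>t. LG_u n N w w1 (g t)) \<longlongrightarrow> 0) (at_right 0)"
  shows "cmod (w (g 1) * LG_V n N (g 1) - 1) \<le>
    LG_bound n g \<bar>N\<bar>"
proof -
  define f k where "f t = phi_density n \<bar>N\<bar> (g t) (vector_derivative g (at t))"
    and "k t = psi_density n \<bar>N\<bar> (g t) (vector_derivative g (at t))" for t
  define F K where "F = 1 / \<bar>N\<bar> ^ n * Phi n g \<bar>N\<bar>" and "K = 1 / \<bar>N\<bar> * Psi n g \<bar>N\<bar>"
  have fF: "(f has_integral F) {0<..1}" and kK: "(k has_integral K) {0<..1}"
    unfolding f_def k_def F_def K_def
    using phi_density_has_integral[OF conv, of "\<bar>N\<bar>"] psi_density_has_integral[OF conv n, of "\<bar>N\<bar>"] n by auto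
  obtain S where S: "finite S"
    "\<And>t. t \<in> {0<..<1} - S \<Longrightarrow> (g has_vector_derivative vector_derivative g (at t)) (at t)"
    "\<And>t. t \<in> {0<..<1} - S \<Longrightarrow> isCont (\<lambda>t. vector_derivative g (at t)) t"
    using R2_chain_regular[OF g(1)] by blast
  have nonneg: "0 \<le> f t" "0 \<le> k t" for t using density_nonneg N by (auto simp: f_def k_def)
  have int: "f integrable_on {a..1}" "k integrable_on {a..1}" "integral {a..1} f \<le> F" "integral {a..1} k \<le> K"
    if "0 < a" for a
  proof -
    have sub: "{a..1} \<subseteq> {0<..1}" using that by auto
    have fk: "f integrable_on {0<..1}" "k integrable_on {0<..1}" using fF kK by blast+
    have "{0<..1} - {0<..<1} \<subseteq> {1::real}" by auto
    have "f integrable_on {0..1}" "k integrable_on {0..1}"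
      by (rule integrable_spike_set[OF fk(1)] integrable_spike_set[OF fk(2)];
          rule negligible_subset[of "{0}"]; auto)+
    then show i: "f integrable_on {a..1}" "k integrable_on {a..1}"
      using that by (auto elim: integrable_subinterval_real)
    show "integral {a..1} f \<le> F" "integral {a..1} k \<le> K"
      using integral_subset_le[OF sub i(1) fk(1)] integral_subset_le[OF sub i(2) fk(2)] nonneg
        integral_unique[OF fF] integral_unique[OF kK] by auto
  qed
  have u: "LG_u n N w w1 (g 1) \<le> (LG_u n N w w1 (g a) + F) * exp (K + F)" if a: "a \<in> {0<..<1}" for a
  proof -
    have "LG_u n N w w1 (g 1) \<le> (LG_u n N w w1 (g a) + integral {a..1} f) * exp (integral {a..1} f + integral {a..1} k)"
      unfolding f_def k_def
    proof (rule LG_curve_bound[OF n N w _ S(1)])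
      show "continuous_on {a..1} g"
        by (rule continuous_on_subset[OF R2_chain_continuous[OF g(1)]]) (use a in auto)
      show "g t \<in> LG_domain" if "t \<in> {a..1}" for t using that a g(2) by auto
      show "(\<lambda>t. phi_density n \<bar>N\<bar> (g t) (vector_derivative g (at t))) integrable_on {a..1}"
        "(\<lambda>t. psi_density n \<bar>N\<bar> (g t) (vector_derivative g (at t))) integrable_on {a..1}"
        using int(1,2) a by (auto simp: f_def[abs_def] k_def[abs_def])
      fix t assume t: "t \<in> {a<..<1} - S"
      then have t': "t \<in> {0<..<1} - S" using a by auto
      show d: "(g has_vector_derivative vector_derivative g (at t)) (at t)"
        and "isCont (\<lambda>t. vector_derivative g (at t)) t" using S t' by auto
      have "(xi has_field_derivative sqrt_z2m1 (g t) / g t) (at (g t) within upper)"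
        using has_field_derivative_xi_upper g(2)[of t] t' by (auto simp: LG_domain_def)
      from has_vector_derivative_chain_upper[OF d this, of "{0<..<1}"] t' g(2)
      have "((\<lambda>t. xi (g t)) has_vector_derivative vector_derivative g (at t) * (sqrt_z2m1 (g t) / g t)) (at t)"
        by (auto simp: LG_domain_def)
      from bounded_linear.has_vector_derivative[OF bounded_linear_Re this]
      have "((\<lambda>t. Re (xi (g t))) has_real_derivative Re (vector_derivative g (at t) * (sqrt_z2m1 (g t) / g t))) (at t)"
        unfolding has_real_derivative_iff_has_vector_derivative .
      from mono_on_imp_deriv_nonneg[OF mono DERIV_cmult[OF this, of N]] t'
      show "0 \<le> N * Re (sqrt_z2m1 (g t) / g t * vector_derivative g (at t))"
        by (simp add: mult.commute)
    qed (use a in auto)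
    also have "\<dots> \<le> (LG_u n N w w1 (g a) + F) * exp (K + F)"
    proof (intro mult_mono add_mono)
      show "0 \<le> LG_u n N w w1 (g a) + F" using int(3)[of a] a nonneg
          integral_nonneg[OF int(1), of a] by (auto simp: LG_u_def intro!: add_nonneg_nonneg)
      show "exp (integral {a..1} f + integral {a..1} k) \<le> exp (K + F)" using int(3,4)[of a] a by simp
    qed (use int[of a] a in auto)
    finally show ?thesis .
  qed
  have "((\<lambda>a. (LG_u n N w w1 (g a) + F) * exp (K + F)) \<longlongrightarrow> (0 + F) * exp (K + F)) (at_right 0)"
    by (intro tendsto_intros lim)
  moreover have "eventually (\<lambda>a. LG_u n N w w1 (g 1) \<le> (LG_u n N w w1 (g a) + F) * exp (K + F)) (at_right 0)"
    using eventually_at_right_real[of 0 1] by (rule eventually_mono) (use u in auto)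
  ultimately have "LG_u n N w w1 (g 1) \<le> (0 + F) * exp (K + F)"
    by (rule tendsto_lowerbound) simp
  moreover have "cmod (w (g 1) * LG_V n N (g 1) - 1) \<le> LG_u n N w w1 (g 1)"
    unfolding LG_u_def by (metis add_diff_cancel_right' norm_triangle_ineq4)
  ultimately show ?thesis by (simp add: LG_bound_def F_def K_def)
qed

section \<open>Modified Bessel functions near the origin\<close>

definition bessel_coeff :: "complex \<Rightarrow> nat \<Rightarrow> complex" where
  "bessel_coeff \<mu> k = rGamma (\<mu> + of_nat k + 1) / fact k"

text \<open>The entire factor of I as a function of u = z^2 / 4; all branch questions stay in the
  power of z / 2.\<close>

definition bessel_series :: "complex \<Rightarrow> complex \<Rightarrow> complex" where
  "bessel_series \<mu> u = (\<Sum>k. bessel_coeff \<mu> k * u ^ k)"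

lemma besselI_series: "besselI \<mu> z = (z / 2) powr \<mu> * bessel_series \<mu> (z\<^sup>2 / 4)"
  by (simp add: besselI_def bessel_series_def bessel_coeff_def mult_ac)

lemma bessel_coeff_Suc:
  "of_nat (Suc k) * (\<mu> + of_nat k + 1) * bessel_coeff \<mu> (Suc k) = bessel_coeff \<mu> k"
proof -
  have "rGamma (\<mu> + of_nat k + 1) = (\<mu> + of_nat k + 1) * rGamma (\<mu> + of_nat (Suc k) + 1)"
    using rGamma_plus1[of "\<mu> + of_nat k + 1"] by (simp add: add_ac)
  moreover have "of_nat (Suc k) * x * (y / fact (Suc k)) = x * y / fact k" for x y :: complex
    unfolding fact_Suc by (simp del: of_nat_Suc)
  ultimately show ?thesis unfolding bessel_coeff_def by metis
qed

lemma summable_bessel_series: "summable (\<lambda>k. bessel_coeff \<mu> k * u ^ k)"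
proof -
  \<comment> \<open>Beyond M one has |\<mu> + k + 1| \<ge> 2 |u|, which makes the ratio of
    successive terms at most 1 / 2.\<close>
  obtain M :: nat where M: "real M \<ge> cmod \<mu> + 2 * cmod u + 1" using real_arch_simple by blast
  show ?thesis
  proof (rule summable_ratio_test[of "1 / 2" M])
    fix k assume "k \<ge> M"
    then have k: "real k \<ge> cmod \<mu> + 2 * cmod u + 1" using M by linarith
    define x where "x = \<mu> + of_nat k + 1"
    have "real k + 1 \<le> cmod x + cmod \<mu>"
      using norm_triangle_ineq4[of x \<mu>] by (simp add: x_def) (metis norm_of_nat of_nat_Suc add.commute)
    then have x: "cmod x \<ge> 2 * cmod u" "cmod x > 0" using k norm_ge_zero[of u] by linarith+
    have "bessel_coeff \<mu> k = of_nat (Suc k) * x * bessel_coeff \<mu> (Suc k)"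
      by (simp only: bessel_coeff_Suc x_def)
    then have "cmod (bessel_coeff \<mu> k) = real (Suc k) * cmod x * cmod (bessel_coeff \<mu> (Suc k))"
      by (simp only: norm_mult norm_of_nat)
    also have "\<dots> \<ge> 1 * (2 * cmod u) * cmod (bessel_coeff \<mu> (Suc k))"
      using x by (intro mult_mono) auto
    finally have "2 * (cmod u * cmod (bessel_coeff \<mu> (Suc k))) \<le> cmod (bessel_coeff \<mu> k)" by simp
    from mult_right_mono[OF this, of "cmod (u ^ k)"]
    show "cmod (bessel_coeff \<mu> (Suc k) * u ^ Suc k) \<le> 1 / 2 * cmod (bessel_coeff \<mu> k * u ^ k)"
      by (simp add: norm_mult mult_ac)
  qed simp
qed

text \<open>Hence differentiation in u is a shift of the order by one.\<close>

lemma diffs_bessel_coeff: "diffs (bessel_coeff \<mu>) = bessel_coeff (\<mu> + 1)"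
  by (rule ext) (simp add: diffs_def bessel_coeff_def add_ac del: of_nat_Suc, simp add: field_simps)

lemma has_field_derivative_bessel_series [derivative_intros]:
  assumes "(f has_field_derivative f') (at z within A)"
  shows "((\<lambda>z. bessel_series \<mu> (f z)) has_field_derivative f' * bessel_series (\<mu> + 1) (f z)) (at z within A)"
proof -
  have "(bessel_series \<mu> has_field_derivative bessel_series (\<mu> + 1) u) (at u)" for u
    using termdiffs_strong_converges_everywhere[OF summable_bessel_series, of \<mu> u]
    unfolding diffs_bessel_coeff bessel_series_def[abs_def] .
  from DERIV_chain'[OF assms this] show ?thesis by (simp add: mult.commute)
qed

lemma continuous_on_bessel_series: "continuous_on A (bessel_series \<mu>)"
  by (rule DERIV_continuous_on) (use has_field_derivative_bessel_series[OF DERIV_ident] in simp)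

text \<open>Bessel's equation in disguise: since a shift of the order is a derivative in u, this is
  y = (\<mu> + 1) y' + u y''.\<close>

lemma bessel_series_recursion:
  "bessel_series \<mu> u = (\<mu> + 1) * bessel_series (\<mu> + 1) u + u * bessel_series (\<mu> + 2) u"
proof -
  define a where "a k = (if k = 0 then 0 else bessel_coeff (\<mu> + 2) (k - 1) * u ^ k)" for k
  have "(\<lambda>k. u * (bessel_coeff (\<mu> + 2) k * u ^ k)) sums (u * bessel_series (\<mu> + 2) u)"
    unfolding bessel_series_def by (intro sums_mult summable_sums summable_bessel_series)
  then have "(\<lambda>k. a (Suc k)) sums (u * bessel_series (\<mu> + 2) u - a 0 + a 0)"
    by (simp add: a_def mult_ac)
  then have a: "a sums (u * bessel_series (\<mu> + 2) u)"
    by (subst (asm) sums_Suc_iff) (simp add: a_def)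
  have b: "(\<lambda>k. (\<mu> + 1) * (bessel_coeff (\<mu> + 1) k * u ^ k)) sums ((\<mu> + 1) * bessel_series (\<mu> + 1) u)"
    unfolding bessel_series_def by (intro sums_mult summable_sums summable_bessel_series)
  have c: "bessel_coeff \<mu> k = (\<mu> + of_nat k + 1) * bessel_coeff (\<mu> + 1) k" for k
    using rGamma_plus1[of "\<mu> + of_nat k + 1"] by (simp add: bessel_coeff_def add_ac)
  have "(\<mu> + 1) * (bessel_coeff (\<mu> + 1) k * u ^ k) + a k = bessel_coeff \<mu> k * u ^ k" for k
  proof (cases k)
    case (Suc m)
    have "bessel_coeff (\<mu> + 2) m = of_nat (Suc m) * bessel_coeff (\<mu> + 1) (Suc m)"
      using fun_cong[OF diffs_bessel_coeff, of "\<mu> + 1" m] by (simp add: diffs_def add_ac)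
    then have "a k = of_nat (Suc m) * bessel_coeff (\<mu> + 1) (Suc m) * u ^ Suc m"
      by (simp only: a_def Suc) simp
    then show ?thesis unfolding Suc c[of "Suc m"] by (simp only: distrib_right) (simp only: mult_ac add_ac)
  qed (simp add: a_def c[of 0])
  with sums_add[OF b a] show ?thesis unfolding bessel_series_def[of \<mu>] by (simp add: sums_iff)
qed

lemma bessel_series_0 [simp]: "bessel_series \<mu> 0 = rGamma (\<mu> + 1)"
  unfolding bessel_series_def using powser_zero[of "bessel_coeff \<mu>"] by (simp add: bessel_coeff_def)

lemma powr_scaled_upper:
  fixes c :: real and z \<mu> :: complex
  assumes "c > 0" "z \<noteq> 0"
  shows "(c * z) powr \<mu> = exp (\<mu> * (ln c + Ln z))"
  using assms Ln_times_of_real[of c z] by (simp add: powr_def Ln_of_real)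

text \<open>The derivative in z of \<open>besselI \<mu> (\<nu> * z)\<close>, by the product rule for
  power times series.\<close>

definition besselI' :: "complex \<Rightarrow> real \<Rightarrow> complex \<Rightarrow> complex" where
  "besselI' \<mu> \<nu> z = (\<nu> * z / 2) powr \<mu> * (\<mu> / z * bessel_series \<mu> ((\<nu> * z)\<^sup>2 / 4) +
     (complex_of_real \<nu>)\<^sup>2 * z / 2 * bessel_series (\<mu> + 1) ((\<nu> * z)\<^sup>2 / 4))"

lemma bessel_system_besselI:
  fixes \<nu> :: real
  assumes \<nu>: "\<nu> > 0" and \<mu>: "\<mu>\<^sup>2 = - (of_real \<nu>)\<^sup>2" and N: "N\<^sup>2 = of_real \<nu> ^ 2"
  shows "bessel_system N (\<lambda>z. besselI \<mu> (\<nu> * z)) (besselI' \<mu> \<nu>)"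
  unfolding bessel_system_def
proof (intro ballI conjI)
  fix z assume z: "z \<in> upper - {0}"
  define P where "P = (\<lambda>z. (complex_of_real \<nu> * z / 2) powr \<mu>)"
  define g where "g = (\<lambda>j z. bessel_series (\<mu> + j) ((complex_of_real \<nu> * z)\<^sup>2 / 4))"
  have dP: "(P has_field_derivative P z * (\<mu> / z)) (at z within upper)"
  proof (rule has_field_derivative_transform_within)
    have "((\<lambda>z. exp (\<mu> * (ln (\<nu> / 2) + Ln z))) has_field_derivative
        exp (\<mu> * (ln (\<nu> / 2) + Ln z)) * (\<mu> * (0 + 1 / z))) (at z within upper)"
      using z by (intro DERIV_chain'[OF DERIV_cmult[OF DERIV_add[OF DERIV_const has_field_derivative_Ln_upper]] DERIV_exp, THEN DERIV_cong]) auto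
    then show "((\<lambda>z. exp (\<mu> * (ln (\<nu> / 2) + Ln z))) has_field_derivative P z * (\<mu> / z)) (at z within upper)"
      using z \<nu> powr_scaled_upper[of "\<nu> / 2" z \<mu>] by (simp add: P_def)
    show "exp (\<mu> * (ln (\<nu> / 2) + Ln x)) = P x" if "dist x z < cmod z" for x
      using that \<nu> powr_scaled_upper[of "\<nu> / 2" x \<mu>] by (cases "x = 0") (auto simp: P_def)
  qed (use z in auto)
  have dg: "(g j has_field_derivative (complex_of_real \<nu>)\<^sup>2 * z / 2 * g (j + 1) z) (at z within upper)" for j
  proof -
    have "((\<lambda>z. (complex_of_real \<nu> * z)\<^sup>2 / 4) has_field_derivative (complex_of_real \<nu>)\<^sup>2 * z / 2) (at z within upper)"
      by (auto intro!: derivative_eq_intros simp: power2_eq_square)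
    from has_field_derivative_bessel_series[OF this, of "\<mu> + j"] show ?thesis by (simp add: g_def add.assoc)
  qed
  have I: "besselI \<mu> (\<nu> * z) = P z * g 0 z" for z :: complex
    by (simp add: besselI_series P_def g_def)
  have I': "besselI' \<mu> \<nu> z = P z * (\<mu> / z * g 0 z + (complex_of_real \<nu>)\<^sup>2 * z / 2 * g 1 z)" for z :: complex
    by (simp add: besselI'_def P_def g_def)
  show "((\<lambda>z. besselI \<mu> (\<nu> * z)) has_field_derivative besselI' \<mu> \<nu> z) (at z within upper)"
    unfolding I I' by (rule DERIV_cong[OF DERIV_mult[OF dP dg]]) (simp add: algebra_simps)
  have g0: "g 0 z = (\<mu> + 1) * g 1 z + (complex_of_real \<nu>)\<^sup>2 * z\<^sup>2 / 4 * g 2 z"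
    using bessel_series_recursion[of \<mu> "(of_real \<nu> * z)\<^sup>2 / 4"] by (simp add: g_def power_mult_distrib)
  have "((\<lambda>z. \<mu> / z) has_field_derivative (0 * z - \<mu> * 1) / (z * z)) (at z within upper)"
    by (rule DERIV_divide[OF DERIV_const DERIV_ident]) (use z in auto)
  moreover have "((\<lambda>z. (complex_of_real \<nu>)\<^sup>2 * z / 2) has_field_derivative (complex_of_real \<nu>)\<^sup>2 / 2) (at z within upper)"
    by (auto intro!: derivative_eq_intros)
  ultimately have "((\<lambda>z. P z * (\<mu> / z * g 0 z + (complex_of_real \<nu>)\<^sup>2 * z / 2 * g 1 z)) has_field_derivative
     P z * (\<mu> / z * ((complex_of_real \<nu>)\<^sup>2 * z / 2 * g (0 + 1) z) + (0 * z - \<mu> * 1) / (z * z) * g 0 z +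
       ((complex_of_real \<nu>)\<^sup>2 * z / 2 * ((complex_of_real \<nu>)\<^sup>2 * z / 2 * g (1 + 1) z) + (complex_of_real \<nu>)\<^sup>2 / 2 * g 1 z)) +
     P z * (\<mu> / z) * (\<mu> / z * g 0 z + (complex_of_real \<nu>)\<^sup>2 * z / 2 * g 1 z)) (at z within upper)"
    by (intro DERIV_mult' DERIV_add dP dg)
  then show "(besselI' \<mu> \<nu> has_field_derivative
      N\<^sup>2 * (1 - 1 / z\<^sup>2) * besselI \<mu> (\<nu> * z) - besselI' \<mu> \<nu> z / z) (at z within upper)"
    unfolding I I'[abs_def]
  proof (rule DERIV_cong)
    define j where "j = 1 / z"
    have j: "j * z = 1" using z by (simp add: j_def)
    have e: "\<mu> / z = \<mu> * j" "(0 * z - \<mu> * 1) / (z * z) = - \<mu> * j\<^sup>2" "1 / z\<^sup>2 = j\<^sup>2" "x / z = x * j" for x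
      by (simp_all add: j_def power2_eq_square)
    \<comment> \<open>The second-order equation as a polynomial identity, with j for 1 / z and m for
      \<nu>^2 / 4; the contiguous relation enters as the formula for g0.\<close>
    have alg: "P * (\<mu> * j * (2 * m * z * g1) + - \<mu> * j\<^sup>2 * g0 + (2 * m * z * (2 * m * z * g2) + 2 * m * g1)) +
        P * (\<mu> * j) * (\<mu> * j * g0 + 2 * m * z * g1) =
        4 * m * (1 - j\<^sup>2) * (P * g0) - P * (\<mu> * j * g0 + 2 * m * z * g1) * j"
      if "j * z = 1" "\<mu>\<^sup>2 = - (4 * m)" "g0 = (\<mu> + 1) * g1 + m * z\<^sup>2 * g2" for P \<mu> m j z g0 g1 g2 :: complex
      using that by algebra
    define m where "m = (complex_of_real \<nu>)\<^sup>2 / 4"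
    have n: "(complex_of_real \<nu>)\<^sup>2 * z / 2 = 2 * m * z" "(complex_of_real \<nu>)\<^sup>2 / 2 = 2 * m"
      "(complex_of_real \<nu>)\<^sup>2 * z\<^sup>2 / 4 = m * z\<^sup>2" "(complex_of_real \<nu>)\<^sup>2 = 4 * m"
      by (simp_all add: m_def)
    have n2: "4 * m * z / 2 = 2 * m * z" "4 * m / 2 = 2 * m" "0 + 1 = (1 :: complex)" "1 + 1 = (2 :: complex)"
      by simp_all
    show "P z * (\<mu> / z * ((complex_of_real \<nu>)\<^sup>2 * z / 2 * g (0 + 1) z) + (0 * z - \<mu> * 1) / (z * z) * g 0 z +
       ((complex_of_real \<nu>)\<^sup>2 * z / 2 * ((complex_of_real \<nu>)\<^sup>2 * z / 2 * g (1 + 1) z) + (complex_of_real \<nu>)\<^sup>2 / 2 * g 1 z)) +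
       P z * (\<mu> / z) * (\<mu> / z * g 0 z + (complex_of_real \<nu>)\<^sup>2 * z / 2 * g 1 z) =
       N\<^sup>2 * (1 - 1 / z\<^sup>2) * (P z * g 0 z) - P z * (\<mu> / z * g 0 z + (complex_of_real \<nu>)\<^sup>2 * z / 2 * g 1 z) / z"
      unfolding e N n(4) n2 by (rule alg[OF j]) (use \<mu> g0 n in \<open>simp_all\<close>)
  qed
qed

text \<open>The oscillation of z to the power \<i> N is cancelled by the term \<i> Ln z of \<xi>, so
  the product has a limit; it is nonzero because \<i> N + 1 is no pole of Gamma. The derivative
  tends to 0 since (1 / \<i>) \<i> N - N = 0 and all G_s vanish in the limit. The sign of N selects
  I of order \<i> \<nu> or - \<i> \<nu>, and approach within \<open>upper\<close> covers both
  reference points at 0.\<close>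

lemma LG_limit_at_0:
  fixes N :: real
  assumes N: "N \<noteq> 0"
  defines "w \<equiv> \<lambda>z::complex. besselI (\<i> * N) (\<bar>N\<bar> * z)" and "w1 \<equiv> besselI' (\<i> * N) \<bar>N\<bar>"
  obtains C where "C \<noteq> 0" "((\<lambda>z. w z * LG_V n N z) \<longlongrightarrow> C) (at 0 within upper)"
    "(LG_p n N w w1 \<longlongrightarrow> 0) (at 0 within upper)"
proof -
  define \<nu> where "\<nu> = \<bar>N\<bar>"
  have \<nu>: "\<nu> > 0" using N by (simp add: \<nu>_def)
  have 0: "0 \<in> upper" "sqrt_z2m1 0 = \<i>" by (auto simp: upper_def sqrt_z2m1_def)
  have r: "(sqrt_z2m1 \<longlongrightarrow> \<i>) (at 0 within upper)"
    using DERIV_continuous[OF has_field_derivative_sqrt_z2m1[OF 0(1)]] 0 by (simp add: continuous_within)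
  have b: "(beta \<longlongrightarrow> 1 / \<i>) (at 0 within upper)"
    unfolding beta_def[abs_def] by (intro tendsto_intros r) auto
  have E: "((\<lambda>z. LG_E s (beta z)) \<longlongrightarrow> LG_E s (1 / \<i>)) (at 0 within upper)"
    and G: "((\<lambda>z. LG_G s (beta z)) \<longlongrightarrow> LG_G s (1 / \<i>)) (at 0 within upper)" for s
    using isCont_tendsto_compose[OF DERIV_isCont[OF LG_E_has_deriv] b]
      isCont_tendsto_compose[OF DERIV_isCont[OF LG_G_has_deriv] b] by auto
  \<comment> \<open>At z = 0 one has \<beta> = 1 / \<i>, a zero of \<beta>^2 + 1.\<close>
  have G0: "LG_G s (1 / \<i>) = 0" for s by (simp add: LG_G_def power_divide)
  have root: "(root4_z2m1 \<longlongrightarrow> root4_z2m1 0) (at 0 within upper)"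
    using DERIV_continuous[OF has_field_derivative_root4_z2m1[OF 0(1)]] by (simp add: continuous_within)
  \<comment> \<open>The product of the power and \<open>LG_V\<close> after \<open>Ln z\<close> has
    cancelled; every factor is now continuous at 0 within \<open>upper\<close>.\<close>
  define e where "e z = root4_z2m1 z * exp (\<i> * N * ln (\<nu> / 2) - N * sqrt_z2m1 z + \<i> * N * Ln (1 - \<i> * sqrt_z2m1 z) -
      (\<Sum>s = 1..n - 1. LG_E s (beta z) / N ^ s))" for z
  define e0 where "e0 = root4_z2m1 0 * exp (\<i> * N * ln (\<nu> / 2) - N * \<i> + \<i> * N * Ln (1 - \<i> * \<i>) -
      (\<Sum>s = 1..n - 1. LG_E s (1 / \<i>) / N ^ s))"
  have elim: "(e \<longlongrightarrow> e0) (at 0 within upper)"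
    unfolding e_def[abs_def] e0_def using N by (intro tendsto_intros r root E) auto
  have eV: "(\<nu> * z / 2) powr (\<i> * N) * LG_V n N z = e z" if "z \<in> upper - {0}" for z :: complex
  proof -
    have "(\<nu> * z / 2) powr (\<i> * N) = exp (\<i> * N * (ln (\<nu> / 2) + Ln z))"
      using powr_scaled_upper[of "\<nu> / 2" z] that \<nu> by simp
    then show ?thesis
      using that by (simp add: LG_V_def e_def xi_upper mult_exp_exp algebra_simps flip: exp_add)
  qed
  define g where "g j z = bessel_series (\<i> * N + j) ((\<nu> * z)\<^sup>2 / 4)" for j z :: complex
  have g: "(g j \<longlongrightarrow> rGamma (\<i> * N + j + 1)) (at 0 within upper)" for j
  proof -
    have "((\<lambda>z. (\<nu> * z)\<^sup>2 / 4) \<longlongrightarrow> (complex_of_real \<nu> * 0)\<^sup>2 / 4) (at 0 within upper)"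
      by (intro tendsto_intros) auto
    then have "(g j \<longlongrightarrow> bessel_series (\<i> * N + j) ((complex_of_real \<nu> * 0)\<^sup>2 / 4)) (at 0 within upper)"
      unfolding g_def[abs_def] using continuous_on_bessel_series[of UNIV]
      by (intro isCont_tendsto_compose[where g = "bessel_series (\<i> * N + j)"]) (simp add: continuous_on_eq_continuous_at)
    then show ?thesis by simp
  qed
  have ev: "eventually (\<lambda>z. z \<in> upper - {0}) (at 0 within upper)"
    by (simp add: eventually_at_filter)
  define C where "C = rGamma (\<i> * N + 0 + 1) * e0"
  have wV: "((\<lambda>z. w z * LG_V n N z) \<longlongrightarrow> C) (at 0 within upper)"
  proof (rule Lim_transform_eventually)
    show "((\<lambda>z. g 0 z * e z) \<longlongrightarrow> C) (at 0 within upper)"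
      unfolding C_def by (intro tendsto_intros g elim)
    show "\<forall>\<^sub>F z in at 0 within upper. g 0 z * e z = w z * LG_V n N z"
      using ev by eventually_elim (use eV in \<open>simp add: w_def besselI_series g_def \<nu>_def mult_ac\<close>)
  qed
  have p: "(LG_p n N w w1 \<longlongrightarrow> 0) (at 0 within upper)"
  proof (rule Lim_transform_eventually)
    let ?f = "\<lambda>z. 1 / sqrt_z2m1 z * (e z * (\<i> * N * g 0 z + (complex_of_real \<nu>)\<^sup>2 * z\<^sup>2 / 2 * g 1 z)) +
        g 0 z * e z * (z\<^sup>2 / (2 * sqrt_z2m1 z ^ 3) - (N + LG_T n N z))"
    have "(?f \<longlongrightarrow>
        1 / \<i> * (e0 * (\<i> * N * rGamma (\<i> * N + 0 + 1) + (complex_of_real \<nu>)\<^sup>2 * 0\<^sup>2 / 2 * rGamma (\<i> * N + 1 + 1))) +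
        rGamma (\<i> * N + 0 + 1) * e0 * (0\<^sup>2 / (2 * \<i> ^ 3) - (N + (\<Sum>s = 1..n - 1. LG_G s (1 / \<i>) / N ^ s)))) (at 0 within upper)"
      unfolding LG_T_def using N by (intro tendsto_intros g elim r G) auto
    then show "(?f \<longlongrightarrow> 0) (at 0 within upper)"
      unfolding G0 by (simp add: mult_ac)
    show "\<forall>\<^sub>F z in at 0 within upper. ?f z = LG_p n N w w1 z"
      using ev
    proof eventually_elim
      case (elim z)
      have "z / sqrt_z2m1 z * w1 z * LG_V n N z = 1 / sqrt_z2m1 z * (e z * (\<i> * N * g 0 z + (complex_of_real \<nu>)\<^sup>2 * z\<^sup>2 / 2 * g 1 z))"
      proof -
        have zx: "z * (\<i> * N / z * A + (complex_of_real \<nu>)\<^sup>2 * z / 2 * B) = \<i> * N * A + (complex_of_real \<nu>)\<^sup>2 * z\<^sup>2 / 2 * B" for A B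
          using elim by (simp add: field_simps power2_eq_square)
        have a: "z / r * (P * X) * V = 1 / r * (P * V * (z * X))" for r P V X :: complex by (simp add: mult_ac)
        show ?thesis
          unfolding eV[OF elim, symmetric] w1_def besselI'_def g_def \<nu>_def[symmetric] a zx by simp
      qed
      moreover have "g 0 z * e z = w z * LG_V n N z"
        using eV[OF elim] by (simp add: w_def besselI_series g_def \<nu>_def mult_ac)
      ultimately show ?case unfolding LG_p_def by (simp add: algebra_simps)
    qed
  qed
  have "C \<noteq> 0"
  proof -
    have "\<i> * of_real N + 0 + 1 \<notin> \<int>\<^sub>\<le>\<^sub>0"
      using N by (auto simp: complex_eq_iff elim!: nonpos_Ints_cases)
    moreover have "root4_z2m1 0 \<noteq> 0" by simp
    ultimately show ?thesis unfolding C_def e0_def by (simp add: rGamma_eq_zero_iff)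
  qed
  then show ?thesis using wV p that by blast
qed

section \<open>Modified Bessel functions on the real axis\<close>

text \<open>Gamma (\<mu> + n + 1) behaves like n! n^\<mu>, read off from Euler's product limit
  \<open>rGamma_series\<close> at \<mu> + 1; the factor 1 + (\<mu> + 1) / n adjusts the
  index.\<close>

lemma rGamma_asymptotics:
  fixes \<mu> :: complex
  assumes "\<mu> + 1 \<notin> \<int>\<^sub>\<le>\<^sub>0"
  shows "(\<lambda>n. rGamma (\<mu> + of_nat n + 1) * fact n * exp (\<mu> * of_real (ln n))) \<longlonglongrightarrow> 1"
proof (rule Lim_transform_eventually)
  let ?f = "\<lambda>n. ((\<mu> + 1) / of_nat n + 1) * (rGamma (\<mu> + 1) / rGamma_series (\<mu> + 1) n)"
  have r0: "rGamma (\<mu> + 1) \<noteq> 0" using assms by (simp add: rGamma_eq_zero_iff)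
  have "(\<lambda>n. (\<mu> + 1) / of_nat n + 1) \<longlonglongrightarrow> 0 + 1"
    by (intro tendsto_intros lim_const_over_n)
  then have "?f \<longlonglongrightarrow> (0 + 1) * (rGamma (\<mu> + 1) / rGamma (\<mu> + 1))"
    by (intro tendsto_mult tendsto_divide tendsto_const rGamma_series_LIMSEQ r0)
  then show "?f \<longlonglongrightarrow> 1"
    using r0 by simp
  show "\<forall>\<^sub>F n in sequentially. ?f n =
      rGamma (\<mu> + of_nat n + 1) * fact n * exp (\<mu> * of_real (ln n))"
    using eventually_gt_at_top[of 0]
  proof eventually_elim
    case (elim n)
    define P where "P = pochhammer (\<mu> + 1) (Suc n)"
    define e where "e = exp (\<mu> * of_real (ln n))"
    have P: "rGamma (\<mu> + 1) = P * rGamma (\<mu> + 1 + of_nat (Suc n))"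
      unfolding P_def by (rule pochhammer_rGamma)
    then have P0: "P \<noteq> 0" using r0 by auto
    have e': "exp ((\<mu> + 1) * of_real (ln (real n))) = e * of_nat n"
      using elim exp_of_real[of "ln (real n)", where ?'a = complex] by (simp add: e_def distrib_right exp_add)
    have "rGamma (\<mu> + of_nat n + 1) = (\<mu> + 1 + of_nat n) * rGamma (\<mu> + 1 + of_nat (Suc n))"
      using rGamma_plus1[of "\<mu> + of_nat n + 1"] by (simp add: add_ac)
    moreover have "rGamma_series (\<mu> + 1) n = P / (fact n * (e * of_nat n))"
      by (simp only: rGamma_series_def P_def e' Suc_eq_plus1)
    ultimately show ?case using elim P0 P
      by (simp add: e_def[symmetric]) (simp add: field_simps)
  qed
qed

text \<open>Total mass and first two factorial moments of the index 2 k under the weights of the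
  cosh series, as needed for a variance.\<close>

lemma even_exponential_sums:
  fixes x :: real
  shows "(\<lambda>k. x ^ (2 * k) / fact (2 * k)) sums cosh x"
    and "(\<lambda>k. real (2 * k) * (x ^ (2 * k) / fact (2 * k))) sums (x * sinh x)"
    and "(\<lambda>k. real (2 * k) * (real (2 * k) - 1) * (x ^ (2 * k) / fact (2 * k))) sums (x\<^sup>2 * cosh x)"
proof -
  have "(\<lambda>k. (if even (2 * k) then x ^ (2 * k) /\<^sub>R fact (2 * k) else 0)) sums cosh x"
    using cosh_converges[of x] by (subst sums_mono_reindex[where g = "\<lambda>k. 2 * k"]) (auto simp: strict_mono_def)
  then show c: "(\<lambda>k. x ^ (2 * k) / fact (2 * k)) sums cosh x" by (simp add: divide_inverse mult.commute)
  have "(\<lambda>k. (if even (2 * k + 1) then 0 else x ^ (2 * k + 1) /\<^sub>R fact (2 * k + 1))) sums sinh x"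
    using sinh_converges[of x]
    by (subst sums_mono_reindex[where g = "\<lambda>k. 2 * k + 1" and f = "\<lambda>n. if even n then 0 else x ^ n /\<^sub>R fact n"])
      (auto simp: strict_mono_def elim!: oddE)
  then have s: "(\<lambda>k. x * (x ^ (2 * k + 1) / fact (2 * k + 1))) sums (x * sinh x)"
    by (intro sums_mult) (simp add: divide_inverse mult.commute)
  have f: "real (2 * Suc k) * (y / fact (2 * Suc k)) = y / fact (2 * k + 1)" for k y
  proof -
    have "fact (2 * Suc k) = real (2 * Suc k) * fact (2 * k + 1)" by (simp add: algebra_simps)
    then show ?thesis by (simp del: of_nat_Suc fact_Suc)
  qed
  have "(\<lambda>k. real (2 * Suc k) * (x ^ (2 * Suc k) / fact (2 * Suc k))) sums (x * sinh x)"
    using s unfolding f by simp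
  then show "(\<lambda>k. real (2 * k) * (x ^ (2 * k) / fact (2 * k))) sums (x * sinh x)"
    by (subst (asm) sums_Suc_iff) simp
  have g: "(real (2 * Suc k) - 1) * (y / fact (2 * k + 1)) = y / fact (2 * k)" for k y
  proof -
    have "fact (2 * k + 1) = real (2 * k + 1) * fact (2 * k)" "real (2 * Suc k) - 1 = real (2 * k + 1)"
      by (simp_all add: algebra_simps)
    moreover have "real (2 * k + 1) \<noteq> 0" by simp
    ultimately show ?thesis by (metis nonzero_mult_divide_mult_cancel_left times_divide_eq_right)
  qed
  have "real (2 * Suc k) * (real (2 * Suc k) - 1) * (x ^ (2 * Suc k) / fact (2 * Suc k)) = x\<^sup>2 * (x ^ (2 * k) / fact (2 * k))" for k
  proof -
    have "real (2 * Suc k) * (real (2 * Suc k) - 1) * (x ^ (2 * Suc k) / fact (2 * Suc k)) =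
        real (2 * Suc k) * ((real (2 * Suc k) - 1) * x ^ (2 * Suc k) / fact (2 * Suc k))"
      by (simp only: mult.assoc times_divide_eq_right)
    also have "\<dots> = (real (2 * Suc k) - 1) * (x ^ (2 * Suc k) / fact (2 * k + 1))"
      unfolding f by (simp only: times_divide_eq_right)
    also have "\<dots> = x ^ (2 * Suc k) / fact (2 * k)" by (rule g)
    finally show ?thesis by (simp add: power2_eq_square)
  qed
  then have h: "(\<lambda>k. real (2 * Suc k) * (real (2 * Suc k) - 1) * (x ^ (2 * Suc k) / fact (2 * Suc k))) =
      (\<lambda>k. x\<^sup>2 * (x ^ (2 * k) / fact (2 * k)))" by (rule ext)
  have "(\<lambda>k. real (2 * Suc k) * (real (2 * Suc k) - 1) * (x ^ (2 * Suc k) / fact (2 * Suc k))) sums (x\<^sup>2 * cosh x)"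
    unfolding h by (rule sums_mult[OF c])
  then show "(\<lambda>k. real (2 * k) * (real (2 * k) - 1) * (x ^ (2 * k) / fact (2 * k))) sums (x\<^sup>2 * cosh x)"
    by (subst (asm) sums_Suc_iff) simp
qed

text \<open>Chebyshev's inequality: under the weights \<open>x\<^sup>2\<^sup>k / (2k)!\<close> the index \<open>k\<close> concentrates at \<open>x / 2\<close>.\<close>

lemma even_exponential_variance:
  fixes x :: real
  assumes "x \<ge> 2"
  shows "summable (\<lambda>k. x ^ (2 * k) / fact (2 * k) * (real (k + 1) / (x / 2) - 1)\<^sup>2)" (is "summable ?f")
    and "(\<Sum>k. x ^ (2 * k) / fact (2 * k) * (real (k + 1) / (x / 2) - 1)\<^sup>2) \<le> 5 / x * cosh x"
proof -
  note s = even_exponential_sums[of x]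
  have f: "?f = (\<lambda>k. 1 / x\<^sup>2 * (real (2 * k) * (real (2 * k) - 1) * (x ^ (2 * k) / fact (2 * k)) +
      (5 - 2 * x) * (real (2 * k) * (x ^ (2 * k) / fact (2 * k))) + (2 - x)\<^sup>2 * (x ^ (2 * k) / fact (2 * k))))"
  proof
    fix k
    define p where "p = x ^ (2 * k) / fact (2 * k)"
    have "real (k + 1) / (x / 2) - 1 = (2 * real k + 2 - x) / x" using assms by (simp add: field_simps)
    then have "(real (k + 1) / (x / 2) - 1)\<^sup>2 = 1 / x\<^sup>2 * (2 * real k + 2 - x)\<^sup>2" by (simp add: power_divide)
    also have "(2 * real k + 2 - x)\<^sup>2 = real (2 * k) * (real (2 * k) - 1) + (5 - 2 * x) * real (2 * k) + (2 - x)\<^sup>2"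
      by (simp add: power2_eq_square algebra_simps)
    finally show "p * (real (k + 1) / (x / 2) - 1)\<^sup>2 = 1 / x\<^sup>2 * (real (2 * k) * (real (2 * k) - 1) * p +
      (5 - 2 * x) * (real (2 * k) * p) + (2 - x)\<^sup>2 * p)"
      by (simp only: ring_distribs mult_ac)
  qed
  have sums: "?f sums (1 / x\<^sup>2 * (x\<^sup>2 * cosh x + (5 - 2 * x) * (x * sinh x) + (2 - x)\<^sup>2 * cosh x))"
    unfolding f by (intro sums_mult sums_add s)
  then show "summable ?f" by (rule sums_summable)
  \<comment> \<open>The difference of cosh and sinh is exp (- x), so the quadratic terms of the
    moments cancel up to a bounded amount.\<close>
  have x2: "x\<^sup>2 \<le> 2 * exp x" using exp_lower_Taylor_quadratic[of x] assms by simp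
  then have "x\<^sup>2 * exp (- x) \<le> 2" by (simp add: exp_minus field_simps)
  moreover have c: "cosh x - sinh x = exp (- x)" "cosh x \<ge> 1" "sinh x \<le> cosh x"
    by (simp_all add: cosh_minus_sinh cosh_real_ge_1 sinh_le_cosh_real)
  ultimately have "x\<^sup>2 * (cosh x - sinh x) \<le> 2 * cosh x" by simp
  moreover have "x * (sinh x - cosh x) \<le> 0" "x * sinh x \<le> x * cosh x"
    using assms c by (auto simp: mult_le_0_iff)
  ultimately have "2 * (x\<^sup>2 * (cosh x - sinh x)) + 4 * cosh x + x * (sinh x - cosh x) * 4 + x * sinh x \<le> 4 * cosh x + 4 * cosh x + 0 + x * cosh x"
    by linarith
  moreover have "x\<^sup>2 * cosh x + (5 - 2 * x) * (x * sinh x) + (2 - x)\<^sup>2 * cosh x =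
      2 * (x\<^sup>2 * (cosh x - sinh x)) + 4 * cosh x + x * (sinh x - cosh x) * 4 + x * sinh x"
    by (simp add: power2_eq_square algebra_simps)
  ultimately have "x\<^sup>2 * cosh x + (5 - 2 * x) * (x * sinh x) + (2 - x)\<^sup>2 * cosh x \<le> (8 + x) * cosh x"
    by (simp add: algebra_simps)
  \<comment> \<open>The constant 5 is chosen so that 8 + x \<le> 5 x holds from x = 2 on.\<close>
  also have "\<dots> \<le> (5 * x) * cosh x" using assms c by (intro mult_right_mono) auto
  finally have "1 / x\<^sup>2 * (x\<^sup>2 * cosh x + (5 - 2 * x) * (x * sinh x) + (2 - x)\<^sup>2 * cosh x) \<le> 1 / x\<^sup>2 * ((5 * x) * cosh x)"
    by (intro mult_left_mono) auto
  also have "\<dots> = 5 / x * cosh x" using assms by (simp add: power2_eq_square)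
  finally show "(\<Sum>k. ?f k) \<le> 5 / x * cosh x" using sums_unique[OF sums] by simp
qed

text \<open>Apart from the factor (x / 2)^\<mu>, the k-th term of I is the k-th term of cosh times a
  quotient that behaves like k^(- s), s = \<mu> + 1 / 2, up to a constant. The index concentrates at
  x / 2, so (x / 2)^s times this quotient may be replaced by 1, and the sum becomes cosh x.\<close>

lemma besselI_real_asymptotics:
  fixes N :: real
  shows "((\<lambda>x::real. besselI (\<i> * N) x * (sqrt (2 * pi * x) * exp (- x))) \<longlongrightarrow> 1) at_top"
proof -
  define \<mu> s where "\<mu> = \<i> * complex_of_real N" and "s = \<mu> + 1 / 2"
  \<comment> \<open>Up to the constant sqrt \<pi>, the quotient of the k-th terms of the Bessel and
    cosh series.\<close>
  define c where "c k = complex_of_real (sqrt pi) * pochhammer (1 / 2) k * rGamma (\<mu> + of_nat k + 1)" for k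
  define b where "b k = c k * exp (s * of_real (ln (real (k + 1))))" for k
  have notin: "\<mu> + 1 \<notin> \<int>\<^sub>\<le>\<^sub>0" "- 1 / 2 + 1 \<notin> (\<int>\<^sub>\<le>\<^sub>0 :: complex set)"
    by (auto simp: \<mu>_def complex_eq_iff elim!: nonpos_Ints_cases)
  have b_lim: "b \<longlonglongrightarrow> 1"
  proof (rule Lim_transform_eventually)
    let ?f = "\<lambda>k. rGamma (\<mu> + of_nat k + 1) * fact k * exp (\<mu> * of_real (ln k)) /
        (rGamma (- 1 / 2 + of_nat k + 1) * fact k * exp (- 1 / 2 * of_real (ln k))) *
        exp (s * of_real (ln (real (k + 1)) - ln (real k)))"
    have "(\<lambda>k. ln (real (k + 1)) - ln (real k)) \<longlonglongrightarrow> 0" by real_asymp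
    then have "?f \<longlonglongrightarrow> 1 / 1 * exp (s * of_real 0)"
      by (intro tendsto_intros rGamma_asymptotics notin) auto
    then show "?f \<longlonglongrightarrow> 1" by simp
    have "?f k = b k" for k
    proof -
      have r: "pochhammer (1 / 2) k * rGamma (1 / 2 + of_nat k) = 1 / complex_of_real (sqrt pi)"
        using pochhammer_rGamma[of "1 / 2 :: complex" k] Gamma_one_half_complex by (simp add: rGamma_inverse_Gamma inverse_eq_divide)
      then have r': "rGamma (1 / 2 + of_nat k) \<noteq> (0 :: complex)" by auto
      have e: "exp (s * of_real (ln (real (k + 1)) - ln (real k))) =
          exp (s * of_real (ln (real (k + 1)))) * exp (- 1 / 2 * of_real (ln k)) / exp (\<mu> * of_real (ln k))"
        by (simp add: s_def algebra_simps flip: exp_add exp_diff)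
      have "complex_of_real (sqrt pi) * pochhammer (1 / 2) k * rGamma (1 / 2 + of_nat k) = 1"
        using r by (simp add: mult.assoc)
      then have "complex_of_real (sqrt pi) * pochhammer (1 / 2) k = 1 / rGamma (1 / 2 + of_nat k)"
        using r' by (simp add: field_simps)
      then show ?thesis unfolding b_def c_def e using r' by (simp add: add_ac)
    qed
    then show "\<forall>\<^sub>F k in sequentially. ?f k = b k" by simp
  qed
  then obtain M where M: "M > 0" "\<And>k. cmod (b k) \<le> M"
    using convergent_imp_Bseq[OF convergentI] by (meson BseqE)
  define p where "p x k = x ^ (2 * k) / fact (2 * k)" for x :: real and k
  \<comment> \<open>Relative error in the k-th term: \<open>1 + d x k\<close> equals
    \<open>c k\<close> times (x / 2)^s. Writing k + 1 in the powers avoids the logarithm of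
    0.\<close>
  define d where "d x k = b k * exp (- s * of_real (ln (real (k + 1) / (x / 2)))) - 1" for x :: real and k
  have p0: "p x k \<ge> 0" for x k by (simp add: p_def)
  have psum: "p x sums cosh x" for x unfolding p_def by (rule even_exponential_sums)
  \<comment> \<open>A crude bound valid for every index. Its growth of order sqrt x is affordable
    because the variance is only of order 1 / x.\<close>
  have d_bound: "cmod (d x k) \<le> 1 + M * sqrt (x / 2)" if "x > 0" for x k
  proof -
    have l: "ln (real (k + 1) / (x / 2)) = ln (real (k + 1)) - ln (x / 2)"
      using that by (subst ln_div) auto
    have "cmod (exp (- s * of_real (ln (real (k + 1) / (x / 2))))) = exp (- (1 / 2) * ln (real (k + 1))) * exp (1 / 2 * ln (x / 2))"
      unfolding l by (simp add: s_def \<mu>_def algebra_simps flip: exp_add)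
    also have "\<dots> \<le> 1 * exp (1 / 2 * ln (x / 2))" by (intro mult_right_mono) auto
    also have "exp (1 / 2 * ln (x / 2)) = sqrt (x / 2)"
      using that by (simp add: ln_sqrt[symmetric] del: ln_div)
    finally have "cmod (b k * exp (- s * of_real (ln (real (k + 1) / (x / 2))))) \<le> M * sqrt (x / 2)"
      unfolding norm_mult using M by (intro mult_mono) auto
    then show ?thesis unfolding d_def using norm_triangle_ineq4[of "b k * exp (- s * of_real (ln (real (k + 1) / (x / 2))))" 1] by simp
  qed
  have pd: "summable (\<lambda>k. cmod (p x k * d x k))" if "x > 0" for x
  proof (rule summable_comparison_test')
    show "summable (\<lambda>k. (1 + M * sqrt (x / 2)) * p x k)"
      using psum by (intro summable_mult) (rule sums_summable)
    show "norm (cmod (p x k * d x k)) \<le> (1 + M * sqrt (x / 2)) * p x k" for k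
      using mult_left_mono[OF d_bound[OF that, of k] p0[of x k]] p0[of x k] by (simp add: norm_mult mult.commute)
  qed
  have key: "((\<lambda>x. (\<Sum>k. p x k * d x k) / complex_of_real (cosh x)) \<longlongrightarrow> 0) at_top"
  proof (rule tendstoI)
    fix \<epsilon> :: real assume "\<epsilon> > 0"
    \<comment> \<open>Near x / 2 the error splits into three terms of size at most \<epsilon>',
      together at most \<epsilon> / 2.\<close>
    define \<epsilon>' where "\<epsilon>' = min 1 (\<epsilon> / 6)"
    have e': "\<epsilon>' > 0" "\<epsilon>' \<le> 1" "\<epsilon>' \<le> \<epsilon> / 6" using \<open>\<epsilon> > 0\<close> by (auto simp: \<epsilon>'_def)
    have "((\<lambda>v::real. exp (- s * of_real (ln v))) \<longlongrightarrow> exp (- s * of_real (ln 1))) (at 1)"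
      by (intro tendsto_intros) auto
    then obtain \<delta>0 where \<delta>0: "\<delta>0 > 0" "\<And>v::real. v \<noteq> 1 \<Longrightarrow> dist v 1 < \<delta>0 \<Longrightarrow> cmod (exp (- s * of_real (ln v)) - 1) < \<epsilon>'"
      using e'(1) unfolding tendsto_iff eventually_at by (auto simp: dist_norm)
    define \<delta> where "\<delta> = min \<delta>0 (1 / 2)"
    have \<delta>: "\<delta> > 0" "\<delta> \<le> 1 / 2" using \<delta>0(1) by (auto simp: \<delta>_def)
    have exp_near: "cmod (exp (- s * of_real (ln v)) - 1) < \<epsilon>'" if "dist v 1 < \<delta>" for v :: real
      using \<delta>0(2)[of v] that e'(1) by (cases "v = 1") (auto simp: \<delta>_def)
    obtain K where K: "\<And>k. k \<ge> K \<Longrightarrow> cmod (b k - 1) < \<epsilon>'"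
      using b_lim e'(1) unfolding lim_sequentially dist_norm by blast
    \<comment> \<open>With this B the crude bound is at most B times the squared deviation off the
      \<delta>-neighbourhood, as in Chebyshev's inequality.\<close>
    define B where "B x = (1 + M * sqrt (x / 2)) / \<delta>\<^sup>2" for x
    have bnd: "\<forall>\<^sub>F x in at_top. cmod ((\<Sum>k. p x k * d x k) / complex_of_real (cosh x)) \<le> \<epsilon> / 2 + B x * (5 / x)"
      \<comment> \<open>In the neighbourhood k + 1 exceeds x / 4, so x \<ge> 4 (K + 1) forces k
        \<ge> K.\<close>
      using eventually_ge_at_top[of "max 2 (4 * (real K + 1))"]
    proof eventually_elim
      case (elim x)
      then have x: "x \<ge> 2" "x \<ge> 4 * (real K + 1)" by auto
      have dk: "cmod (d x k) \<le> \<epsilon> / 2 + B x * (real (k + 1) / (x / 2) - 1)\<^sup>2" for k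
      proof (cases "dist (real (k + 1) / (x / 2)) 1 < \<delta>")
        case True
        have "v > 1 / 2" if "dist v 1 < \<delta>" for v :: real using that \<delta>(2) unfolding dist_real_def by linarith
        from this[OF True] have "real (k + 1) / (x / 2) > 1 / 2" .
        then have "real (k + 1) > x / 4" using x by (simp add: field_simps)
        with x(2) have "real K + 1 < real (k + 1)" by simp
        then have "real K < real k" by simp
        then have k: "k \<ge> K" by simp
        define e where "e = exp (- s * of_real (ln (real (k + 1) / (x / 2))))"
        have e: "cmod (e - 1) \<le> \<epsilon>'" "cmod (b k - 1) \<le> \<epsilon>'" using exp_near[OF True] K[OF k] by (auto simp: e_def)
        have "d x k = (b k - 1) * (e - 1) + (b k - 1) + (e - 1)" by (simp add: d_def e_def algebra_simps)
        also have "cmod \<dots> \<le> cmod (b k - 1) * cmod (e - 1) + cmod (b k - 1) + cmod (e - 1)"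
          by (metis norm_mult norm_triangle_ineq norm_triangle_mono order_refl)
        also have "\<dots> \<le> 1 * \<epsilon>' + \<epsilon>' + \<epsilon>'" using e e' by (intro add_mono mult_mono) auto
        also have "\<dots> \<le> \<epsilon> / 2" using e' by simp
        finally have "cmod (d x k) \<le> \<epsilon> / 2" .
        moreover have "B x * (real (k + 1) / (x / 2) - 1)\<^sup>2 \<ge> 0" using M x by (simp add: B_def)
        ultimately show ?thesis by linarith
      next
        case False
        then have "\<delta> \<le> \<bar>real (k + 1) / (x / 2) - 1\<bar>" by (simp add: dist_real_def)
        then have "\<delta>\<^sup>2 \<le> (real (k + 1) / (x / 2) - 1)\<^sup>2" using \<delta>(1) by (metis abs_le_square_iff abs_of_pos)
        then have "1 + M * sqrt (x / 2) \<le> B x * (real (k + 1) / (x / 2) - 1)\<^sup>2"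
          using \<delta>(1) M x mult_left_mono[of "\<delta>\<^sup>2" "(real (k + 1) / (x / 2) - 1)\<^sup>2" "B x"] by (simp add: B_def)
        then show ?thesis using d_bound[of x k] x \<open>\<epsilon> > 0\<close> by linarith
      qed
      note v = even_exponential_variance[OF x(1), folded p_def]
      have sm: "summable (\<lambda>k. p x k * (\<epsilon> / 2) + B x * (p x k * (real (k + 1) / (x / 2) - 1)\<^sup>2))"
        by (intro summable_add summable_mult summable_mult2 v(1)) (use psum in \<open>rule sums_summable\<close>)
      have "cmod (\<Sum>k. p x k * d x k) \<le> (\<Sum>k. cmod (p x k * d x k))"
        using pd[of x] x by (intro summable_norm) auto
      also have "\<dots> \<le> (\<Sum>k. p x k * (\<epsilon> / 2) + B x * (p x k * (real (k + 1) / (x / 2) - 1)\<^sup>2))"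
      proof (intro suminf_le sm pd)
        show "cmod (p x k * d x k) \<le> p x k * (\<epsilon> / 2) + B x * (p x k * (real (k + 1) / (x / 2) - 1)\<^sup>2)" for k
          using mult_left_mono[OF dk[of k] p0[of x k]] p0[of x k] by (simp add: norm_mult algebra_simps)
      qed (use x in auto)
      also have "\<dots> = cosh x * (\<epsilon> / 2) + B x * (\<Sum>k. p x k * (real (k + 1) / (x / 2) - 1)\<^sup>2)"
        by (intro sums_unique[symmetric] sums_add sums_mult2 sums_mult psum summable_sums v(1))
      also have "\<dots> \<le> cosh x * (\<epsilon> / 2) + B x * (5 / x * cosh x)"
        using v(2) M x by (intro add_left_mono mult_left_mono) (auto simp: B_def)
      finally have "cmod (\<Sum>k. p x k * d x k) \<le> (\<epsilon> / 2 + B x * (5 / x)) * cosh x" by (simp add: algebra_simps)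
      then show ?case using cosh_real_pos[of x] by (simp add: norm_divide pos_divide_le_eq)
    qed
    have lim: "((\<lambda>x. \<epsilon> / 2 + B x * (5 / x)) \<longlongrightarrow> \<epsilon> / 2) at_top"
      unfolding B_def using \<delta>(1) M(1) by real_asymp
    have "\<forall>\<^sub>F x in at_top. \<epsilon> / 2 + B x * (5 / x) < \<epsilon>"
      using order_tendstoD(2)[OF lim, of \<epsilon>] \<open>\<epsilon> > 0\<close> by simp
    with bnd show "\<forall>\<^sub>F x in at_top. dist ((\<Sum>k. p x k * d x k) / complex_of_real (cosh x)) 0 < \<epsilon>"
      by eventually_elim simp
  qed
  show ?thesis
  proof (rule Lim_transform_eventually)
    let ?f = "\<lambda>x. of_real (2 * exp (- x) * cosh x) * ((\<Sum>k. p x k * d x k) / complex_of_real (cosh x) + 1)"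
    have "((\<lambda>x. 2 * exp (- x) * cosh x) \<longlongrightarrow> (1 :: real)) at_top"
      unfolding cosh_def by (simp add: field_simps) real_asymp
    then have "(?f \<longlongrightarrow> of_real 1 * (0 + 1)) at_top"
      by (intro tendsto_intros key)
    then show "(?f \<longlongrightarrow> 1) at_top" by simp
    show "\<forall>\<^sub>F x in at_top. ?f x =
        besselI (\<i> * N) (complex_of_real x) * (sqrt (2 * pi * x) * exp (- x))"
      using eventually_gt_at_top[of 0]
    proof eventually_elim
      case (elim x)
      define t where "t = x / 2"
      have t: "t > 0" using elim by (simp add: t_def)
      \<comment> \<open>The duplication formula (2 k)! = 4^k (1/2)_k k! turns the cosh term times
        \<open>c k\<close> into the Bessel term.\<close>
      have tm: "of_real (p x k) + p x k * d x k = exp (s * of_real (ln t)) * of_real (sqrt pi) * (((of_real x)\<^sup>2 / 4) ^ k * rGamma (\<mu> + of_nat k + 1) / fact k)" for k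
      proof -
        have "exp (s * of_real (ln (real (k + 1)))) * exp (- s * of_real (ln (real (k + 1) / t))) = exp (s * of_real (ln t))"
          using t by (simp add: ln_div algebra_simps flip: exp_add)
        then have "of_real (p x k) + p x k * d x k = of_real (p x k) * c k * exp (s * of_real (ln t))"
          by (simp add: d_def b_def t_def algebra_simps)
        moreover have "of_real (p x k) * pochhammer (1 / 2) k = ((complex_of_real x)\<^sup>2 / 4) ^ k / fact k"
        proof -
          have "fact (2 * k) = (4 ^ k * pochhammer (1 / 2) k * fact k :: complex)"
            by (simp add: fact_double power_mult)
          moreover have "pochhammer (1 / 2) k \<noteq> (0 :: complex)"
            by (metis calculation fact_nonzero mult_zero_left mult_zero_right)
          ultimately show ?thesis by (simp add: p_def power_mult power_divide)
        qed
        moreover have "P * (q * y * R) * E = E * q * ((P * y) * R)" for P q y R E :: complex by (simp add: mult_ac)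
        then have "of_real (p x k) * c k * exp (s * of_real (ln t)) =
            exp (s * of_real (ln t)) * of_real (sqrt pi) * ((of_real (p x k) * pochhammer (1 / 2) k) * rGamma (\<mu> + of_nat k + 1))"
          unfolding c_def .
        ultimately show ?thesis by (simp only: times_divide_eq_left)
      qed
      have "summable (\<lambda>k. p x k * d x k)" using pd[OF elim] by (rule summable_norm_cancel)
      from sums_add[OF sums_of_real[OF psum] summable_sums[OF this]]
      have "(\<lambda>k. of_real (p x k) + p x k * d x k) sums (of_real (cosh x) + (\<Sum>k. p x k * d x k))" .
      then have "(\<lambda>k. exp (s * of_real (ln t)) * of_real (sqrt pi) * (((of_real x)\<^sup>2 / 4) ^ k * rGamma (\<mu> + of_nat k + 1) / fact k)) sums
          (of_real (cosh x) + (\<Sum>k. p x k * d x k))" by (simp only: tm)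
      moreover have nz: "exp (s * of_real (ln t)) * of_real (sqrt pi) \<noteq> 0" by simp
      ultimately have "(\<lambda>k. ((of_real x)\<^sup>2 / 4) ^ k * rGamma (\<mu> + of_nat k + 1) / fact k) sums
          ((of_real (cosh x) + (\<Sum>k. p x k * d x k)) / (exp (s * of_real (ln t)) * of_real (sqrt pi)))"
        by (rule sums_mult_D)
      then have I: "besselI \<mu> x = of_real t powr \<mu> * ((of_real (cosh x) + (\<Sum>k. p x k * d x k)) / (exp (s * of_real (ln t)) * of_real (sqrt pi)))"
        unfolding besselI_def by (simp add: sums_iff t_def)
      have st: "exp (s * of_real (ln t)) = of_real t powr \<mu> * of_real (sqrt t)"
      proof -
        have "exp (s * of_real (ln t)) = exp (\<mu> * of_real (ln t)) * exp (of_real (1 / 2 * ln t))"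
          by (simp add: s_def algebra_simps flip: exp_add)
        also have "exp (of_real (1 / 2 * ln t)) = complex_of_real (sqrt t)"
          unfolding exp_of_real using t by (simp add: ln_sqrt[symmetric])
        finally show ?thesis using t by (simp add: powr_def Ln_of_real)
      qed
      have "sqrt (2 * pi * x) = 2 * sqrt t * sqrt pi"
      proof -
        have "2 * pi * x = 4 * (t * pi)" by (simp add: t_def)
        then show ?thesis by (simp only: real_sqrt_mult) simp
      qed
      moreover have "of_real t powr \<mu> \<noteq> 0" using t by simp
      moreover have "cosh x > 0" by simp
      ultimately show ?case unfolding \<mu>_def[symmetric] I st using t
        by (simp add: field_simps)
    qed
  qed
qed

text \<open>Integration of f' from x to infinity, where f vanishes: an exponential asymptotic of the
  derivative passes to the function.\<close>

lemma vanishing_at_top_asymptotics: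
  fixes f :: "real \<Rightarrow> complex"
  assumes \<kappa>: "\<kappa> > 0" and f0: "(f \<longlongrightarrow> 0) at_top"
    and f': "\<forall>\<^sub>F x in at_top. (f has_vector_derivative f' x) (at x)"
    and lim: "((\<lambda>x. f' x * exp (\<kappa> * x)) \<longlongrightarrow> m) at_top"
  shows "((\<lambda>x. f x * exp (\<kappa> * x)) \<longlongrightarrow> - m / \<kappa>) at_top"
proof (rule tendstoI)
  fix \<epsilon> :: real assume "\<epsilon> > 0"
  define \<epsilon>' where "\<epsilon>' = \<kappa> * \<epsilon> / 2"
  have e': "\<epsilon>' > 0" using \<open>\<epsilon> > 0\<close> \<kappa> by (simp add: \<epsilon>'_def)
  \<comment> \<open>h is f minus its expected leading term, and \<phi> has as derivative the bound
    \<epsilon>' exp (- \<kappa> x) for |h'|.\<close>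
  define h where "h x = f x + m / \<kappa> * of_real (exp (- \<kappa> * x))" for x
  define \<phi> where "\<phi> x = - \<epsilon>' / \<kappa> * exp (- \<kappa> * x)" for x
  have dexp: "((\<lambda>x. exp (- \<kappa> * x)) has_real_derivative - \<kappa> * exp (- \<kappa> * x)) (at x)" for x
    by (auto intro!: derivative_eq_intros)
  have dh: "(h has_vector_derivative f' x - m * of_real (exp (- \<kappa> * x))) (at x)" if "(f has_vector_derivative f' x) (at x)" for x
  proof -
    have "((\<lambda>x. complex_of_real (exp (- \<kappa> * x))) has_vector_derivative of_real (- \<kappa> * exp (- \<kappa> * x))) (at x)"
      using dexp[of x] by (intro has_vector_derivative_of_real) (simp add: has_real_derivative_iff_has_vector_derivative)
    from has_vector_derivative_add[OF that has_vector_derivative_mult_right[OF this, of "m / \<kappa>"]]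
    show ?thesis using \<kappa> by (simp add: h_def[abs_def])
  qed
  have d\<phi>: "(\<phi> has_vector_derivative \<epsilon>' * exp (- \<kappa> * x)) (at x)" for x
    using DERIV_cmult[OF dexp, of "- \<epsilon>' / \<kappa>"] \<kappa>
    by (simp add: \<phi>_def[abs_def] has_real_derivative_iff_has_vector_derivative)
  have exp0: "((\<lambda>x. exp (- \<kappa> * x)) \<longlongrightarrow> 0) at_top" using \<kappa> by real_asymp
  have h0: "(h \<longlongrightarrow> 0 + m / \<kappa> * of_real 0) at_top"
    unfolding h_def[abs_def] by (intro tendsto_intros f0 exp0)
  have "\<forall>\<^sub>F x in at_top. (f has_vector_derivative f' x) (at x) \<and> dist (f' x * exp (\<kappa> * x)) m < \<epsilon>'"
    using tendstoD[OF lim e'] f' by eventually_elim simp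
  then obtain X where X: "\<And>x. x \<ge> X \<Longrightarrow> (f has_vector_derivative f' x) (at x) \<and> dist (f' x * exp (\<kappa> * x)) m < \<epsilon>'"
    unfolding eventually_at_top_linorder by blast
  have bound: "cmod (f' x - m * of_real (exp (- \<kappa> * x))) \<le> \<epsilon>' * exp (- \<kappa> * x)" if "x \<ge> X" for x
  proof -
    have "f' x - m * of_real (exp (- \<kappa> * x)) = (f' x * exp (\<kappa> * x) - m) * of_real (exp (- \<kappa> * x))"
      by (simp add: algebra_simps exp_of_real exp_minus)
    then have "cmod (f' x - m * of_real (exp (- \<kappa> * x))) = dist (f' x * exp (\<kappa> * x)) m * exp (- \<kappa> * x)"
      by (simp add: norm_mult dist_norm)
    also have "\<dots> \<le> \<epsilon>' * exp (- \<kappa> * x)" using X[OF that] by (intro mult_right_mono) auto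
    finally show ?thesis .
  qed
  have main: "cmod (h x) \<le> \<epsilon>' / \<kappa> * exp (- \<kappa> * x)" if x: "x \<ge> X" for x
  \<comment> \<open>The increment of h over [x, y] is bounded uniformly in y; as y grows, h y tends
    to 0 and only h x is left.\<close>
  proof (rule tendsto_upperbound)
    show "((\<lambda>y. cmod (h y - h x)) \<longlongrightarrow> cmod (h x)) at_top"
      using tendsto_norm[OF tendsto_diff[OF h0 tendsto_const[of "h x"]]] by simp
    have "cmod (h y - h x) \<le> \<epsilon>' / \<kappa> * exp (- \<kappa> * x)" if y: "y > x" for y
    proof -
      have "cmod (h y - h x) \<le> \<phi> y - \<phi> x"
      proof (rule differentiable_bound_general[OF y])
        show "continuous_on {x..y} h" "continuous_on {x..y} \<phi>"
          using X x by (auto intro!: continuous_on_vector_derivative has_vector_derivative_at_within[OF dh]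
              has_vector_derivative_at_within[OF d\<phi>])
      qed (use X x in \<open>auto intro!: dh d\<phi> bound\<close>)
      also have "\<dots> \<le> - \<phi> x" using e' \<kappa> by (simp add: \<phi>_def)
      finally show ?thesis by (simp add: \<phi>_def)
    qed
    then show "\<forall>\<^sub>F y in at_top. cmod (h y - h x) \<le> \<epsilon>' / \<kappa> * exp (- \<kappa> * x)"
      by (intro eventually_mono[OF eventually_gt_at_top[of x]])
  qed simp
  have "dist (f x * exp (\<kappa> * x)) (- m / \<kappa>) < \<epsilon>" if "x \<ge> X" for x
  proof -
    have "f x * exp (\<kappa> * x) - (- m / \<kappa>) = h x * of_real (exp (\<kappa> * x))"
      by (simp add: h_def algebra_simps exp_of_real exp_minus)
    then have "dist (f x * exp (\<kappa> * x)) (- m / \<kappa>) = cmod (h x) * exp (\<kappa> * x)"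
      by (simp add: dist_norm norm_mult)
    also have "\<dots> \<le> \<epsilon>' / \<kappa> * exp (- \<kappa> * x) * exp (\<kappa> * x)"
      using main[OF that] by (intro mult_right_mono) auto
    also have "\<dots> = \<epsilon> / 2" using \<kappa> by (simp add: \<epsilon>'_def exp_minus field_simps)
    also have "\<dots> < \<epsilon>" using \<open>\<epsilon> > 0\<close> by simp
    finally show ?thesis .
  qed
  then show "\<forall>\<^sub>F x in at_top. dist (f x * exp (\<kappa> * x)) (- m / \<kappa>) < \<epsilon>"
    by (auto simp: eventually_at_top_linorder)
qed

text \<open>With a real denominator the real and imaginary parts can be treated separately by the
  real rule.\<close>

lemma lhopital_at_top_complex:
  fixes f :: "real \<Rightarrow> complex" and g :: "real \<Rightarrow> real"
  assumes "filterlim g at_top at_top" "\<And>x. x > 0 \<Longrightarrow> g' x \<noteq> 0"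
    and f: "\<And>x. x > 0 \<Longrightarrow> (f has_vector_derivative f' x) (at x)"
    and g: "\<And>x. x > 0 \<Longrightarrow> (g has_real_derivative g' x) (at x)"
    and lim: "((\<lambda>x. f' x / g' x) \<longlongrightarrow> l) at_top"
  shows "((\<lambda>x. f x / g x) \<longlongrightarrow> l) at_top"
proof -
  have ev: "\<forall>\<^sub>F x in at_top. P x" if "\<And>x::real. x > 0 \<Longrightarrow> P x" for P
    using that eventually_gt_at_top[of 0] by (rule eventually_mono[rotated])
  have "((\<lambda>x. Re (f x)) has_real_derivative Re (f' x)) (at x)" "((\<lambda>x. Im (f x)) has_real_derivative Im (f' x)) (at x)" if "x > 0" for x
    using bounded_linear.has_vector_derivative[OF bounded_linear_Re f[OF that]]
      bounded_linear.has_vector_derivative[OF bounded_linear_Im f[OF that]]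
    unfolding has_real_derivative_iff_has_vector_derivative by blast+
  note d = ev[OF this(1)] ev[OF this(2)]
  have Re: "((\<lambda>x. Re (f x) / g x) \<longlongrightarrow> Re l) at_top"
    using tendsto_Re[OF lim]
    by (intro lhospital_at_top_at_top[OF assms(1) ev[OF assms(2)] d(1) ev[OF g]]) (simp_all add: Re_divide_of_real)
  have Im: "((\<lambda>x. Im (f x) / g x) \<longlongrightarrow> Im l) at_top"
    using tendsto_Im[OF lim]
    by (intro lhospital_at_top_at_top[OF assms(1) ev[OF assms(2)] d(2) ev[OF g]]) (simp_all add: Im_divide_of_real)
  show ?thesis using Re Im by (simp add: tendsto_complex_iff Re_divide_of_real Im_divide_of_real)
qed

section \<open>The Wronskian and the decay of K on the real axis\<close>

lemma bessel_system_real: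
  assumes "bessel_system N w w1" "x > 0"
  shows "((\<lambda>x::real. w x) has_vector_derivative w1 x) (at x)"
    "((\<lambda>x::real. w1 x) has_vector_derivative N\<^sup>2 * (1 - 1 / (of_real x)\<^sup>2) * w x - w1 x / x) (at x)"
proof -
  have r: "((\<lambda>x. complex_of_real x) has_vector_derivative 1) (at x)"
    using has_vector_derivative_of_real[OF DERIV_ident, where 'a = complex] by simp
  have x: "of_real x \<in> upper - {0}" using assms(2) by (simp add: upper_def)
  show "((\<lambda>x::real. w x) has_vector_derivative w1 x) (at x)"
    "((\<lambda>x::real. w1 x) has_vector_derivative N\<^sup>2 * (1 - 1 / (of_real x)\<^sup>2) * w x - w1 x / x) (at x)"
    using has_vector_derivative_chain_upper[OF r, of w _ UNIV] has_vector_derivative_chain_upper[OF r, of w1 _ UNIV]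
      assms(1) x by (auto simp: bessel_system_def upper_def)
qed

lemma bessel_system_lincomb:
  assumes "bessel_system N u u1" "bessel_system N v v1"
  shows "bessel_system N (\<lambda>z. a * u z + b * v z) (\<lambda>z. a * u1 z + b * v1 z)"
  unfolding bessel_system_def
proof (intro ballI conjI)
  fix z assume z: "z \<in> upper - {0}"
  have d: "(u has_field_derivative u1 z) (at z within upper)" "(v has_field_derivative v1 z) (at z within upper)"
    "(u1 has_field_derivative N\<^sup>2 * (1 - 1 / z\<^sup>2) * u z - u1 z / z) (at z within upper)"
    "(v1 has_field_derivative N\<^sup>2 * (1 - 1 / z\<^sup>2) * v z - v1 z / z) (at z within upper)"
    using assms z unfolding bessel_system_def by blast+
  show "((\<lambda>z. a * u z + b * v z) has_field_derivative a * u1 z + b * v1 z) (at z within upper)"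
    by (intro DERIV_add DERIV_cmult d)
  show "((\<lambda>z. a * u1 z + b * v1 z) has_field_derivative
      N\<^sup>2 * (1 - 1 / z\<^sup>2) * (a * u z + b * v z) - (a * u1 z + b * v1 z) / z) (at z within upper)"
    by (rule DERIV_cong[OF DERIV_add[OF DERIV_cmult[OF d(3)] DERIV_cmult[OF d(4)]]])
      (simp add: algebra_simps add_divide_distrib)
qed


text \<open>By the equation x times the Wronskian is constant. As x tends to 0 the powers of order
  \<mu> and - \<mu> multiply to 1, only the values of the series at 0 remain, and the reflection
  formula of Gamma gives the sine.\<close>

lemma wronskian_besselI:
  fixes \<nu> x :: real and \<mu> :: complex
  assumes \<nu>: "\<nu> > 0" and x: "x > 0" and \<mu>_def: "\<mu> = \<i> * of_real \<nu>"
  shows "x * (besselI \<mu> (\<nu> * x) * besselI' (- \<mu>) \<nu> x - besselI' \<mu> \<nu> x * besselI (- \<mu>) (\<nu> * x)) =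
    - 2 * sin (\<mu> * pi) / pi"
proof -
  define u u1 v v1 where "u z = besselI \<mu> (of_real \<nu> * z)" and "u1 = besselI' \<mu> \<nu>"
    and "v z = besselI (- \<mu>) (of_real \<nu> * z)" and "v1 = besselI' (- \<mu>) \<nu>" for z
  have m2: "\<mu>\<^sup>2 = - (of_real \<nu>)\<^sup>2" "(- \<mu>)\<^sup>2 = - (of_real \<nu>)\<^sup>2" by (simp_all add: \<mu>_def power_mult_distrib)
  have sys: "bessel_system \<nu> u u1" "bessel_system \<nu> v v1"
    unfolding u_def u1_def v_def v1_def by (intro bessel_system_besselI \<nu> m2 refl)+
  define W where "W y = of_real y * (u (of_real y) * v1 (of_real y) - u1 (of_real y) * v (of_real y))" for y :: real
  have dW: "(W has_vector_derivative 0) (at y)" if "y > 0" for y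
  proof -
    note d = bessel_system_real[OF sys(1) that] bessel_system_real[OF sys(2) that]
    have r: "((\<lambda>x. complex_of_real x) has_vector_derivative 1) (at y)"
      using has_vector_derivative_of_real[OF DERIV_ident, where 'a = complex] by simp
    show ?thesis unfolding W_def[abs_def]
      by (rule has_vector_derivative_eq_rhs[OF has_vector_derivative_mult[OF r has_vector_derivative_diff[OF
          has_vector_derivative_mult[OF d(1,4)] has_vector_derivative_mult[OF d(2,3)]]]])
        (use that in \<open>simp add: field_simps\<close>)
  qed
  have "(W has_vector_derivative 0) (at y within {0<..})" if "y \<in> {0<..}" for y
    using that by (intro has_vector_derivative_at_within[OF dW]) simp
  then obtain C where "\<And>y. y \<in> {0<..} \<Longrightarrow> W y = C"
    using has_vector_derivative_zero_constant[of "{0<..}" W] convex_real_interval(3)[of 0] by blast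
  then have const: "W y = W x" if "y \<in> {0<..}" for y using that x by simp
  define g where "g \<mu> z = bessel_series \<mu> ((of_real \<nu> * z)\<^sup>2 / 4)" for \<mu> z
  have glim: "((\<lambda>y::real. g \<mu> y) \<longlongrightarrow> rGamma (\<mu> + 1)) (at_right 0)" for \<mu>
  proof -
    have "((\<lambda>y::real. (of_real \<nu> * complex_of_real y)\<^sup>2 / 4) \<longlongrightarrow> (of_real \<nu> * of_real 0)\<^sup>2 / 4) (at_right 0)"
      by (intro tendsto_intros) auto
    then have "((\<lambda>y::real. g \<mu> y) \<longlongrightarrow> bessel_series \<mu> ((of_real \<nu> * of_real 0)\<^sup>2 / 4)) (at_right 0)"
      unfolding g_def[abs_def] using continuous_on_bessel_series[of UNIV]
      by (intro isCont_tendsto_compose[where g = "bessel_series \<mu>"]) (simp add: continuous_on_eq_continuous_at)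
    then show ?thesis by simp
  qed
  let ?f = "\<lambda>y. - 2 * \<mu> * (g \<mu> y * g (- \<mu>) y) +
      (of_real \<nu>)\<^sup>2 * (of_real y)\<^sup>2 / 2 * (g \<mu> y * g (- \<mu> + 1) y - g (\<mu> + 1) y * g (- \<mu>) y)"
  have W: "W y = ?f y" if "y > 0" for y
  proof -
    define P Q where "P = (of_real \<nu> * of_real y / 2) powr \<mu>" and "Q = (of_real \<nu> * of_real y / 2) powr (- \<mu>)"
    have PQ: "P * Q = 1" using that \<nu> by (simp add: P_def Q_def flip: powr_add)
    have "W y = y * ((P * g \<mu> y) * (Q * (- \<mu> / y * g (- \<mu>) y + (of_real \<nu>)\<^sup>2 * y / 2 * g (- \<mu> + 1) y)) -
        P * (\<mu> / y * g \<mu> y + (of_real \<nu>)\<^sup>2 * y / 2 * g (\<mu> + 1) y) * (Q * g (- \<mu>) y))"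
      unfolding W_def u_def u1_def v_def v1_def besselI_series besselI'_def P_def Q_def g_def by simp
    also have "\<dots> = (P * Q) * (?f y)"
      using that by (simp add: field_simps power2_eq_square)
    finally show ?thesis by (simp add: PQ)
  qed
  have "(W \<longlongrightarrow> - 2 * \<mu> * (rGamma (\<mu> + 1) * rGamma (- \<mu> + 1)) +
      (of_real \<nu>)\<^sup>2 * (of_real 0)\<^sup>2 / 2 * (rGamma (\<mu> + 1) * rGamma (- \<mu> + 1 + 1) - rGamma (\<mu> + 1 + 1) * rGamma (- \<mu> + 1))) (at_right 0)"
  proof (rule Lim_transform_eventually)
    show "(?f \<longlongrightarrow>
      - 2 * \<mu> * (rGamma (\<mu> + 1) * rGamma (- \<mu> + 1)) +
      (of_real \<nu>)\<^sup>2 * (of_real 0)\<^sup>2 / 2 * (rGamma (\<mu> + 1) * rGamma (- \<mu> + 1 + 1) - rGamma (\<mu> + 1 + 1) * rGamma (- \<mu> + 1))) (at_right 0)"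
      by (intro tendsto_intros glim) auto
    show "\<forall>\<^sub>F y in at_right 0. ?f y = W y"
      using eventually_at_right_less[of 0] by eventually_elim (simp add: W)
  qed
  moreover have "(W \<longlongrightarrow> W x) (at_right 0)"
    by (rule Lim_transform_eventually[OF tendsto_const])
      (use eventually_at_right_less[of 0] in \<open>eventually_elim, use const in auto\<close>)
  ultimately have "W x = - 2 * (\<mu> * rGamma (\<mu> + 1) * rGamma (- \<mu> + 1))"
    using tendsto_unique[of "at_right (0::real)" W] by fastforce
  also have "\<mu> * rGamma (\<mu> + 1) = rGamma \<mu>" by (rule rGamma_plus1)
  also have "rGamma \<mu> * rGamma (- \<mu> + 1) = sin (pi * \<mu>) / pi"
    using rGamma_reflection_complex[of \<mu>] by (simp add: add.commute)
  finally show ?thesis by (simp add: W_def u_def u1_def v_def v1_def mult.commute)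
qed

lemma besselI_scaled_asymptotics:
  fixes N \<nu> :: real
  assumes \<nu>: "\<nu> > 0"
  shows "((\<lambda>x::real. besselI (\<i> * N) (of_real \<nu> * of_real x) * of_real (sqrt (2 * pi * \<nu> * x) * exp (- (\<nu> * x)))) \<longlongrightarrow> 1) at_top"
proof -
  have "filterlim (\<lambda>x. \<nu> * x) at_top at_top" using \<nu> by real_asymp
  from filterlim_compose[OF besselI_real_asymptotics this, of N] show ?thesis
    by (simp add: mult_ac exp_of_real)
qed

text \<open>Both solutions have the same leading behaviour, which gives only v / u -> 1. The
  Wronskian supplies the derivative of v / u exactly, and integrating it back from infinity yields
  the decay of v - u. The second claim then fixes the logarithmic derivative, needed for dh/d\<xi>
  -> 0.\<close>

lemma besselK_real_asymptotics:
  fixes \<nu> :: real and \<mu> :: complex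
  assumes \<nu>: "\<nu> > 0" and \<mu>: "\<mu> = \<i> * of_real \<nu>"
  defines "w \<equiv> \<lambda>z. besselI (- \<mu>) (of_real \<nu> * z) - besselI \<mu> (of_real \<nu> * z)"
    and "w1 \<equiv> \<lambda>z. besselI' (- \<mu>) \<nu> z - besselI' \<mu> \<nu> z"
  shows "((\<lambda>x::real. w (of_real x) * of_real (sqrt (2 * pi * \<nu> * x) * exp (\<nu> * x))) \<longlongrightarrow> 2 * sin (\<mu> * of_real pi)) at_top"
    and "((\<lambda>x::real. w1 (of_real x) / w (of_real x)) \<longlongrightarrow> - of_real \<nu>) at_top"
proof -
  define u u1 v v1 where "u x = besselI \<mu> (of_real \<nu> * of_real x)" and "u1 x = besselI' \<mu> \<nu> (of_real x)"
    and "v x = besselI (- \<mu>) (of_real \<nu> * of_real x)" and "v1 x = besselI' (- \<mu>) \<nu> (of_real x)" for x :: real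
  define S where "S = sin (\<mu> * of_real pi)"
  define E where "E x = sqrt (2 * pi * \<nu> * x) * exp (- (\<nu> * x))" for x
  have S: "S \<noteq> 0"
  proof
    assume "S = 0"
    then obtain k :: int where "\<mu> * of_real pi = of_int k * of_real pi"
      unfolding S_def by (auto simp: sin_eq_0 complex_is_Int_iff mult.commute)
    then have "Re \<mu> = of_int k" "Im \<mu> = 0" by (auto simp: complex_eq_iff)
    then show False using \<nu> \<mu> by simp
  qed
  have uE: "((\<lambda>x. u x * of_real (E x)) \<longlongrightarrow> 1) at_top"
    using besselI_scaled_asymptotics[OF \<nu>, of \<nu>] by (simp add: u_def \<mu> E_def)
  have vE: "((\<lambda>x. v x * of_real (E x)) \<longlongrightarrow> 1) at_top"
    using besselI_scaled_asymptotics[OF \<nu>, of "- \<nu>"] by (simp add: v_def \<mu> E_def)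
  have m2: "\<mu>\<^sup>2 = - (of_real \<nu>)\<^sup>2" "(- \<mu>)\<^sup>2 = - (of_real \<nu>)\<^sup>2" by (simp_all add: \<mu> power_mult_distrib)
  have sys: "bessel_system \<nu> (\<lambda>z. besselI \<mu> (of_real \<nu> * z)) (besselI' \<mu> \<nu>)"
     "bessel_system \<nu> (\<lambda>z. besselI (- \<mu>) (of_real \<nu> * z)) (besselI' (- \<mu>) \<nu>)"
    by (intro bessel_system_besselI \<nu> m2 refl)+
  have du: "(u has_vector_derivative u1 x) (at x)" "(v has_vector_derivative v1 x) (at x)"
    "(u1 has_vector_derivative (of_real \<nu>)\<^sup>2 * (1 - 1 / (of_real x)\<^sup>2) * u x - u1 x / of_real x) (at x)" if "x > 0" for x
    using bessel_system_real[OF sys(1) that] bessel_system_real[OF sys(2) that]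
    by (simp_all add: u_def[abs_def] u1_def[abs_def] v_def[abs_def] v1_def[abs_def])
  have wr: "of_real x * (u x * v1 x - u1 x * v x) = - 2 * S / of_real pi" if "x > 0" for x
    using wronskian_besselI[OF \<nu> that \<mu>] by (simp add: u_def u1_def v_def v1_def S_def)
  have Epos: "E x > 0" if "x > 0" for x using that \<nu> by (simp add: E_def)
  have nz: "\<forall>\<^sub>F x in at_top. u x \<noteq> 0"
    using tendsto_imp_eventually_ne[OF uE, of 0] by (auto elim: eventually_mono)
  \<comment> \<open>Then w = u f, with f tending to 0 and f' given by the Wronskian over u^2, of
    size exp (- 2 \<nu> x).\<close>
  define f where "f x = v x / u x - 1" for x
  define f' where "f' x = - 2 * S / of_real pi / (of_real x * (u x)\<^sup>2)" for x
  have E2: "complex_of_real (exp (2 * \<nu> * x)) = of_real (2 * pi * \<nu> * x) / (of_real (E x))\<^sup>2" if "x > 0" for x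
  proof -
    have "(E x)\<^sup>2 = 2 * pi * \<nu> * x * exp (- (2 * \<nu> * x))"
      using that \<nu> by (simp add: E_def power_mult_distrib flip: exp_double)
    then have "exp (2 * \<nu> * x) = 2 * pi * \<nu> * x / (E x)\<^sup>2"
      using that \<nu> Epos[OF that] by (simp add: exp_minus field_simps)
    then show ?thesis by (simp only: of_real_divide of_real_power)
  qed
  have f0: "(f \<longlongrightarrow> 0) at_top"
  proof (rule Lim_transform_eventually)
    show "((\<lambda>x. (v x * of_real (E x)) / (u x * of_real (E x)) - 1) \<longlongrightarrow> 0) at_top"
      using tendsto_diff[OF tendsto_divide[OF vE uE] tendsto_const[of 1]] by simp
    show "\<forall>\<^sub>F x in at_top. (v x * of_real (E x)) / (u x * of_real (E x)) - 1 = f x"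
      using eventually_gt_at_top[of 0] by eventually_elim (use Epos in \<open>force simp: f_def\<close>)
  qed
  have df: "\<forall>\<^sub>F x in at_top. (f has_vector_derivative f' x) (at x)"
    using nz eventually_gt_at_top[of 0]
  proof eventually_elim
    case (elim x)
    have "((\<lambda>x. v x / u x) has_vector_derivative (v1 x * u x - v x * u1 x) / (u x)\<^sup>2) (at x)"
    proof -
      have "((inverse \<circ> u) has_vector_derivative u1 x * - (inverse (u x) ^ Suc (Suc 0))) (at x)"
        by (rule field_vector_diff_chain_at[OF du(1)[OF elim(2)] DERIV_inverse[OF elim(1)]])
      from has_vector_derivative_mult[OF du(2)[OF elim(2)] this]
      show ?thesis unfolding o_def divide_inverse[symmetric]
        by (rule has_vector_derivative_eq_rhs) (use elim(1) in \<open>simp add: field_simps power2_eq_square\<close>)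
    qed
    from has_vector_derivative_diff[OF this has_vector_derivative_const[of 1]]
    have "(f has_vector_derivative (v1 x * u x - v x * u1 x) / (u x)\<^sup>2) (at x)"
      by (simp add: f_def[abs_def])
    moreover have "(v1 x * u x - v x * u1 x) / (u x)\<^sup>2 = f' x"
      unfolding f'_def wr[OF elim(2), symmetric] using elim by (simp add: field_simps)
    ultimately show ?case by simp
  qed
  have f'lim: "((\<lambda>x. f' x * of_real (exp (2 * \<nu> * x))) \<longlongrightarrow> - 4 * S * of_real \<nu>) at_top"
  proof (rule Lim_transform_eventually)
    show "((\<lambda>x. - 4 * S * of_real \<nu> / (u x * of_real (E x))\<^sup>2) \<longlongrightarrow> - 4 * S * of_real \<nu>) at_top"
      using tendsto_divide[OF tendsto_const[of "- 4 * S * of_real \<nu>"] tendsto_power[OF uE, of 2]] by simp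
    show "\<forall>\<^sub>F x in at_top. - 4 * S * of_real \<nu> / (u x * of_real (E x))\<^sup>2 = f' x * of_real (exp (2 * \<nu> * x))"
      using eventually_gt_at_top[of 0] nz
    proof eventually_elim
      case (elim x)
      show ?case unfolding E2[OF elim(1)] f'_def using elim Epos[OF elim(1)]
        by (simp add: field_simps power2_eq_square)
    qed
  qed
  have flim: "((\<lambda>x. f x * of_real (exp (2 * \<nu> * x))) \<longlongrightarrow> 2 * S) at_top"
    using vanishing_at_top_asymptotics[OF _ f0 df f'lim] \<nu> by simp
  let ?f = "\<lambda>x::real. w (of_real x) * of_real (sqrt (2 * pi * \<nu> * x) * exp (\<nu> * x))"
  show "(?f \<longlongrightarrow> 2 * sin (\<mu> * of_real pi)) at_top"
  proof (rule Lim_transform_eventually)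
    show "((\<lambda>x. (u x * of_real (E x)) * (f x * of_real (exp (2 * \<nu> * x)))) \<longlongrightarrow> 2 * sin (\<mu> * of_real pi)) at_top"
      using tendsto_mult[OF uE flim] by (simp add: S_def)
    show "\<forall>\<^sub>F x in at_top. (u x * of_real (E x)) * (f x * of_real (exp (2 * \<nu> * x))) =
        ?f x"
      using nz
    proof eventually_elim
      case (elim x)
      have "E x * exp (2 * \<nu> * x) = sqrt (2 * pi * \<nu> * x) * exp (\<nu> * x)"
        by (simp add: E_def flip: exp_add)
      then have "of_real (E x) * of_real (exp (2 * \<nu> * x)) = complex_of_real (sqrt (2 * pi * \<nu> * x) * exp (\<nu> * x))"
        unfolding of_real_mult[symmetric] by (simp only:)
      moreover have "u x * f x = w (of_real x)" using elim by (simp add: f_def w_def u_def v_def field_simps)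
      ultimately show ?case by (metis mult.assoc mult.commute)
    qed
  qed
  \<comment> \<open>The growth of x u1 up to a constant.\<close>
  define G where "G x = sqrt x * exp (\<nu> * x)" for x
  have EG: "E x * G x = sqrt (2 * pi * \<nu>) * x" if "x > 0" for x
  proof -
    have "E x * G x = sqrt (2 * pi * \<nu>) * (sqrt x * sqrt x) * (exp (- (\<nu> * x)) * exp (\<nu> * x))"
      unfolding E_def G_def real_sqrt_mult by (simp only: mult_ac)
    also have "exp (- (\<nu> * x)) * exp (\<nu> * x) = 1" by (simp flip: exp_add)
    finally show ?thesis using that by simp
  qed
  \<comment> \<open>Asymptotics may not be differentiated termwise, but the equation gives x u1 the
    derivative \<nu>^2 (x - 1 / x) u, and the behaviour of u is known; l'Hospital's rule converts
    this into the behaviour of u1.\<close>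
  have y: "((\<lambda>x. of_real x * u1 x / of_real (G x)) \<longlongrightarrow> of_real (\<nu> / sqrt (2 * pi * \<nu>))) at_top"
  proof (rule lhopital_at_top_complex)
    show "filterlim G at_top at_top" unfolding G_def[abs_def] using \<nu> by real_asymp
    show "(G has_real_derivative G x * (\<nu> + 1 / (2 * x))) (at x)" if "x > 0" for x
      unfolding G_def[abs_def] using that
      by (auto intro!: derivative_eq_intros simp: field_simps)
    show "G x * (\<nu> + 1 / (2 * x)) \<noteq> 0" if "x > 0" for x
      using that \<nu> by (simp add: G_def) (metis add_pos_pos divide_pos_pos less_irrefl mult_pos_pos zero_less_numeral zero_less_one)
    show "((\<lambda>x. of_real x * u1 x) has_vector_derivative (of_real \<nu>)\<^sup>2 * of_real (x - 1 / x) * u x) (at x)" if "x > 0" for x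
    proof -
      have r: "((\<lambda>x. complex_of_real x) has_vector_derivative 1) (at x)"
        using has_vector_derivative_of_real[OF DERIV_ident, where 'a = complex] by simp
      show ?thesis
        by (rule has_vector_derivative_eq_rhs[OF has_vector_derivative_mult[OF r du(3)[OF that]]])
          (use that in \<open>simp add: field_simps power2_eq_square\<close>)
    qed
    show "((\<lambda>x. (of_real \<nu>)\<^sup>2 * of_real (x - 1 / x) * u x / of_real (G x * (\<nu> + 1 / (2 * x)))) \<longlongrightarrow>
        of_real (\<nu> / sqrt (2 * pi * \<nu>))) at_top"
    proof (rule Lim_transform_eventually)
      let ?f = "\<lambda>x. \<nu>\<^sup>2 * (1 - 1 / x\<^sup>2) / (sqrt (2 * pi * \<nu>) * (\<nu> + 1 / (2 * x)))"
      have "((\<lambda>x. 1 - 1 / x\<^sup>2) \<longlongrightarrow> (1 :: real)) at_top" "((\<lambda>x. \<nu> + 1 / (2 * x)) \<longlongrightarrow> \<nu>) at_top"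
        by real_asymp+
      then have "(?f \<longlongrightarrow> \<nu>\<^sup>2 * 1 / (sqrt (2 * pi * \<nu>) * \<nu>)) at_top"
        using \<nu> by (intro tendsto_intros) auto
      then have "(?f \<longlongrightarrow> \<nu> / sqrt (2 * pi * \<nu>)) at_top"
        using \<nu> by (simp add: power2_eq_square)
      from tendsto_mult[OF tendsto_of_real[OF this, where 'a = complex] uE]
      show "((\<lambda>x. of_real (?f x) * (u x * of_real (E x))) \<longlongrightarrow>
        of_real (\<nu> / sqrt (2 * pi * \<nu>))) at_top" by simp
      show "\<forall>\<^sub>F x in at_top. of_real (?f x) * (u x * of_real (E x)) =
        (of_real \<nu>)\<^sup>2 * of_real (x - 1 / x) * u x / of_real (G x * (\<nu> + 1 / (2 * x)))"
        using eventually_gt_at_top[of 0]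
      proof eventually_elim
        case (elim x)
        have M: "\<nu> + 1 / (2 * x) > 0" using elim \<nu> by (simp add: add_pos_pos)
        have G: "G x > 0" using elim by (simp add: G_def)
        have Ex: "E x = sqrt (2 * pi * \<nu>) * x / G x" using EG[OF elim] G by (simp add: field_simps)
        have "?f x * E x =
            \<nu>\<^sup>2 * (x - 1 / x) / (G x * (\<nu> + 1 / (2 * x)))"
        proof -
          have "n * (1 - 1 / x\<^sup>2) / (c * M) * (c * x / g) = n * (x - 1 / x) / (g * M)"
            if "c \<noteq> 0" "M \<noteq> 0" "g \<noteq> 0" for n c M g :: real
            using that elim by (simp add: field_simps power2_eq_square)
          moreover have "sqrt (2 * pi * \<nu>) \<noteq> 0" using \<nu> by simp
          ultimately show ?thesis
            using M G Ex by (metis less_irrefl)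
        qed
        then have eq: "complex_of_real (?f x) * of_real (E x) =
            of_real (\<nu>\<^sup>2 * (x - 1 / x) / (G x * (\<nu> + 1 / (2 * x))))" unfolding of_real_mult[symmetric] by (simp only:)
        have "of_real (?f x) * (u x * of_real (E x)) =
            (of_real (?f x) * of_real (E x)) * u x"
          by (simp only: mult_ac)
        also note eq
        also have "of_real (\<nu>\<^sup>2 * (x - 1 / x) / (G x * (\<nu> + 1 / (2 * x)))) * u x =
            (of_real \<nu>)\<^sup>2 * of_real (x - 1 / x) * u x / of_real (G x * (\<nu> + 1 / (2 * x)))"
          by (simp only: of_real_divide of_real_mult of_real_power times_divide_eq_left)
        finally show ?case .
      qed
    qed
  qed
  have u1u: "((\<lambda>x. u1 x / u x) \<longlongrightarrow> of_real \<nu>) at_top"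
  proof (rule Lim_transform_eventually)
    let ?f = "\<lambda>x. (of_real x * u1 x / of_real (G x)) * (of_real (sqrt (2 * pi * \<nu>)) / (u x * of_real (E x)))"
    show "(?f \<longlongrightarrow> of_real \<nu>) at_top"
      using tendsto_mult[OF y tendsto_divide[OF tendsto_const[of "of_real (sqrt (2 * pi * \<nu>))"] uE]] \<nu> by simp
    show "\<forall>\<^sub>F x in at_top. ?f x = u1 x / u x"
      using eventually_gt_at_top[of 0] nz
    proof eventually_elim
      case (elim x)
      have "E x > 0" "G x > 0" using Epos elim by (auto simp: G_def)
      moreover have "complex_of_real (E x) * of_real (G x) = of_real (sqrt (2 * pi * \<nu>)) * of_real x"
        using EG[OF elim(1)] unfolding of_real_mult[symmetric] by (simp only:)
      moreover have "X * a / g * (c / (b * e)) = a / b" if "e \<noteq> 0" "g \<noteq> 0" "b \<noteq> 0" "e * g = c * X" for a b c e g X :: complex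
      proof -
        have "X * a / g * (c / (b * e)) = a * (c * X) / (b * (e * g))" by (simp add: mult_ac)
        also have "\<dots> = a * (e * g) / (b * (e * g))" by (simp only: that(4))
        also have "\<dots> = a / b"
          by (rule nonzero_mult_divide_mult_cancel_right) (use that(1,2) in simp)
        finally show ?thesis .
      qed
      ultimately show ?case using elim by (metis less_irrefl of_real_eq_0_iff)
    qed
  qed
  show "((\<lambda>x::real. w1 (of_real x) / w (of_real x)) \<longlongrightarrow> - of_real \<nu>) at_top"
  proof (rule Lim_transform_eventually)
    \<comment> \<open>Logarithmic derivative of u f: its limit is \<nu> + (- 4 S \<nu>) / (2 S) = -
      \<nu>.\<close>
    let ?f = "\<lambda>x. u1 x / u x + (f' x * of_real (exp (2 * \<nu> * x))) / (f x * of_real (exp (2 * \<nu> * x)))"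
    have "(?f \<longlongrightarrow>
        of_real \<nu> + (- 4 * S * of_real \<nu>) / (2 * S)) at_top"
      using S by (intro tendsto_intros u1u f'lim flim) auto
    then show "(?f \<longlongrightarrow> - of_real \<nu>) at_top"
      using S by simp
    have "\<forall>\<^sub>F x in at_top. f x * of_real (exp (2 * \<nu> * x)) \<noteq> 0"
      using tendsto_imp_eventually_ne[OF flim, of 0] S by simp
    then show "\<forall>\<^sub>F x in at_top. ?f x =
        w1 (of_real x) / w (of_real x)"
      using eventually_gt_at_top[of 0] nz
    proof eventually_elim
      case (elim x)
      have "f x \<noteq> 0" using elim by auto
      have "w (of_real x) = u x * f x" using elim by (simp add: f_def w_def u_def v_def field_simps)
      moreover have "w1 (of_real x) = u x * f' x + u1 x * f x"
      proof -
        have "u x * f' x + u1 x * f x = (v1 x * u x - v x * u1 x) / u x + u1 x * (v x / u x - 1)"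
          unfolding f'_def f_def wr[OF elim(2), symmetric] using elim(2,3) by (simp add: field_simps power2_eq_square)
        also have "\<dots> = v1 x - u1 x" using elim(3) by (simp add: field_simps)
        finally show ?thesis by (simp add: w1_def u1_def v1_def)
      qed
      ultimately show ?case using elim(3) \<open>f x \<noteq> 0\<close> by (simp add: field_simps)
    qed
  qed
qed

section \<open>Behaviour at infinity\<close>

lemma sqrt_z2m1_of_real:
  assumes "x > 1"
  shows "sqrt_z2m1 (of_real x) = of_real (sqrt (x\<^sup>2 - 1))"
    and "sqrt_z2m1 (- of_real x) = - of_real (sqrt (x\<^sup>2 - 1))"
proof -
  have s: "sqrt (x - 1) * sqrt (x + 1) = sqrt (x\<^sup>2 - 1)"
    by (simp add: power2_eq_square algebra_simps flip: real_sqrt_mult)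
  have "csqrt (of_real x - 1) = of_real (sqrt (x - 1))" "csqrt (of_real x + 1) = of_real (sqrt (x + 1))"
    using assms csqrt_of_real_nonneg[of "x - 1"] csqrt_of_real_nonneg[of "x + 1"] by auto
  then show "sqrt_z2m1 (of_real x) = of_real (sqrt (x\<^sup>2 - 1))"
    unfolding sqrt_z2m1_def s[symmetric] of_real_mult by (simp only:)
  have "csqrt (- of_real x - 1) = \<i> * of_real (sqrt (x + 1))" "csqrt (- of_real x + 1) = \<i> * of_real (sqrt (x - 1))"
    using assms csqrt_of_real_nonpos[of "- x - 1"] csqrt_of_real_nonpos[of "- x + 1"] by (auto simp: add.commute)
  then have "sqrt_z2m1 (- of_real x) = - (of_real (sqrt (x - 1)) * of_real (sqrt (x + 1)))"
    unfolding sqrt_z2m1_def by (simp add: mult_ac)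
  then show "sqrt_z2m1 (- of_real x) = - of_real (sqrt (x\<^sup>2 - 1))"
    unfolding s[symmetric] of_real_mult .
qed

text \<open>On the negative axis each quarter power contributes exp (\<i> \<pi> / 4). Their product
  is the factor \<i> in the expansion of I of order - \<i> \<nu>.\<close>

lemma root4_z2m1_of_real:
  assumes "x > 1"
  shows "root4_z2m1 (of_real x) = of_real (sqrt (sqrt (x\<^sup>2 - 1)))"
    and "root4_z2m1 (- of_real x) = \<i> * of_real (sqrt (sqrt (x\<^sup>2 - 1)))"
proof -
  have q: "of_real y powr (1 / 4) = complex_of_real (sqrt (sqrt y))" if "y > 0" for y
  proof -
    have "of_real y powr (1 / 4) = complex_of_real (y powr (1 / 4))"
      using powr_of_real[of y "1 / 4"] that by simp
    also have "y powr (1 / 4) = sqrt (sqrt y)"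
      using that by (simp add: powr_half_sqrt[symmetric] powr_powr)
    finally show ?thesis .
  qed
  have s: "sqrt (sqrt (x - 1)) * sqrt (sqrt (x + 1)) = sqrt (sqrt (x\<^sup>2 - 1))"
    by (simp add: power2_eq_square algebra_simps flip: real_sqrt_mult)
  have "root4_z2m1 (of_real x) = of_real (x - 1) powr (1 / 4) * of_real (x + 1) powr (1 / 4)"
    by (simp add: root4_z2m1_def)
  also have "\<dots> = of_real (sqrt (sqrt (x - 1)) * sqrt (sqrt (x + 1)))"
    using assms unfolding of_real_mult by (subst (1 2) q) auto
  finally show "root4_z2m1 (of_real x) = of_real (sqrt (sqrt (x\<^sup>2 - 1)))" unfolding s .
  have neg: "(- of_real y) powr (1 / 4) = exp (\<i> * pi / 4) * complex_of_real (sqrt (sqrt y))" if "y > 0" for y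
  proof -
    have "Ln (- complex_of_real y) = Ln (of_real y) + \<i> * pi"
      using that Ln_minus[of "of_real y"] by simp
    then have "(- of_real y) powr (1 / 4) = exp (\<i> * pi / 4) * of_real y powr (1 / 4)"
      using that by (simp add: powr_def algebra_simps exp_add add_divide_distrib)
    then show ?thesis using q[OF that] by simp
  qed
  have "- complex_of_real x - 1 = - of_real (x + 1)" "- complex_of_real x + 1 = - of_real (x - 1)" by auto
  then have "root4_z2m1 (- of_real x) = (- of_real (x + 1)) powr (1 / 4) * (- of_real (x - 1)) powr (1 / 4)"
    unfolding root4_z2m1_def by (simp only:)
  also have "\<dots> = (exp (\<i> * pi / 4) * exp (\<i> * pi / 4)) * (complex_of_real (sqrt (sqrt (x - 1))) * of_real (sqrt (sqrt (x + 1))))"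
    using assms by (subst (1 2) neg) (auto simp: mult_ac)
  also have "exp (\<i> * pi / 4) * exp (\<i> * pi / 4) = \<i>"
    using exp_pi_i by (simp flip: exp_add exp_double) (metis cis_conv_exp cis_pi_half of_real_divide of_real_numeral times_divide_eq_right)
  finally show "root4_z2m1 (- of_real x) = \<i> * of_real (sqrt (sqrt (x\<^sup>2 - 1)))"
    unfolding of_real_mult[symmetric] s .
qed

text \<open>The constant - \<pi> / 2 is minus the limit of \<open>arcsec\<close>, from Ln \<i>; it
  is the reason for \<pi> \<nu> / 2 in the exponents.\<close>

lemma xi_real_at_infinity:
  shows "((\<lambda>x. xi (of_real x) - of_real x) \<longlongrightarrow> - of_real pi / 2) at_top"
    and "((\<lambda>x. xi (- of_real x) + of_real x) \<longlongrightarrow> - of_real pi / 2) at_top"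
proof -
  define r where "r x = sqrt (x\<^sup>2 - 1)" for x :: real
  have lims: "((\<lambda>x. r x - x) \<longlongrightarrow> 0) at_top" "((\<lambda>x. x - r x) \<longlongrightarrow> 0) at_top" "((\<lambda>x. r x / x) \<longlongrightarrow> 1) at_top"
    "((\<lambda>x. 1 / x) \<longlongrightarrow> (0::real)) at_top"
    unfolding r_def by real_asymp+
  note c = lims[THEN tendsto_of_real[where 'a = complex]]
  have i: "\<i> \<notin> \<real>\<^sub>\<le>\<^sub>0" by (simp add: complex_nonpos_Reals_iff)
  let ?f = "\<lambda>x. of_real (r x - x) + \<i> * Ln (of_real (1 / x) + \<i> * of_real (r x / x))"
  have "(?f \<longlongrightarrow> of_real 0 + \<i> * Ln (of_real 0 + \<i> * of_real 1)) at_top"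
    by (intro tendsto_intros c) (use i in auto)
  then have a: "(?f \<longlongrightarrow> - of_real pi / 2) at_top"
    by simp
  show "((\<lambda>x. xi (of_real x) - of_real x) \<longlongrightarrow> - of_real pi / 2) at_top"
  proof (rule Lim_transform_eventually[OF a])
    show "\<forall>\<^sub>F x in at_top. ?f x = xi (of_real x) - of_real x"
      using eventually_gt_at_top[of 1]
      by eventually_elim (simp add: xi_def arcsec_def sqrt_z2m1_of_real r_def add_divide_distrib)
  qed
  let ?f = "\<lambda>x. of_real (x - r x) + \<i> * Ln (- of_real (1 / x) + \<i> * of_real (r x / x))"
  have "(?f \<longlongrightarrow> of_real 0 + \<i> * Ln (- of_real 0 + \<i> * of_real 1)) at_top"
    by (intro tendsto_intros c) (use i in auto)
  then have b: "(?f \<longlongrightarrow> - of_real pi / 2) at_top"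
    by simp
  show "((\<lambda>x. xi (- of_real x) + of_real x) \<longlongrightarrow> - of_real pi / 2) at_top"
  proof (rule Lim_transform_eventually[OF b])
    show "\<forall>\<^sub>F x in at_top. ?f x = xi (- of_real x) + of_real x"
      using eventually_gt_at_top[of 1]
    proof eventually_elim
      case (elim x)
      have "(1 + \<i> * sqrt_z2m1 (- of_real x)) / (- of_real x) = - of_real (1 / x) + \<i> * of_real (r x / x)"
        using elim by (simp add: sqrt_z2m1_of_real r_def field_simps)
      then show ?case using elim by (simp add: xi_def arcsec_def sqrt_z2m1_of_real(2) r_def)
    qed
  qed
qed

lemma beta_at_infinity: "(beta \<longlongrightarrow> 0) at_infinity"
proof -
  have "filterlim (\<lambda>z::complex. z ^ 2 + - 1) at_infinity at_infinity"
    by (intro tendsto_add_filterlim_at_infinity'[OF _ tendsto_const] filterlim_power_at_infinity filterlim_ident) auto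
  then have "filterlim (\<lambda>z::complex. cmod (z ^ 2 + - 1)) at_top at_infinity"
    by (simp only: filterlim_at_infinity_conv_norm_at_top)
  from filterlim_compose[OF sqrt_at_top this]
  have "filterlim (\<lambda>z. sqrt (cmod (z ^ 2 + - 1))) at_top at_infinity" .
  moreover have "sqrt (cmod (z ^ 2 + - 1)) = cmod (sqrt_z2m1 z)" for z
  proof -
    have "cmod (z ^ 2 + - 1) = (cmod (sqrt_z2m1 z))\<^sup>2"
      by (simp add: sqrt_z2m1_power2 flip: norm_power)
    then show ?thesis by simp
  qed
  ultimately have "filterlim sqrt_z2m1 at_infinity at_infinity"
    by (simp only: filterlim_at_infinity_conv_norm_at_top)
  then have "((\<lambda>z. inverse (sqrt_z2m1 z)) \<longlongrightarrow> 0) at_infinity"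
    by (rule filterlim_compose[OF tendsto_inverse_0])
  then show ?thesis unfolding beta_def[abs_def] inverse_eq_divide .
qed

lemma LG_at_infinity:
  assumes "filterlim f at_infinity F"
  shows "((\<lambda>x. beta (f x)) \<longlongrightarrow> 0) F" "((\<lambda>x. LG_E s (beta (f x))) \<longlongrightarrow> 0) F"
    "((\<lambda>x. LG_G s (beta (f x))) \<longlongrightarrow> 0) F" "((\<lambda>x. LG_T n N (f x)) \<longlongrightarrow> 0) F"
proof -
  show b: "((\<lambda>x. beta (f x)) \<longlongrightarrow> 0) F" by (rule filterlim_compose[OF beta_at_infinity assms])
  show "((\<lambda>x. LG_E s (beta (f x))) \<longlongrightarrow> 0) F"
    using isCont_tendsto_compose[OF DERIV_isCont[OF LG_E_has_deriv] b, of s] by simp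
  show G: "((\<lambda>x. LG_G s (beta (f x))) \<longlongrightarrow> 0) F" for s
    using isCont_tendsto_compose[OF DERIV_isCont[OF LG_G_has_deriv] b, of s] by (simp add: LG_G_def[of _ 0])
  have "((\<lambda>x. LG_T n N (f x)) \<longlongrightarrow> (\<Sum>s = 1..n - 1. 0 / N ^ s)) F"
    unfolding LG_T_def divide_inverse by (intro tendsto_intros G)
  then show "((\<lambda>x. LG_T n N (f x)) \<longlongrightarrow> 0) F" by simp
qed

text \<open>The positive end normalises K and I of order \<i> \<nu>, the negative end I of order -
  \<i> \<nu>.\<close>

lemma LG_V_real_at_infinity:
  fixes N :: real
  assumes N: "N \<noteq> 0"
  shows "((\<lambda>x::real. LG_V n N (of_real x) * of_real (exp (N * x) / sqrt x)) \<longlongrightarrow> of_real (exp (N * pi / 2))) at_top"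
    and "((\<lambda>x::real. LG_V n N (- of_real x) * of_real (exp (- N * x) / sqrt x)) \<longlongrightarrow> \<i> * of_real (exp (N * pi / 2))) at_top"
proof -
  have root: "((\<lambda>x::real. sqrt (sqrt (x\<^sup>2 - 1)) / sqrt x) \<longlongrightarrow> 1) at_top" by real_asymp
  note root' = tendsto_of_real[OF root, where 'a = complex]
  have inf: "filterlim (\<lambda>x::real. complex_of_real x) at_infinity at_top"
    "filterlim (\<lambda>x::real. - complex_of_real x) at_infinity at_top"
    unfolding filterlim_at_infinity_conv_norm_at_top by (simp_all add: filterlim_abs_real)
  have S: "((\<lambda>x::real. \<Sum>s = 1..n - 1. LG_E s (beta (of_real x)) / of_real N ^ s) \<longlongrightarrow> (\<Sum>s = 1..n - 1. 0 / complex_of_real N ^ s)) at_top"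
    "((\<lambda>x::real. \<Sum>s = 1..n - 1. LG_E s (beta (- of_real x)) / of_real N ^ s) \<longlongrightarrow> (\<Sum>s = 1..n - 1. 0 / complex_of_real N ^ s)) at_top"
    unfolding divide_inverse by (intro tendsto_intros LG_at_infinity(2)[OF inf(1)] LG_at_infinity(2)[OF inf(2)])+
  have e: "- (of_real N * (- complex_of_real pi / 2)) - (\<Sum>s = 1..n - 1. 0 / complex_of_real N ^ s) = of_real (N * pi / 2)"
    by simp
  let ?f = "\<lambda>x. of_real (sqrt (sqrt (x\<^sup>2 - 1)) / sqrt x) * exp (- (N * (xi (of_real x) - of_real x)) - (\<Sum>s = 1..n - 1. LG_E s (beta (of_real x)) / of_real N ^ s))"
  have "(?f \<longlongrightarrow>
      of_real 1 * exp (- (of_real N * (- complex_of_real pi / 2)) - (\<Sum>s = 1..n - 1. 0 / complex_of_real N ^ s))) at_top"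
    by (intro tendsto_intros root' xi_real_at_infinity S)
  then have a: "(?f \<longlongrightarrow>
      of_real (exp (N * pi / 2))) at_top"
    unfolding e exp_of_real by simp
  show "((\<lambda>x::real. LG_V n N (of_real x) * of_real (exp (N * x) / sqrt x)) \<longlongrightarrow> of_real (exp (N * pi / 2))) at_top"
  proof (rule Lim_transform_eventually[OF a])
    show "\<forall>\<^sub>F x in at_top. ?f x =
      LG_V n N (of_real x) * of_real (exp (N * x) / sqrt x)"
      using eventually_gt_at_top[of 1]
    proof eventually_elim
      case (elim x)
      have "exp (- (N * (xi (of_real x) - of_real x)) - S) = exp (- (N * xi (of_real x)) - S) * of_real (exp (N * x))" for S
        unfolding exp_of_real[symmetric] exp_add[symmetric] by (simp add: algebra_simps)
      then show ?case using elim by (simp add: LG_V_def root4_z2m1_of_real)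
    qed
  qed
  let ?f = "\<lambda>x. \<i> * of_real (sqrt (sqrt (x\<^sup>2 - 1)) / sqrt x) * exp (- (N * (xi (- of_real x) + of_real x)) - (\<Sum>s = 1..n - 1. LG_E s (beta (- of_real x)) / of_real N ^ s))"
  have "(?f \<longlongrightarrow>
      \<i> * of_real 1 * exp (- (of_real N * (- complex_of_real pi / 2)) - (\<Sum>s = 1..n - 1. 0 / complex_of_real N ^ s))) at_top"
    by (intro tendsto_intros root' xi_real_at_infinity S)
  then have b: "(?f \<longlongrightarrow>
      \<i> * of_real (exp (N * pi / 2))) at_top"
    unfolding e exp_of_real by simp
  show "((\<lambda>x::real. LG_V n N (- of_real x) * of_real (exp (- N * x) / sqrt x)) \<longlongrightarrow> \<i> * of_real (exp (N * pi / 2))) at_top"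
  proof (rule Lim_transform_eventually[OF b])
    show "\<forall>\<^sub>F x in at_top. ?f x =
      LG_V n N (- of_real x) * of_real (exp (- N * x) / sqrt x)"
      using eventually_gt_at_top[of 1]
    proof eventually_elim
      case (elim x)
      have "exp (- (N * (xi (- of_real x) + of_real x)) - S) = exp (- (N * xi (- of_real x)) - S) * of_real (exp (- N * x))" for S
        unfolding exp_of_real[symmetric] exp_add[symmetric] by (simp add: algebra_simps)
      then show ?case using elim by (simp add: LG_V_def root4_z2m1_of_real)
    qed
  qed
qed

section \<open>From the real axis to a sector at infinity\<close>

lemma LG_u_tendsto:
  assumes "((\<lambda>x. w (f x) * LG_V n N (f x)) \<longlongrightarrow> 1) F" "((\<lambda>x. LG_p n N w w1 (f x)) \<longlongrightarrow> 0) F"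
  shows "((\<lambda>x. LG_u n N w w1 (f x)) \<longlongrightarrow> 0) F"
proof -
  have "((\<lambda>x. LG_u n N w w1 (f x)) \<longlongrightarrow> cmod (1 - 1 + 0 * inverse (2 * N)) + cmod (0 * inverse (2 * N))) F"
    unfolding LG_u_def divide_inverse by (intro tendsto_intros assms)
  then show ?thesis by simp
qed

text \<open>The square of q = d\<xi>/dz is 1 - 1 / z^2 and has nonnegative real part, so |Im q|
  \<le> |Re q|. Consequently Re (q (- 1 + \<i>)) \<le> 0: moving in the direction - 1 + \<i> does
  not increase Re \<xi>.\<close>

lemma sqrt_z2m1_over_z_sector:
  assumes "z \<in> upper" "Re z \<ge> 2"
  shows "\<bar>Im (sqrt_z2m1 z / z)\<bar> \<le> Re (sqrt_z2m1 z / z)"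
proof -
  define r q where "r = sqrt_z2m1 z" and "q = r / z"
  have z: "z \<noteq> 0" "cmod z \<ge> 2" using assms complex_Re_le_cmod[of z] by auto
  have r: "Im r \<ge> 0" using sqrt_z2m1_in_upper(1)[OF assms(1)] by (simp add: r_def upper_def)
  have "Im (r\<^sup>2) = Im (z\<^sup>2)" by (simp add: r_def sqrt_z2m1_power2)
  then have ri: "Re r * Im r = Re z * Im z" by (simp add: Im_power2)
  have "Re r \<ge> 0"
  proof (cases "Im r = 0")
    case True
    with ri assms(2) have "Im z = 0" by simp
    then have "z = of_real (Re z)" by (simp add: complex_eq_iff)
    with sqrt_z2m1_of_real(1)[of "Re z"] assms(2) have "r = of_real (sqrt ((Re z)\<^sup>2 - 1))"
      by (metis r_def less_le_trans one_less_numeral_iff semiring_norm(76))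
    moreover have "(Re z)\<^sup>2 \<ge> 1" using assms(2) by (simp add: power2_eq_square) (metis (full_types) dual_order.trans mult_mono' one_le_numeral mult_1 zero_le_one)
    ultimately show ?thesis by simp
  next
    case False
    have "Re r * Im r \<ge> 0" using ri assms by (simp add: upper_def)
    then show ?thesis using False r by (simp add: zero_le_mult_iff)
  qed
  then have "Re r * Re z + Im r * Im z \<ge> 0" using r assms by (simp add: upper_def)
  then have q0: "Re q \<ge> 0" by (simp add: q_def Re_divide)
  have "q\<^sup>2 = 1 - 1 / z\<^sup>2" using z by (simp add: q_def r_def power_divide sqrt_z2m1_power2 diff_divide_distrib)
  then have "Re (q\<^sup>2) = 1 - Re (1 / z\<^sup>2)" by simp
  moreover have "cmod (1 / z\<^sup>2) \<le> 1" using z one_le_power[of "cmod z" 2] by (simp add: norm_divide norm_power)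
  ultimately have "Re (q\<^sup>2) \<ge> 0" using complex_Re_le_cmod[of "1 / z\<^sup>2"] by linarith
  then have "(Im q)\<^sup>2 \<le> (Re q)\<^sup>2" by (simp add: Re_power2)
  then have "\<bar>Im q\<bar> \<le> Re q" using q0 by (metis abs_le_square_iff abs_of_nonneg)
  then show ?thesis by (simp add: q_def r_def)
qed

text \<open>F_s contains \<beta>^2, and one factor \<beta> cancels the square root. The densities
  are thus small compared with 1 / |z|, and a segment whose length is comparable to |z| contributes
  little.\<close>

lemma densities_at_infinity:
  fixes \<nu> :: real
  shows "((\<lambda>z. cmod z * phi_density n \<nu> z 1) \<longlongrightarrow> 0) at_infinity"
    and "((\<lambda>z. cmod z * psi_density n \<nu> z 1) \<longlongrightarrow> 0) at_infinity"
proof -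
  have ev: "\<forall>\<^sub>F z::complex in at_infinity. cmod z \<ge> 2" by (auto simp: eventually_at_infinity)
  have nz: "z \<noteq> 0" "z \<noteq> 1" "z \<noteq> -1" if "cmod z \<ge> 2" for z using that by auto
  have F: "((\<lambda>z. LG_F s z) \<longlongrightarrow> 0) at_infinity" for s
    by (rule Lim_transform_eventually[OF LG_at_infinity(3)[OF filterlim_ident]])
      (use ev in eventually_elim, use LG_F_eq nz in auto)
  have qF: "((\<lambda>z. cmod z * cmod (1 / z * sqrt_z2m1 z * LG_F s z)) \<longlongrightarrow> 0) at_infinity" for s
  proof (rule Lim_transform_eventually)
    let ?f = "\<lambda>z. cmod (beta z * ((beta z)\<^sup>2 + 1) * deriv (LG_E s) (beta z))"
    have "isCont (deriv (LG_E s)) 0" by (rule DERIV_isCont[OF deriv_LG_E_has_deriv])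
    then have "((\<lambda>z. deriv (LG_E s) (beta z)) \<longlongrightarrow> deriv (LG_E s) 0) at_infinity"
      by (rule isCont_tendsto_compose[OF _ beta_at_infinity])
    then have "(?f \<longlongrightarrow> cmod (0 * (0\<^sup>2 + 1) * deriv (LG_E s) 0)) at_infinity"
      by (intro tendsto_intros beta_at_infinity)
    then show "(?f \<longlongrightarrow> 0) at_infinity" by simp
    show "\<forall>\<^sub>F z in at_infinity. ?f z = cmod z * cmod (1 / z * sqrt_z2m1 z * LG_F s z)"
      using ev
    proof eventually_elim
      case (elim z)
      have "sqrt_z2m1 z * beta z = 1" using nz[OF elim] by (simp add: beta_def)
      then have "sqrt_z2m1 z * ((beta z)\<^sup>2 * X) = beta z * X" for X by (simp add: power2_eq_square)
      then have "sqrt_z2m1 z * LG_F s z = - (beta z * ((beta z)\<^sup>2 + 1) * deriv (LG_E s) (beta z))"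
        using nz[OF elim] by (simp add: LG_F_eq LG_G_def mult.assoc)
      moreover have "cmod z * cmod (1 / z * sqrt_z2m1 z * LG_F s z) = cmod (sqrt_z2m1 z * LG_F s z)"
        using nz[OF elim] by (simp add: norm_mult norm_divide)
      ultimately show ?case by simp
    qed
  qed
  let ?f = "\<lambda>z. inverse (\<nu> ^ n) * (2 * (cmod z * cmod (1 / z * sqrt_z2m1 z * LG_F n z)) +
      (\<Sum>s = 1..n - 1. inverse (\<nu> ^ s) * (\<Sum>k = s..n - 1.
        (cmod z * cmod (1 / z * sqrt_z2m1 z * LG_F k z)) * cmod (LG_F (s + n - k - 1) z))))"
  have "(?f \<longlongrightarrow>
     inverse (\<nu> ^ n) * (2 * 0 + (\<Sum>s = 1..n - 1. inverse (\<nu> ^ s) * (\<Sum>k = s..n - 1. 0 * cmod 0)))) at_infinity"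
    by (intro tendsto_intros qF F)
  then show "((\<lambda>z. cmod z * phi_density n \<nu> z 1) \<longlongrightarrow> 0) at_infinity"
  proof (rule Lim_transform_eventually[OF tendsto_eq_rhs])
    have e: "cmod (1 / z * sqrt_z2m1 z * LG_F k z * LG_F l z * 1) = cmod (1 / z * sqrt_z2m1 z * LG_F k z) * cmod (LG_F l z)"
      "cmod (1 / z * sqrt_z2m1 z * LG_F k z * 1) = cmod (1 / z * sqrt_z2m1 z * LG_F k z)" for k l z
      by (simp_all only: norm_mult mult_1_right)
    show "\<forall>\<^sub>F z in at_infinity. ?f z = cmod z * phi_density n \<nu> z 1"
      unfolding phi_density_def e inverse_eq_divide
      by (intro always_eventually allI) (simp only: sum_distrib_left distrib_left mult_ac)
  qed simp
  let ?f = "\<lambda>z. inverse \<nu> * (4 * (\<Sum>s = 0..n - 2. inverse (\<nu> ^ s) *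
        (cmod z * cmod (1 / z * sqrt_z2m1 z * LG_F (s + 1) z))))"
  have "(?f \<longlongrightarrow>
     inverse \<nu> * (4 * (\<Sum>s = 0..n - 2. inverse (\<nu> ^ s) * 0))) at_infinity"
    by (intro tendsto_intros qF)
  then show "((\<lambda>z. cmod z * psi_density n \<nu> z 1) \<longlongrightarrow> 0) at_infinity"
  proof (rule Lim_transform_eventually[OF tendsto_eq_rhs])
    show "\<forall>\<^sub>F z in at_infinity. ?f z = cmod z * psi_density n \<nu> z 1"
      unfolding psi_density_def mult_1_right inverse_eq_divide
      by (intro always_eventually allI) (simp only: sum_distrib_left mult_ac)
  qed simp
qed

lemma density_scale:
  "phi_density n \<nu> z v = cmod v * phi_density n \<nu> z 1" "psi_density n \<nu> z v = cmod v * psi_density n \<nu> z 1"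
  unfolding phi_density_def psi_density_def norm_mult[of _ v] mult_1_right
  by (simp_all only: sum_distrib_left distrib_left mult_ac)

text \<open>From a point \<open>X\<close> of the real axis the bound is propagated along a segment of direction
  \<open>- 1 + \<i>\<close>, along which \<open>Re \<xi>\<close> decreases.\<close>

lemma LG_u_sector:
  fixes N :: real
  assumes n: "n \<ge> 2" and N: "N < 0" and w: "bessel_system N w w1"
    and real: "((\<lambda>x::real. LG_u n N w w1 (of_real x)) \<longlongrightarrow> 0) at_top" and \<epsilon>: "\<epsilon> > 0"
  obtains R where "\<And>z. z \<in> upper \<Longrightarrow> Re z \<ge> R \<Longrightarrow> Im z \<le> Re z \<Longrightarrow> LG_u n N w w1 z < \<epsilon>"
proof -
  \<comment> \<open>4 \<delta> \<le> 1 keeps the exponential below 3, and the final bound 9 \<delta>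
    is below \<epsilon> because \<delta> \<le> \<epsilon> / 12.\<close>
  define \<delta> where "\<delta> = min (1 / 4) (\<epsilon> / 12)"
  have \<delta>: "\<delta> > 0" "\<delta> \<le> 1 / 4" "\<delta> \<le> \<epsilon> / 12" using \<epsilon> by (auto simp: \<delta>_def)
  obtain R1 where R1: "\<And>x. x \<ge> R1 \<Longrightarrow> LG_u n N w w1 (of_real x) < \<delta>"
    using order_tendstoD(2)[OF real \<delta>(1)] by (auto simp: eventually_at_top_linorder)
  obtain R2 where R2: "\<And>z. cmod z \<ge> R2 \<Longrightarrow> cmod z * phi_density n \<bar>N\<bar> z 1 < \<delta> \<and> cmod z * psi_density n \<bar>N\<bar> z 1 < \<delta>"
    using eventually_conj[OF order_tendstoD(2)[OF densities_at_infinity(1)[of n "\<bar>N\<bar>"] \<delta>(1)]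
        order_tendstoD(2)[OF densities_at_infinity(2)[of n "\<bar>N\<bar>"] \<delta>(1)]]
    unfolding eventually_at_infinity by blast
  define R where "R = max 2 (max R1 R2)"
  show ?thesis
  proof (rule that[of R])
    fix z assume z: "z \<in> upper" "Re z \<ge> R" "Im z \<le> Re z"
    \<comment> \<open>X is where the line through z in the direction 1 - \<i> meets the real
      axis.\<close>
    define a y X where "a = Re z" and "y = Im z" and "X = Re z + Im z"
    have a: "a \<ge> 2" "a \<ge> R1" "a \<ge> R2" "0 \<le> y" "y \<le> a" using z by (auto simp: R_def a_def y_def upper_def)
    define v where "v = z - of_real X"
    define g where "g t = of_real X + of_real t * v" for t :: real
    have v: "Re v = - y" "Im v = y" by (simp_all add: v_def X_def y_def)
    have g: "Re (g t) = a + (1 - t) * y" "Im (g t) = t * y" for t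
      by (simp_all add: g_def v) (simp add: X_def a_def y_def algebra_simps)
    have gdom: "g t \<in> LG_domain" "Re (g t) \<ge> a" "g t \<in> upper" if "t \<in> {0..1}" for t
    proof -
      show r: "Re (g t) \<ge> a" using that a unfolding g by simp
      show "g t \<in> upper" using that a by (simp add: g upper_def)
      moreover have "g t \<notin> {0, 1, -1}" using r a(1) by auto
      ultimately show "g t \<in> LG_domain" by (simp add: LG_domain_def)
    qed
    \<comment> \<open>Here Im z \<le> Re z is used: the segment is at most twice as long as the
      lower bound a for |g t|.\<close>
    have cv: "cmod v \<le> 2 * a"
      using cmod_le[of v] v a by simp
    have dens: "phi_density n \<bar>N\<bar> (g t) v \<le> 2 * \<delta>" "psi_density n \<bar>N\<bar> (g t) v \<le> 2 * \<delta>" if "t \<in> {0..1}" for t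
    proof -
      have c: "cmod (g t) \<ge> a" using gdom(2)[OF that] complex_Re_le_cmod[of "g t"] by linarith
      have "a * phi_density n \<bar>N\<bar> (g t) 1 \<le> cmod (g t) * phi_density n \<bar>N\<bar> (g t) 1"
        "a * psi_density n \<bar>N\<bar> (g t) 1 \<le> cmod (g t) * psi_density n \<bar>N\<bar> (g t) 1"
        using c density_nonneg N by (auto intro!: mult_right_mono)
      then have "a * phi_density n \<bar>N\<bar> (g t) 1 \<le> \<delta>" "a * psi_density n \<bar>N\<bar> (g t) 1 \<le> \<delta>"
        using R2[of "g t"] c a(3) by linarith+
      moreover have "cmod v * phi_density n \<bar>N\<bar> (g t) 1 \<le> (2 * a) * phi_density n \<bar>N\<bar> (g t) 1"
        "cmod v * psi_density n \<bar>N\<bar> (g t) 1 \<le> (2 * a) * psi_density n \<bar>N\<bar> (g t) 1"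
        using cv density_nonneg N by (auto intro!: mult_right_mono)
      ultimately show "phi_density n \<bar>N\<bar> (g t) v \<le> 2 * \<delta>" "psi_density n \<bar>N\<bar> (g t) v \<le> 2 * \<delta>"
        unfolding density_scale[of n _ _ v] by linarith+
    qed
    have contg: "continuous_on {0..1} g" unfolding g_def by (intro continuous_intros)
    have comp: "continuous_on {0..1} (\<lambda>t. f (g t))" if "continuous_on LG_domain f" for f :: "complex \<Rightarrow> complex"
      using continuous_on_compose2[OF that contg] gdom(1) by blast
    have g0: "g t \<noteq> 0" if "t \<in> {0..1}" for t using gdom(1)[OF that] by (auto simp: LG_domain_def)
    have int: "(\<lambda>t. phi_density n \<bar>N\<bar> (g t) v) integrable_on {0..1}" "(\<lambda>t. psi_density n \<bar>N\<bar> (g t) v) integrable_on {0..1}"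
      unfolding phi_density_def psi_density_def using g0 N
      by (intro integrable_continuous_real continuous_intros contg comp[OF continuous_on_LG_F] comp[OF continuous_on_sqrt_z2m1]; simp)+
    have bound: "LG_u n N w w1 (g 1) \<le>
       (LG_u n N w w1 (g 0) + integral {0..1} (\<lambda>t. phi_density n \<bar>N\<bar> (g t) v)) *
       exp (integral {0..1} (\<lambda>t. phi_density n \<bar>N\<bar> (g t) v) + integral {0..1} (\<lambda>t. psi_density n \<bar>N\<bar> (g t) v))"
    proof (rule LG_curve_bound[OF n _ w _ finite.emptyI contg gdom(1) _ _ _ int])
      show "(g has_vector_derivative v) (at t)" for t
        unfolding g_def[abs_def] by (auto intro!: derivative_eq_intros)
      show "0 \<le> N * Re (sqrt_z2m1 (g t) / g t * v)" if "t \<in> {0<..<1} - {}" for t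
      proof -
        have "\<bar>Im (sqrt_z2m1 (g t) / g t)\<bar> \<le> Re (sqrt_z2m1 (g t) / g t)"
          using sqrt_z2m1_over_z_sector[of "g t"] gdom[of t] that a(1) by auto
        then have "0 \<le> y * (Re (sqrt_z2m1 (g t) / g t) + Im (sqrt_z2m1 (g t) / g t))"
          using a(4) by (intro mult_nonneg_nonneg) linarith+
        moreover have "Re (q * v) = - (y * (Re q + Im q))" for q by (simp add: v algebra_simps)
        ultimately have "Re (sqrt_z2m1 (g t) / g t * v) \<le> 0" by (simp only: neg_le_0_iff_le)
        then show ?thesis using N by (intro mult_nonpos_nonpos) auto
      qed
    qed (use N in auto)
    have I: "integral {0..1} (\<lambda>t. phi_density n \<bar>N\<bar> (g t) v) \<le> 2 * \<delta>" "integral {0..1} (\<lambda>t. psi_density n \<bar>N\<bar> (g t) v) \<le> 2 * \<delta>"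
      "0 \<le> integral {0..1} (\<lambda>t. phi_density n \<bar>N\<bar> (g t) v)"
      using integral_le[OF int(1), of "\<lambda>_. 2 * \<delta>"] integral_le[OF int(2), of "\<lambda>_. 2 * \<delta>"] dens
        integral_nonneg[OF int(1)] density_nonneg N by auto
    have "g 0 = of_real X" "g 1 = z" by (simp_all add: g_def v_def)
    moreover have "X \<ge> R1" using a by (simp add: X_def a_def y_def)
    ultimately have "LG_u n N w w1 (g 0) \<le> \<delta>" using R1[of X] by simp
    then have "LG_u n N w w1 (g 1) \<le> (\<delta> + 2 * \<delta>) * exp (2 * \<delta> + 2 * \<delta>)"
      using I by (intro order.trans[OF bound] mult_mono add_mono) (auto simp: LG_u_def)
    also have "\<dots> \<le> (3 * \<delta>) * 3"
    proof (intro mult_mono)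
      have "exp (2 * \<delta> + 2 * \<delta>) \<le> exp 1" using \<delta> by simp
      then show "exp (2 * \<delta> + 2 * \<delta>) \<le> 3" using exp_le by linarith
    qed (use \<delta> in auto)
    also have "\<dots> < \<epsilon>" using \<delta> \<epsilon> by simp
    finally show "LG_u n N w w1 z < \<epsilon>" using \<open>g 1 = z\<close> by simp
  qed
qed

text \<open>Modulus tending to infinity and argument to 0 place g eventually in the sector of
  \<open>LG_u_sector\<close>: below the angle \<pi> / 4 one has Im z \<le> Re z and Re z \<ge> |z| /
  2.\<close>

lemma LG_u_at_infinity:
  fixes N :: real
  assumes n: "n \<ge> 2" and N: "N < 0" and w: "bessel_system N w w1"
    and real: "((\<lambda>x::real. LG_u n N w w1 (of_real x)) \<longlongrightarrow> 0) at_top"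
    and g: "filterlim g at_infinity F" "((\<lambda>t. Arg (g t)) \<longlongrightarrow> 0) F" "eventually (\<lambda>t. g t \<in> upper) F"
  shows "((\<lambda>t. LG_u n N w w1 (g t)) \<longlongrightarrow> 0) F"
proof (rule tendstoI)
  fix \<epsilon> :: real assume "\<epsilon> > 0"
  then obtain R where R: "\<And>z. z \<in> upper \<Longrightarrow> Re z \<ge> R \<Longrightarrow> Im z \<le> Re z \<Longrightarrow> LG_u n N w w1 z < \<epsilon>"
    using LG_u_sector[OF n N w real] by blast
  have "\<forall>\<^sub>F t in F. cmod (g t) \<ge> max 1 (2 * R)"
    using g(1) unfolding filterlim_at_infinity_conv_norm_at_top filterlim_at_top by blast
  moreover have "\<forall>\<^sub>F t in F. \<bar>Arg (g t)\<bar> < pi / 4"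
    using tendstoD[OF g(2), of "pi / 4"] by (simp add: dist_real_def)
  ultimately show "\<forall>\<^sub>F t in F. dist (LG_u n N w w1 (g t)) 0 < \<epsilon>"
    using g(3)
  proof eventually_elim
    case (elim t)
    define z \<theta> where "z = g t" and "\<theta> = Arg z"
    have z: "z \<noteq> 0" "cmod z \<ge> 2 * R" "cmod z \<ge> 1" using elim by (auto simp: z_def)
    have "z = of_real (cmod z) * exp (\<i> * \<theta>)" unfolding \<theta>_def using Arg_eq[OF z(1)] .
    then have polar: "Re z = cmod z * cos \<theta>" "Im z = cmod z * sin \<theta>"
      by (metis Re_rcis rcis_def cis_conv_exp, metis Im_rcis rcis_def cis_conv_exp)
    have \<theta>: "0 \<le> \<theta>" "\<theta> < pi / 4" using elim by (auto simp: \<theta>_def z_def upper_def Arg_less_0)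
    have c: "cos \<theta> \<ge> cos (pi / 4)" using \<theta> pi_gt_zero by (intro cos_monotone_0_pi_le) auto
    have "sin \<theta> \<le> sin (pi / 4)" using \<theta> pi_gt_zero by (intro sin_monotone_2pi_le) auto
    then have sc: "sin \<theta> \<le> cos \<theta>" using c by (simp add: sin_45 cos_45)
    have "1 \<le> sqrt (2 :: real)" by simp
    then have "cos \<theta> \<ge> 1 / 2" using c unfolding cos_45 by linarith
    then have "cmod z * cos \<theta> \<ge> cmod z * (1 / 2)" by (rule mult_left_mono) auto
    then have "Re z \<ge> R" unfolding polar(1) using z(2) by linarith
    moreover have "Im z \<le> Re z" using sc polar by (simp add: mult_left_mono)
    ultimately have "LG_u n N w w1 z < \<epsilon>" using R[of z] elim by (simp add: z_def)
    moreover have "LG_u n N w w1 z \<ge> 0" by (simp add: LG_u_def)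
    ultimately show ?case by (simp add: z_def)
  qed
qed

section \<open>Error bounds and reflection\<close>

lemma bessel_system_cmult:
  "bessel_system N w w1 \<Longrightarrow> bessel_system N (\<lambda>z. c * w z) (\<lambda>z. c * w1 z)"
  using bessel_system_lincomb[of N w w1 w w1 c 0] by simp

lemma LG_p_cmult: "LG_p n N (\<lambda>z. c * w z) (\<lambda>z. c * w1 z) z = c * LG_p n N w w1 z"
  by (simp add: LG_p_def algebra_simps)

lemma linking_path_domain:
  "linking_path j g z \<Longrightarrow> t \<in> {0<..1} \<Longrightarrow> g t \<in> LG_domain"
  unfolding linking_path_def LG_domain_def upper_def by blast

text \<open>The sign of N matches the direction of monotonicity: N > 0 goes with nondecreasing Re
  \<xi>, hence j = 1, and N < 0 with the nonincreasing paths.\<close>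

lemma LG_path_bound':
  fixes N :: real
  assumes n: "n \<ge> 2" and N: "N \<noteq> 0" and w: "bessel_system N w w1"
    and path: "admissible_path n j g z" and j: "if N > 0 then j = 1 else j \<noteq> 1"
    and lim: "((\<lambda>t. LG_u n N w w1 (g t)) \<longlongrightarrow> 0) (at_right 0)"
  shows "cmod (w z * LG_V n N z - 1) \<le>
    LG_bound n g \<bar>N\<bar>"
proof -
  have p: "linking_path j g z" "integrals_converge n g" using path by (auto simp: admissible_path_def)
  then have g: "R2_chain g" "g 1 = z" by (auto simp: linking_path_def)
  have mono: "mono_on {0<..1} (\<lambda>t. N * Re (xi (g t)))"
  proof (rule mono_onI)
    fix s t :: real assume st: "s \<in> {0<..1}" "t \<in> {0<..1}" "s \<le> t"
    show "N * Re (xi (g s)) \<le> N * Re (xi (g t))"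
    proof (cases "N > 0")
      case True
      then have "mono_on {0<..1} (\<lambda>t. Re (xi (g t)))" using p(1) j by (simp add: linking_path_def)
      then have "Re (xi (g s)) \<le> Re (xi (g t))" using st by (simp add: monotone_on_def)
      then show ?thesis using True by (intro mult_left_mono) auto
    next
      case False
      then have "antimono_on {0<..1} (\<lambda>t. Re (xi (g t)))" using p(1) j by (simp add: linking_path_def)
      then have "Re (xi (g t)) \<le> Re (xi (g s))" using st by (simp add: monotone_on_def)
      then show ?thesis using False by (intro mult_left_mono_neg) auto
    qed
  qed
  from LG_path_bound[OF n N w g(1) linking_path_domain[OF p(1)] mono p(2) lim] show ?thesis by (simp add: g(2))
qed

text \<open>Both signs of N are served at once: N = \<nu> gives order \<i> \<nu> from the first
  reference point at 0, N = - \<nu> order - \<i> \<nu> from the other. C is the limit of h at 0; it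
  is the same for every path, so one error function serves all of them.\<close>

lemma besselI_path_bound:
  fixes N :: real
  assumes n: "n \<ge> 2" and N: "N \<noteq> 0"
  obtains C where "C \<noteq> 0" "\<And>j g z. admissible_path n j g z \<Longrightarrow> (if N > 0 then j = 1 else j = -1) \<Longrightarrow>
    cmod (besselI (\<i> * N) (of_real \<bar>N\<bar> * z) * LG_V n N z / C - 1) \<le>
    LG_bound n g \<bar>N\<bar>"
proof -
  define w w1 where "w z = besselI (\<i> * N) (of_real \<bar>N\<bar> * z)" and "w1 = besselI' (\<i> * N) \<bar>N\<bar>" for z
  obtain C where C: "C \<noteq> 0" "((\<lambda>z. w z * LG_V n N z) \<longlongrightarrow> C) (at 0 within upper)"
    "(LG_p n N w w1 \<longlongrightarrow> 0) (at 0 within upper)"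
    using LG_limit_at_0[OF N, of n] unfolding w_def[abs_def] w1_def by blast
  have "bessel_system N w w1"
    unfolding w_def[abs_def] w1_def
    by (rule bessel_system_besselI) (use N in \<open>auto simp: power_mult_distrib simp flip: of_real_power\<close>)
  note sys = bessel_system_cmult[OF this, of "1 / C"]
  show ?thesis
  proof (rule that[OF C(1)])
    fix j g z assume path: "admissible_path n j g z" and j: "if N > 0 then j = 1 else j = -1"
    have p: "linking_path j g z" using path by (simp add: admissible_path_def)
    have "starts_at_ref j g" using p by (simp add: linking_path_def)
    then have "(g \<longlongrightarrow> 0) (at_right 0)" using j by (auto simp: starts_at_ref_def split: if_splits)
    moreover have "\<forall>\<^sub>F t in at_right 0. g t \<in> upper - {0}"
      using eventually_at_right_real[of 0 1]
    proof (rule eventually_mono)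
      show "g t \<in> upper - {0}" if "t \<in> {0<..<1}" for t
        using linking_path_domain[OF p, of t] that by (auto simp: LG_domain_def)
    qed simp
    ultimately have g: "filterlim g (at 0 within upper) (at_right 0)"
      by (auto simp: filterlim_at elim: eventually_mono)
    have "((\<lambda>t. LG_u n N (\<lambda>z. 1 / C * w z) (\<lambda>z. 1 / C * w1 z) (g t)) \<longlongrightarrow> 0) (at_right 0)"
    proof (rule LG_u_tendsto)
      have "((\<lambda>z. 1 / C * (w z * LG_V n N z)) \<longlongrightarrow> 1 / C * C) (at 0 within upper)"
        "((\<lambda>z. 1 / C * LG_p n N w w1 z) \<longlongrightarrow> 1 / C * 0) (at 0 within upper)"
        by (intro tendsto_intros C)+
      from this[THEN filterlim_compose, OF g] C(1)
      show "((\<lambda>t. 1 / C * w (g t) * LG_V n N (g t)) \<longlongrightarrow> 1) (at_right 0)"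
        "((\<lambda>t. LG_p n N (\<lambda>z. 1 / C * w z) (\<lambda>z. 1 / C * w1 z) (g t)) \<longlongrightarrow> 0) (at_right 0)"
        unfolding LG_p_cmult by (simp_all add: mult.assoc)
    qed
    from LG_path_bound'[OF n N sys path _ this] j
    show "cmod (besselI (\<i> * N) (of_real \<bar>N\<bar> * z) * LG_V n N z / C - 1) \<le>
      LG_bound n g \<bar>N\<bar>"
      by (auto simp: w_def split: if_splits)
  qed
qed

text \<open>The constant c is the reciprocal of the constant in \<open>K_approx\<close>; that h
  tends to exactly 1 is what identifies the connection coefficient of K.\<close>

lemma besselK_path_bound:
  fixes \<nu> :: real
  assumes n: "n \<ge> 2" and \<nu>: "\<nu> > 0" and path: "admissible_path n 0 g z"
  defines "c \<equiv> of_real (sqrt (2 * \<nu> / pi) * exp (pi * \<nu> / 2))"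
  shows "cmod (c * besselK (\<i> * \<nu>) (of_real \<nu> * z) * LG_V n (of_real (- \<nu>)) z - 1) \<le>
    LG_bound n g \<nu>"
proof -
  define \<mu> where "\<mu> = \<i> * complex_of_real \<nu>"
  define S where "S = sin (\<mu> * of_real pi)"
  have "\<mu> \<notin> \<int>" using \<nu> by (auto simp: \<mu>_def complex_is_Int_iff)
  then have K: "besselK \<mu> x = of_real pi / 2 * (besselI (- \<mu>) x - besselI \<mu> x) / S" for x
    by (simp add: besselK_def S_def Let_def)
  have S: "S \<noteq> 0"
  proof
    assume "S = 0"
    then have "\<exists>k::int. \<mu> * of_real pi = of_int k * of_real pi"
      unfolding S_def by (auto simp: sin_eq_0 complex_is_Int_iff mult.commute)
    then show False using \<open>\<mu> \<notin> \<int>\<close> by auto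
  qed
  define w w1 where "w z = besselI (- \<mu>) (of_real \<nu> * z) - besselI \<mu> (of_real \<nu> * z)"
    and "w1 z = besselI' (- \<mu>) \<nu> z - besselI' \<mu> \<nu> z" for z
  define d where "d = c * (of_real pi / (2 * S))"
  have cK: "c * besselK \<mu> (of_real \<nu> * z) = d * w z" for z
    by (simp add: K d_def w_def)
  have m2: "\<mu>\<^sup>2 = - (of_real \<nu>)\<^sup>2" "(- \<mu>)\<^sup>2 = - (of_real \<nu>)\<^sup>2" "(of_real (- \<nu>))\<^sup>2 = (of_real \<nu> :: complex)\<^sup>2"
    by (simp_all add: \<mu>_def power_mult_distrib)
  have "bessel_system (of_real (- \<nu>)) w w1"
    using bessel_system_lincomb[OF bessel_system_besselI[OF \<nu> m2(2,3)] bessel_system_besselI[OF \<nu> m2(1,3)], of 1 "-1"]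
    by (simp add: w_def[abs_def] w1_def[abs_def])
  note sys = bessel_system_cmult[OF this, of d]
  note asym = besselK_real_asymptotics[OF \<nu> \<mu>_def, folded w_def w1_def S_def]
  have inf: "filterlim (\<lambda>x::real. complex_of_real x) at_infinity at_top"
    unfolding filterlim_at_infinity_conv_norm_at_top by (simp add: filterlim_abs_real)
  have h: "((\<lambda>x::real. d * w (of_real x) * LG_V n (of_real (- \<nu>)) (of_real x)) \<longlongrightarrow> 1) at_top"
  proof (rule Lim_transform_eventually)
    let ?f = "\<lambda>x::real. d / of_real (sqrt (2 * pi * \<nu>)) * ((w (of_real x) * of_real (sqrt (2 * pi * \<nu> * x) * exp (\<nu> * x))) *
      (LG_V n (of_real (- \<nu>)) (of_real x) * of_real (exp (- \<nu> * x) / sqrt x)))"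
    have "(?f \<longlongrightarrow>
      d / of_real (sqrt (2 * pi * \<nu>)) * ((2 * S) * of_real (exp (- \<nu> * pi / 2)))) at_top"
      using \<nu> by (intro tendsto_intros asym(1) LG_V_real_at_infinity(1)) auto
    moreover have "d / of_real (sqrt (2 * pi * \<nu>)) * ((2 * S) * of_real (exp (- \<nu> * pi / 2))) = 1"
    proof -
      have "sqrt (2 * \<nu> / pi) * exp (pi * \<nu> / 2) * pi / sqrt (2 * pi * \<nu>) * exp (- \<nu> * pi / 2) =
          (sqrt (2 * \<nu> / pi) * pi / sqrt (2 * pi * \<nu>)) * (exp (pi * \<nu> / 2) * exp (- \<nu> * pi / 2))" by simp
      also have "exp (pi * \<nu> / 2) * exp (- \<nu> * pi / 2) = 1" by (simp add: mult.commute flip: exp_add)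
      also have "sqrt (2 * \<nu> / pi) * pi = sqrt (2 * pi * \<nu>)"
        using \<nu> by (simp add: real_sqrt_divide real_sqrt_mult field_simps)
      finally have "sqrt (2 * \<nu> / pi) * exp (pi * \<nu> / 2) * pi / sqrt (2 * pi * \<nu>) * exp (- \<nu> * pi / 2) = 1"
        using \<nu> by simp
      then have "c * of_real pi / of_real (sqrt (2 * pi * \<nu>)) * of_real (exp (- \<nu> * pi / 2)) = 1"
        unfolding c_def by (simp only: of_real_mult[symmetric] of_real_divide[symmetric] of_real_1)
      moreover have "d / x * ((2 * S) * y) = c * of_real pi / x * y" for x y using S by (simp add: d_def)
      ultimately show ?thesis by (simp only:)
    qed
    ultimately show "(?f \<longlongrightarrow> 1) at_top" by simp
    show "\<forall>\<^sub>F x::real in at_top. ?f x =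
      d * w (of_real x) * LG_V n (of_real (- \<nu>)) (of_real x)"
      using eventually_gt_at_top[of 0]
    proof eventually_elim
      case (elim x)
      have "sqrt (2 * pi * \<nu> * x) * exp (\<nu> * x) * (exp (- \<nu> * x) / sqrt x) = sqrt (2 * pi * \<nu>) * (exp (\<nu> * x) * exp (- \<nu> * x))"
        using elim unfolding real_sqrt_mult[of _ x] by simp
      also have "exp (\<nu> * x) * exp (- \<nu> * x) = 1" by (simp flip: exp_add)
      finally have e: "complex_of_real (sqrt (2 * pi * \<nu> * x) * exp (\<nu> * x)) * of_real (exp (- \<nu> * x) / sqrt x) = of_real (sqrt (2 * pi * \<nu>))"
        unfolding of_real_mult[symmetric] by simp
      have "d / q * ((w (of_real x) * a) * (v * b)) = d * w (of_real x) * v * (a * b) / q" for q a b v by simp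
      then show ?case using \<nu> by (simp only: e) simp
    qed
  qed
  \<comment> \<open>Writing p as h times a logarithmic derivative reduces the claim to - \<nu> +
    \<nu> = 0, the first summand coming from w1 / w.\<close>
  have p: "((\<lambda>x::real. LG_p n (of_real (- \<nu>)) (\<lambda>z. d * w z) (\<lambda>z. d * w1 z) (of_real x)) \<longlongrightarrow> 0) at_top"
  proof (rule Lim_transform_eventually)
    let ?f = "\<lambda>x. d * w (of_real x) * LG_V n (of_real (- \<nu>)) (of_real x) * (of_real (x / sqrt (x\<^sup>2 - 1)) * (w1 (of_real x) / w (of_real x)) +
       (of_real (x\<^sup>2 / (2 * sqrt (x\<^sup>2 - 1) ^ 3)) - (of_real (- \<nu>) + LG_T n (of_real (- \<nu>)) (of_real x))))"
    have r: "((\<lambda>x::real. x / sqrt (x\<^sup>2 - 1)) \<longlongrightarrow> 1) at_top" "((\<lambda>x::real. x\<^sup>2 / (2 * sqrt (x\<^sup>2 - 1) ^ 3)) \<longlongrightarrow> 0) at_top"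
      by real_asymp+
    have "(?f \<longlongrightarrow>
       1 * (of_real 1 * (- of_real \<nu>) + (of_real 0 - (of_real (- \<nu>) + 0)))) at_top"
      by (intro tendsto_intros h r asym(2) LG_at_infinity(4)[OF inf])
    then show "(?f \<longlongrightarrow> 0) at_top" by simp
    have "\<forall>\<^sub>F x in at_top. d * w (of_real x) * LG_V n (of_real (- \<nu>)) (of_real x) \<noteq> 0"
      using tendsto_imp_eventually_ne[OF h, of 0] by simp
    then show "\<forall>\<^sub>F x in at_top. ?f x =
       LG_p n (of_real (- \<nu>)) (\<lambda>z. d * w z) (\<lambda>z. d * w1 z) (of_real x)"
      using eventually_gt_at_top[of 1]
    proof eventually_elim
      case (elim x)
      then have "w (of_real x) \<noteq> 0" by auto
      then have e: "d * w (of_real x) * V * (q * (w1 (of_real x) / w (of_real x)) + B) = d * (V * (q * w1 (of_real x) + w (of_real x) * B))" for V q B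
        by (simp add: field_simps)
      have "of_real x / of_real (sqrt (x\<^sup>2 - 1)) = complex_of_real (x / sqrt (x\<^sup>2 - 1))"
        "(of_real x)\<^sup>2 / (2 * of_real (sqrt (x\<^sup>2 - 1)) ^ 3) = complex_of_real (x\<^sup>2 / (2 * sqrt (x\<^sup>2 - 1) ^ 3))"
        by simp_all
      then show ?case unfolding LG_p_cmult LG_p_def sqrt_z2m1_of_real(1)[OF elim(2)] by (simp only: e)
    qed
  qed
  have "((\<lambda>t. LG_u n (of_real (- \<nu>)) (\<lambda>z. d * w z) (\<lambda>z. d * w1 z) (g t)) \<longlongrightarrow> 0) (at_right 0)"
  proof (rule LG_u_at_infinity[OF n _ sys LG_u_tendsto[OF h p]])
    have lp: "linking_path 0 g z" using path by (simp add: admissible_path_def)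
    then have "starts_at_ref 0 g" by (simp add: linking_path_def)
    then show "filterlim g at_infinity (at_right 0)" "((\<lambda>t. Arg (g t)) \<longlongrightarrow> 0) (at_right 0)"
      by (simp_all add: starts_at_ref_def)
    show "\<forall>\<^sub>F t in at_right 0. g t \<in> upper"
      using eventually_at_right_real[of 0 1]
    proof (rule eventually_mono)
      show "g t \<in> upper" if "t \<in> {0<..<1}" for t
        using linking_path_domain[OF lp, of t] that by (auto simp: LG_domain_def)
    qed simp
  qed (use \<nu> in simp)
  from LG_path_bound'[OF n _ sys path _ this] \<nu>
  have "cmod (d * w z * LG_V n (of_real (- \<nu>)) z - 1) \<le> LG_bound n g \<nu>"
    by simp
  then show ?thesis unfolding cK[symmetric] \<mu>_def .
qed

section \<open>Reflection in the real axis\<close>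

lemma besselI_cnj:
  assumes "Im z = 0 \<Longrightarrow> Re z \<ge> 0"
  shows "besselI (cnj \<mu>) (cnj z) = cnj (besselI \<mu> z)"
proof -
  have "(\<lambda>k. cnj (bessel_coeff \<mu> k * (z\<^sup>2 / 4) ^ k)) sums cnj (bessel_series \<mu> (z\<^sup>2 / 4))"
    unfolding sums_cnj bessel_series_def by (rule summable_sums[OF summable_bessel_series])
  then have "bessel_series (cnj \<mu>) ((cnj z)\<^sup>2 / 4) = cnj (bessel_series \<mu> (z\<^sup>2 / 4))"
    unfolding bessel_series_def bessel_coeff_def by (simp add: cnj_rGamma sums_iff)
  \<comment> \<open>The principal power commutes with conjugation off the negative real axis, which
    the assumption excludes.\<close>
  moreover have "(cnj z / 2) powr cnj \<mu> = cnj ((z / 2) powr \<mu>)"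
    using cnj_powr[of "z / 2" \<mu>] assms by simp
  ultimately show ?thesis by (simp add: besselI_series)
qed

text \<open>On the cut conjugation carries the limit from below into a limit within
  \<open>upper\<close>, where g is continuous; elsewhere the relation f (cnj w) = cnj (g w) applies
  directly.\<close>

lemma value_at_conjugate_reflection:
  assumes z: "z \<noteq> 0" and fg: "\<And>w. (Im w = 0 \<Longrightarrow> Re w \<ge> 0) \<Longrightarrow> f (cnj w) = cnj (g w)"
    and cont: "continuous_on (upper - {0}) g"
  shows "value_at_conjugate f z (cnj (g z))"
proof (cases "z \<in> \<real>\<^sub>\<le>\<^sub>0")
  case False
  then show ?thesis using fg[of z] by (auto simp: value_at_conjugate_def complex_nonpos_Reals_iff)
next
  case True
  then have zr: "cnj z = z" "z \<in> upper" by (auto simp: complex_nonpos_Reals_iff complex_eq_iff upper_def)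
  have "filterlim cnj (at z within upper - {0}) (at z within {w. Im w < 0})"
    unfolding filterlim_at
  proof
    have "(cnj \<longlongrightarrow> cnj z) (at z within {w. Im w < 0})" by (intro tendsto_intros)
    then show "(cnj \<longlongrightarrow> z) (at z within {w. Im w < 0})" using zr by simp
    show "\<forall>\<^sub>F w in at z within {w. Im w < 0}. cnj w \<in> upper - {0} \<and> cnj w \<noteq> z"
      unfolding eventually_at_filter using zr by (auto simp: upper_def intro!: always_eventually)
  qed
  moreover have "(g \<longlongrightarrow> g z) (at z within upper - {0})"
    using cont z zr by (auto simp: continuous_on_def)
  ultimately have "((\<lambda>w. g (cnj w)) \<longlongrightarrow> g z) (at z within {w. Im w < 0})"
    by (rule filterlim_compose[rotated])
  then have lim: "((\<lambda>w. cnj (g (cnj w))) \<longlongrightarrow> cnj (g z)) (at z within {w. Im w < 0})"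
    by (intro tendsto_intros)
  have "(f \<longlongrightarrow> cnj (g z)) (at z within {w. Im w < 0})"
  proof (rule Lim_transform_eventually[OF lim])
    show "\<forall>\<^sub>F w in at z within {w. Im w < 0}. cnj (g (cnj w)) = f w"
      unfolding eventually_at_filter using fg[of "cnj _"] by (auto intro!: always_eventually)
  qed
  then show ?thesis using True by (simp add: value_at_conjugate_def)
qed

lemma bessel_reflection:
  fixes \<nu> :: real
  assumes \<nu>: "\<nu> > 0" and z: "z \<noteq> 0"
  shows "value_at_conjugate (\<lambda>w. besselI (\<i> * of_real \<nu>) (of_real \<nu> * w)) z
            (cnj (besselI (- (\<i> * of_real \<nu>)) (of_real \<nu> * z)))"
    and "value_at_conjugate (\<lambda>w. besselI (- (\<i> * of_real \<nu>)) (of_real \<nu> * w)) z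
            (cnj (besselI (\<i> * of_real \<nu>) (of_real \<nu> * z)))"
    and "value_at_conjugate (\<lambda>w. besselK (\<i> * of_real \<nu>) (of_real \<nu> * w)) z
            (cnj (besselK (\<i> * of_real \<nu>) (of_real \<nu> * z)))"
proof -
  define \<mu> where "\<mu> = \<i> * complex_of_real \<nu>"
  have cnj: "cnj \<mu> = - \<mu>" by (simp add: \<mu>_def)
  have reflect: "besselI \<mu> (of_real \<nu> * cnj w) = cnj (besselI (- \<mu>) (of_real \<nu> * w))"
    "besselI (- \<mu>) (of_real \<nu> * cnj w) = cnj (besselI \<mu> (of_real \<nu> * w))" if "Im w = 0 \<Longrightarrow> Re w \<ge> 0" for w
    using besselI_cnj[of "of_real \<nu> * w" "- \<mu>"] besselI_cnj[of "of_real \<nu> * w" \<mu>] that \<nu> by (simp_all add: cnj)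
  have m2: "\<mu>\<^sup>2 = - (of_real \<nu>)\<^sup>2" "(- \<mu>)\<^sup>2 = - (of_real \<nu>)\<^sup>2" by (simp_all add: \<mu>_def power_mult_distrib)
  have cont: "continuous_on (upper - {0}) (\<lambda>z. besselI \<mu> (of_real \<nu> * z))" if "\<mu>\<^sup>2 = - (of_real \<nu>)\<^sup>2" for \<mu>
    using bessel_system_besselI[OF \<nu> that refl] unfolding bessel_system_def continuous_on_eq_continuous_within
    by (blast intro: DERIV_continuous continuous_within_subset)
  show "value_at_conjugate (\<lambda>w. besselI (\<i> * of_real \<nu>) (of_real \<nu> * w)) z (cnj (besselI (- (\<i> * of_real \<nu>)) (of_real \<nu> * z)))"
    unfolding \<mu>_def[symmetric] by (rule value_at_conjugate_reflection[OF z reflect(1) cont[OF m2(2)]])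
  show "value_at_conjugate (\<lambda>w. besselI (- (\<i> * of_real \<nu>)) (of_real \<nu> * w)) z (cnj (besselI (\<i> * of_real \<nu>) (of_real \<nu> * z)))"
    unfolding \<mu>_def[symmetric] by (rule value_at_conjugate_reflection[OF z reflect(2) cont[OF m2(1)]])
  have "\<mu> \<notin> \<int>" using \<nu> by (auto simp: \<mu>_def complex_is_Int_iff)
  then have K: "besselK \<mu> x = of_real pi / 2 * (besselI (- \<mu>) x - besselI \<mu> x) / sin (\<mu> * of_real pi)" for x
    by (simp add: besselK_def Let_def)
  show "value_at_conjugate (\<lambda>w. besselK (\<i> * of_real \<nu>) (of_real \<nu> * w)) z (cnj (besselK (\<i> * of_real \<nu>) (of_real \<nu> * z)))"
    unfolding \<mu>_def[symmetric]
  proof (rule value_at_conjugate_reflection[OF z])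
    \<comment> \<open>The sine is purely imaginary, so conjugation reverses its sign; this offsets
      the exchange of the two orders in the numerator.\<close>
    have S: "cnj (sin (\<mu> * of_real pi)) = - sin (\<mu> * of_real pi)"
      using cnj_sin[of "\<mu> * of_real pi"] by (simp add: cnj)
    fix w :: complex assume w: "Im w = 0 \<Longrightarrow> Re w \<ge> 0"
    have "besselI \<mu> (of_real \<nu> * cnj w) = cnj (besselI (- \<mu>) (of_real \<nu> * w))"
      "besselI (- \<mu>) (of_real \<nu> * cnj w) = cnj (besselI \<mu> (of_real \<nu> * w))"
      by (rule reflect, rule w, assumption)+
    then show "besselK \<mu> (of_real \<nu> * cnj w) = cnj (besselK \<mu> (of_real \<nu> * w))"
      by (simp add: K S minus_divide_right[symmetric] right_diff_distrib diff_divide_distrib)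
  next
    show "continuous_on (upper - {0}) (\<lambda>z. besselK \<mu> (of_real \<nu> * z))"
      unfolding K divide_inverse[of _ "sin _"] by (intro continuous_intros cont m2)
  qed
qed

section \<open>The expansions for a fixed order\<close>

lemma approx_eq_LG_V:
  fixes \<nu> :: real
  shows "K_approx n \<nu> z = of_real (sqrt (pi / (2 * \<nu>)) * exp (- (pi * \<nu> / 2))) / LG_V n (of_real (- \<nu>)) z"
    and "Ip_approx n \<nu> z = of_real (sqrt (1 / (2 * pi * \<nu>)) * exp (pi * \<nu> / 2)) / LG_V n (of_real \<nu>) z"
    and "Im_approx n \<nu> z = \<i> * of_real (sqrt (1 / (2 * pi * \<nu>)) * exp (pi * \<nu> / 2)) / LG_V n (of_real (- \<nu>)) z"
proof -
  \<comment> \<open>The alternating signs are those of the powers of N = - \<nu>.\<close>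
  have s: "(- 1) ^ s * LG_E s (beta z) / of_real \<nu> ^ s = LG_E s (beta z) / of_real (- \<nu>) ^ s" for s
    by (cases "even s") (simp_all add: power_minus_odd)
  have e: "exp (a + b + c) = of_real (exp b') / exp (- a - c)" if "b = of_real b'" for a b c :: complex and b'
    unfolding that exp_of_real[symmetric] by (simp add: algebra_simps flip: exp_diff)
  show "K_approx n \<nu> z = of_real (sqrt (pi / (2 * \<nu>)) * exp (- (pi * \<nu> / 2))) / LG_V n (of_real (- \<nu>)) z"
    unfolding K_approx_def LG_V_def s
    using e[of "- of_real (pi * \<nu> / 2)" "- (pi * \<nu> / 2)" "- of_real \<nu> * xi z" "\<Sum>s = 1..n - 1. LG_E s (beta z) / of_real (- \<nu>) ^ s"]
    by (simp add: mult_ac)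
  show "Ip_approx n \<nu> z = of_real (sqrt (1 / (2 * pi * \<nu>)) * exp (pi * \<nu> / 2)) / LG_V n (of_real \<nu>) z"
    unfolding Ip_approx_def LG_V_def
    using e[of "of_real (pi * \<nu> / 2)" "pi * \<nu> / 2" "of_real \<nu> * xi z" "\<Sum>s = 1..n - 1. LG_E s (beta z) / of_real \<nu> ^ s"]
    by (simp add: mult_ac)
  show "Im_approx n \<nu> z = \<i> * of_real (sqrt (1 / (2 * pi * \<nu>)) * exp (pi * \<nu> / 2)) / LG_V n (of_real (- \<nu>)) z"
    unfolding Im_approx_def LG_V_def s
    using e[of "of_real (pi * \<nu> / 2)" "pi * \<nu> / 2" "- of_real \<nu> * xi z" "\<Sum>s = 1..n - 1. LG_E s (beta z) / of_real (- \<nu>) ^ s"]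
    by (simp add: mult_ac)
qed

text \<open>These limits are the constants of \<open>Ip_approx\<close> and \<open>Im_approx\<close>.
  Divided by the limit of h at 0 they give 1 + \<eta>(\<infinity>).\<close>

lemma besselI_LG_V_at_infinity:
  fixes \<nu> :: real
  assumes \<nu>: "\<nu> > 0"
  shows "((\<lambda>x::real. besselI (\<i> * \<nu>) (of_real \<nu> * of_real x) * LG_V n \<nu> (of_real x)) \<longlongrightarrow>
           of_real (sqrt (1 / (2 * pi * \<nu>)) * exp (pi * \<nu> / 2))) at_top"
    and "((\<lambda>x::real. besselI (- (\<i> * \<nu>)) (of_real \<nu> * - of_real x) * LG_V n (of_real (- \<nu>)) (- of_real x)) \<longlongrightarrow>
           \<i> * of_real (sqrt (1 / (2 * pi * \<nu>)) * exp (pi * \<nu> / 2))) at_top"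
proof -
  define k where "k = sqrt (1 / (2 * pi * \<nu>))"
  have k: "sqrt (2 * pi * \<nu> * x) * exp (- (\<nu> * x)) * (exp (\<nu> * x) / sqrt x) * k = 1" if "x > 0" for x
  proof -
    have "sqrt (2 * pi * \<nu> * x) * exp (- (\<nu> * x)) * (exp (\<nu> * x) / sqrt x) * k =
       (sqrt (2 * pi * \<nu>) * k) * (exp (- (\<nu> * x)) * exp (\<nu> * x))"
      using that unfolding real_sqrt_mult[of _ x] by simp
    also have "exp (- (\<nu> * x)) * exp (\<nu> * x) = 1" by (simp flip: exp_add)
    also have "sqrt (2 * pi * \<nu>) * k = 1" using \<nu> by (simp add: k_def real_sqrt_divide)
    finally show ?thesis by (simp only: mult_1)
  qed
  have kc: "of_real (sqrt (2 * pi * \<nu> * x) * exp (- (\<nu> * x))) * complex_of_real (exp (\<nu> * x) / sqrt x) * of_real k = 1" if "x > 0" for x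
    using arg_cong[OF k[OF that], of complex_of_real] by (simp only: of_real_mult of_real_1)
  show "((\<lambda>x::real. besselI (\<i> * \<nu>) (of_real \<nu> * of_real x) * LG_V n \<nu> (of_real x)) \<longlongrightarrow>
           of_real (sqrt (1 / (2 * pi * \<nu>)) * exp (pi * \<nu> / 2))) at_top"
  proof (rule Lim_transform_eventually)
    let ?f = "\<lambda>x. (besselI (\<i> * \<nu>) (of_real \<nu> * of_real x) * of_real (sqrt (2 * pi * \<nu> * x) * exp (- (\<nu> * x)))) *
        (LG_V n \<nu> (of_real x) * of_real (exp (\<nu> * x) / sqrt x)) * of_real k"
    have "(?f \<longlongrightarrow> 1 * of_real (exp (\<nu> * pi / 2)) * of_real k) at_top"
      using \<nu> by (intro tendsto_intros besselI_scaled_asymptotics LG_V_real_at_infinity(1)) auto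
    then show "(?f \<longlongrightarrow> of_real (sqrt (1 / (2 * pi * \<nu>)) * exp (pi * \<nu> / 2))) at_top"
      unfolding k_def[symmetric] of_real_mult by (simp only: mult_1 mult.commute)
    show "\<forall>\<^sub>F x in at_top. ?f x = besselI (\<i> * \<nu>) (of_real \<nu> * of_real x) * LG_V n \<nu> (of_real x)"
      using eventually_gt_at_top[of 0]
    proof eventually_elim
      case (elim x)
      have "(I * a) * (V * b) * c = I * V * (a * b * c)" for I a V b c :: complex by (simp only: mult_ac)
      then show ?case by (simp only: kc[OF elim] mult_1_right)
    qed
  qed
  \<comment> \<open>On the upper side of the negative axis Ln gains \<i> \<pi>, which multiplies the
    power by exp (\<pi> \<nu>); the series depends on the square of its argument only.\<close>
  have neg: "besselI (- (\<i> * \<nu>)) (of_real \<nu> * - of_real x) = of_real (exp (pi * \<nu>)) * besselI (\<i> * of_real (- \<nu>)) (of_real \<nu> * of_real x)"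
    if "x > 0" for x
  proof -
    have "Ln (- of_real (\<nu> * x / 2)) = Ln (of_real (\<nu> * x / 2)) + \<i> * pi"
      using that \<nu> Ln_minus[of "of_real (\<nu> * x / 2)"] by (simp add: not_less)
    then have "(- of_real (\<nu> * x / 2)) powr (- (\<i> * \<nu>)) = of_real (exp (pi * \<nu>)) * of_real (\<nu> * x / 2) powr (- (\<i> * \<nu>))"
      using that \<nu> by (simp add: powr_def algebra_simps exp_of_real[symmetric] flip: exp_add)
    then show ?thesis by (simp add: besselI_series)
  qed
  show "((\<lambda>x::real. besselI (- (\<i> * \<nu>)) (of_real \<nu> * - of_real x) * LG_V n (of_real (- \<nu>)) (- of_real x)) \<longlongrightarrow>
           \<i> * of_real (sqrt (1 / (2 * pi * \<nu>)) * exp (pi * \<nu> / 2))) at_top"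
  proof (rule Lim_transform_eventually)
    let ?f = "\<lambda>x. of_real (exp (pi * \<nu>)) * (besselI (\<i> * of_real (- \<nu>)) (of_real \<nu> * of_real x) * of_real (sqrt (2 * pi * \<nu> * x) * exp (- (\<nu> * x)))) *
        (LG_V n (of_real (- \<nu>)) (- of_real x) * of_real (exp (- (- \<nu>) * x) / sqrt x)) * of_real k"
    have "(?f \<longlongrightarrow>
        of_real (exp (pi * \<nu>)) * 1 * (\<i> * of_real (exp (- \<nu> * pi / 2))) * of_real k) at_top"
      using \<nu> by (intro tendsto_intros besselI_scaled_asymptotics LG_V_real_at_infinity(2)) auto
    moreover have "of_real (exp (pi * \<nu>)) * 1 * (\<i> * of_real (exp (- \<nu> * pi / 2))) * of_real k = \<i> * of_real (k * exp (pi * \<nu> / 2))"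
    proof -
      have "exp (pi * \<nu>) * exp (- \<nu> * pi / 2) = exp (pi * \<nu> / 2)" by (simp add: field_simps flip: exp_add)
      then have "complex_of_real (exp (pi * \<nu>)) * of_real (exp (- \<nu> * pi / 2)) = of_real (exp (pi * \<nu> / 2))"
        unfolding of_real_mult[symmetric] by (simp only:)
      moreover have "a * 1 * (\<i> * b) * c = \<i> * (c * (a * b))" for a b c :: complex by simp
      ultimately show ?thesis by (simp only: of_real_mult)
    qed
    ultimately show "(?f \<longlongrightarrow>
        \<i> * of_real (sqrt (1 / (2 * pi * \<nu>)) * exp (pi * \<nu> / 2))) at_top"
      unfolding k_def[symmetric] by (simp only:)
    show "\<forall>\<^sub>F x in at_top. ?f x =
        besselI (- (\<i> * \<nu>)) (of_real \<nu> * - of_real x) * LG_V n (of_real (- \<nu>)) (- of_real x)"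
      using eventually_gt_at_top[of 0]
    proof eventually_elim
      case (elim x)
      have "e * (I * a) * (V * b) * c = e * I * V * (a * b * c)" for e I a V b c :: complex by (simp only: mult_ac)
      then show ?case unfolding neg[OF elim] minus_minus by (simp only: kc[OF elim] mult_1_right)
    qed
  qed
qed

lemma LG_Z_domain: "z \<in> LG_Z n j \<Longrightarrow> z \<in> LG_domain"
  unfolding LG_Z_def admissible_path_def using linking_path_domain[of j _ z 1] by (auto simp: linking_path_def)

text \<open>All claims about a single \<nu>, bundled so that the error functions and constants can
  afterwards be chosen as functions of \<nu>.\<close>

definition LG_expansions :: "nat \<Rightarrow> real \<Rightarrow> (int \<Rightarrow> complex \<Rightarrow> complex) \<Rightarrow> complex \<Rightarrow> complex \<Rightarrow> bool" where
  "LG_expansions n \<nu> \<eta> a b \<longleftrightarrow>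
    (\<forall>z\<in>LG_Z n 0. besselK (\<i> * of_real \<nu>) (of_real \<nu> * z) = K_approx n \<nu> z * (1 + \<eta> 0 z)) \<and>
    (\<forall>z\<in>LG_Z n 1. besselI (\<i> * of_real \<nu>) (of_real \<nu> * z) = Ip_approx n \<nu> z * ((1 + \<eta> 1 z) / (1 + a))) \<and>
    (\<forall>z\<in>LG_Z n (- 1). besselI (- (\<i> * of_real \<nu>)) (of_real \<nu> * z) = Im_approx n \<nu> z * ((1 + \<eta> (- 1) z) / (1 + b))) \<and>
    ((\<lambda>x::real. \<eta> 1 (of_real x)) \<longlongrightarrow> a) at_top \<and>
    ((\<lambda>x::real. \<eta> (- 1) (- of_real x)) \<longlongrightarrow> b) at_top \<and>
    1 + a \<noteq> 0 \<and> 1 + b \<noteq> 0 \<and>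
    (\<forall>j\<in>{- 1, 0, 1}. \<forall>z g. admissible_path n j g z \<longrightarrow>
      cmod (\<eta> j z) \<le> LG_bound n g \<nu>)"

lemma expansions_fixed_order:
  fixes \<nu> :: real
  assumes n: "n \<ge> 2" and \<nu>: "\<nu> > 0"
  shows "\<exists>\<eta> a b. LG_expansions n \<nu> \<eta> a b"
proof -
  define \<mu> where "\<mu> = \<i> * complex_of_real \<nu>"
  define c where "c = complex_of_real (sqrt (2 * \<nu> / pi) * exp (pi * \<nu> / 2))"
  define k where "k = complex_of_real (sqrt (1 / (2 * pi * \<nu>)) * exp (pi * \<nu> / 2))"
  have k0: "k \<noteq> 0" using \<nu> by (simp add: k_def)
  have \<nu>0: "\<nu> \<noteq> 0" "- \<nu> \<noteq> 0" using \<nu> by auto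
  obtain C where C0: "C \<noteq> 0" and C1: "\<And>j g z. admissible_path n j g z \<Longrightarrow> (if \<nu> > 0 then j = 1 else j = - 1) \<Longrightarrow>
      cmod (besselI (\<i> * \<nu>) (of_real \<bar>\<nu>\<bar> * z) * LG_V n \<nu> z / C - 1) \<le>
      LG_bound n g \<bar>\<nu>\<bar>"
    using besselI_path_bound[OF n \<nu>0(1)] by blast
  have C: "cmod (besselI \<mu> (of_real \<nu> * z) * LG_V n \<nu> z / C - 1) \<le>
      LG_bound n g \<nu>"
    if "admissible_path n 1 g z" for g z
    using C1[OF that] \<nu> by (simp add: \<mu>_def)
  obtain C' where C'0: "C' \<noteq> 0" and C'1: "\<And>j g z. admissible_path n j g z \<Longrightarrow> (if - \<nu> > 0 then j = 1 else j = - 1) \<Longrightarrow>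
      cmod (besselI (\<i> * of_real (- \<nu>)) (of_real \<bar>- \<nu>\<bar> * z) * LG_V n (of_real (- \<nu>)) z / C' - 1) \<le>
      LG_bound n g \<bar>- \<nu>\<bar>"
    using besselI_path_bound[OF n \<nu>0(2)] by blast
  have C': "cmod (besselI (- \<mu>) (of_real \<nu> * z) * LG_V n (of_real (- \<nu>)) z / C' - 1) \<le>
      LG_bound n g \<nu>"
    if "admissible_path n (- 1) g z" for g z
    using C'1[OF that] \<nu> by (simp add: \<mu>_def)
  \<comment> \<open>Each \<eta> is the normalised error factor minus 1, defined at all z and without
    reference to a path, so the expansions become identities wherever \<open>LG_V\<close> is
    nonzero.\<close>
  define \<eta> :: "int \<Rightarrow> complex \<Rightarrow> complex" where "\<eta> j z =
    (if j = 0 then c * besselK \<mu> (of_real \<nu> * z) * LG_V n (of_real (- \<nu>)) z - 1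
     else if j = 1 then besselI \<mu> (of_real \<nu> * z) * LG_V n \<nu> z / C - 1
     else besselI (- \<mu>) (of_real \<nu> * z) * LG_V n (of_real (- \<nu>)) z / C' - 1)" for j z
  have V: "LG_V n N z \<noteq> 0" if "z \<in> LG_Z n j" for N z j
    using LG_Z_domain[OF that] by (intro LG_V_nonzero) (auto simp: LG_domain_def)
  have cc: "of_real (sqrt (pi / (2 * \<nu>)) * exp (- (pi * \<nu> / 2))) * c = 1"
  proof -
    have "sqrt (pi / (2 * \<nu>)) * exp (- (pi * \<nu> / 2)) * (sqrt (2 * \<nu> / pi) * exp (pi * \<nu> / 2)) =
       (sqrt (pi / (2 * \<nu>)) * sqrt (2 * \<nu> / pi)) * (exp (- (pi * \<nu> / 2)) * exp (pi * \<nu> / 2))" by (simp only: mult_ac)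
    also have "exp (- (pi * \<nu> / 2)) * exp (pi * \<nu> / 2) = 1" by (simp flip: exp_add)
    also have "sqrt (pi / (2 * \<nu>)) * sqrt (2 * \<nu> / pi) = 1" using \<nu> by (simp flip: real_sqrt_mult)
    finally show ?thesis unfolding c_def of_real_mult[symmetric] by simp
  qed
  show ?thesis
  \<comment> \<open>In (1 + \<eta>) / (1 + a) with 1 + a = k / C the unknown C cancels; likewise C'
    on the negative axis, where the limit has the additional factor \<i>.\<close>
  proof (rule exI[of _ \<eta>], rule exI[of _ "k / C - 1"], rule exI[of _ "\<i> * k / C' - 1"],
      unfold LG_expansions_def, intro conjI ballI allI impI)
    fix z assume "z \<in> LG_Z n 0"
    from V[OF this] have "a / V * (1 + (c * K * V - 1)) = a * c * K" if "V = LG_V n (of_real (- \<nu>)) z" for a V K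
      using that by simp
    then show "besselK (\<i> * of_real \<nu>) (of_real \<nu> * z) = K_approx n \<nu> z * (1 + \<eta> 0 z)"
      by (simp only: approx_eq_LG_V \<eta>_def cc mult_1 if_True refl \<mu>_def)
  next
    fix z assume "z \<in> LG_Z n 1"
    from V[OF this] have "LG_V n \<nu> z \<noteq> 0" .
    then show "besselI (\<i> * of_real \<nu>) (of_real \<nu> * z) = Ip_approx n \<nu> z * ((1 + \<eta> 1 z) / (1 + (k / C - 1)))"
      using C0 k0 unfolding approx_eq_LG_V k_def[symmetric] \<mu>_def[symmetric] by (simp add: \<eta>_def)
  next
    fix z assume "z \<in> LG_Z n (- 1)"
    from V[OF this] have "LG_V n (of_real (- \<nu>)) z \<noteq> 0" .
    then show "besselI (- (\<i> * of_real \<nu>)) (of_real \<nu> * z) = Im_approx n \<nu> z * ((1 + \<eta> (- 1) z) / (1 + (\<i> * k / C' - 1)))"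
      using C'0 k0 unfolding approx_eq_LG_V k_def[symmetric] \<mu>_def[symmetric] by (simp add: \<eta>_def)
  next
    show "((\<lambda>x::real. \<eta> 1 (of_real x)) \<longlongrightarrow> k / C - 1) at_top"
      using tendsto_diff[OF tendsto_divide[OF besselI_LG_V_at_infinity(1)[OF \<nu>, of n] tendsto_const C0] tendsto_const[of 1]]
      by (simp add: \<eta>_def \<mu>_def k_def)
    show "((\<lambda>x::real. \<eta> (- 1) (- of_real x)) \<longlongrightarrow> \<i> * k / C' - 1) at_top"
      using tendsto_diff[OF tendsto_divide[OF besselI_LG_V_at_infinity(2)[OF \<nu>, of n] tendsto_const C'0] tendsto_const[of 1]]
      by (simp add: \<eta>_def \<mu>_def k_def)
    show "1 + (k / C - 1) \<noteq> 0" "1 + (\<i> * k / C' - 1) \<noteq> 0" using k0 C0 C'0 by simp_all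
  next
    fix j :: int and z g assume "j \<in> {- 1, 0, 1}" and path: "admissible_path n j g z"
    then consider "j = -1" | "j = 0" | "j = 1" by auto
    then show "cmod (\<eta> j z) \<le> LG_bound n g \<nu>"
    proof cases
      case 1
      then show ?thesis using C'[of g z] path by (simp add: \<eta>_def)
    next
      case 2
      then show ?thesis using besselK_path_bound[OF n \<nu>, of g z] path by (simp add: \<eta>_def \<mu>_def c_def)
    next
      case 3
      then show ?thesis using C[of g z] path by (simp add: \<eta>_def)
    qed
  qed
qed

section \<open>Order of the error terms\<close>

lemma abs_integral_nonneg: "abs_integral g f \<ge> 0"
  unfolding abs_integral_def
  \<comment> \<open>A nonintegrable function has integral 0 by convention.\<close>
  by (cases "(\<lambda>\<tau>. cmod (f (g \<tau>) * vector_derivative g (at \<tau>))) integrable_on {0<..1}")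
    (auto intro: integral_nonneg simp: not_integrable_integral)

lemma Phi_nonneg: "\<nu> > 0 \<Longrightarrow> Phi n g \<nu> \<ge> 0"
  unfolding Phi_def
  by (auto intro!: add_nonneg_nonneg sum_nonneg mult_nonneg_nonneg divide_nonneg_nonneg abs_integral_nonneg)

text \<open>Every summand is a nonnegative integral times a power of 1 / \<nu>, so on a fixed path
  the values at \<nu> = 1 bound all later ones.\<close>

lemma Phi_Psi_antimono:
  assumes "\<nu> \<ge> 1"
  shows "Phi n g \<nu> \<le> Phi n g 1" "Psi n g \<nu> \<le> Psi n g 1"
proof -
  have p: "1 / \<nu> ^ s \<le> 1 / 1 ^ s" for s using assms one_le_power[OF assms, of s] by (simp add: divide_le_eq_1)
  show "Phi n g \<nu> \<le> Phi n g 1" "Psi n g \<nu> \<le> Psi n g 1"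
    unfolding Phi_def Psi_def
    by (intro add_left_mono mult_left_mono sum_mono mult_right_mono[OF p] sum_nonneg abs_integral_nonneg zero_le_numeral)+
qed

lemma LG_bound_le:
  assumes "\<nu> \<ge> 1" "Phi n g \<nu> \<le> B" "Psi n g \<nu> \<le> B"
  shows "LG_bound n g \<nu> \<le> B * exp (2 * B) / \<nu> ^ n"
proof -
  have \<Phi>: "0 \<le> Phi n g \<nu>" using assms(1) by (intro Phi_nonneg) simp
  then have B: "B \<ge> 0" using assms by linarith
  have n1: "1 / \<nu> ^ n \<le> 1" "1 / \<nu> \<le> 1" "0 < 1 / \<nu> ^ n" "0 < 1 / \<nu>"
    using assms(1) one_le_power[OF assms(1), of n] by (auto simp: divide_le_eq_1)
  have "1 / \<nu> * Psi n g \<nu> \<le> 1 / \<nu> * B" using n1 assms by (intro mult_left_mono) auto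
  also have "\<dots> \<le> 1 * B" using n1 B by (intro mult_right_mono) auto
  finally have "1 / \<nu> * Psi n g \<nu> \<le> B" by simp
  moreover have "1 / \<nu> ^ n * Phi n g \<nu> \<le> 1 * B" using n1 assms \<Phi> by (intro mult_mono) auto
  ultimately have "exp (1 / \<nu> * Psi n g \<nu> + 1 / \<nu> ^ n * Phi n g \<nu>) \<le> exp (2 * B)" by simp
  then have "LG_bound n g \<nu> \<le> 1 / \<nu> ^ n * B * exp (2 * B)"
    unfolding LG_bound_def using n1 assms \<Phi> B by (intro mult_mono mult_left_mono mult_nonneg_nonneg) auto
  then show ?thesis by simp
qed

theorem theorem2p1:
  fixes n :: nat
  assumes "n \<ge> 2"
  shows "\<exists>(\<eta> :: int \<Rightarrow> real \<Rightarrow> complex \<Rightarrow> complex)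
          (\<eta>1_inf :: real \<Rightarrow> complex) (\<eta>m1_inf :: real \<Rightarrow> complex).
    (\<forall>\<nu>>0.
       \<comment> \<open>the three expansions\<close>
       (\<forall>z\<in>LG_Z n 0. besselK (\<i> * of_real \<nu>) (of_real \<nu> * z) = K_approx n \<nu> z * (1 + \<eta> 0 \<nu> z)) \<and>
       (\<forall>z\<in>LG_Z n 1. besselI (\<i> * of_real \<nu>) (of_real \<nu> * z) =
          Ip_approx n \<nu> z * ((1 + \<eta> 1 \<nu> z) / (1 + \<eta>1_inf \<nu>))) \<and>
       (\<forall>z\<in>LG_Z n (- 1). besselI (- (\<i> * of_real \<nu>)) (of_real \<nu> * z) =
          Im_approx n \<nu> z * ((1 + \<eta> (- 1) \<nu> z) / (1 + \<eta>m1_inf \<nu>))) \<and>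
       \<comment> \<open>the normalizing constants, as limits along \<open>arg z = 0\<close> and \<open>arg z = \<pi>\<close>\<close>
       ((\<lambda>x::real. \<eta> 1 \<nu> (of_real x)) \<longlongrightarrow> \<eta>1_inf \<nu>) at_top \<and>
       ((\<lambda>x::real. \<eta> (- 1) \<nu> (- of_real x)) \<longlongrightarrow> \<eta>m1_inf \<nu>) at_top \<and>
       1 + \<eta>1_inf \<nu> \<noteq> 0 \<and> 1 + \<eta>m1_inf \<nu> \<noteq> 0 \<and>
       \<comment> \<open>the error bounds, for every admissible path\<close>
       (\<forall>j\<in>{- 1, 0, 1}. \<forall>z g. admissible_path n j g z \<longrightarrow>
          cmod (\<eta> j \<nu> z) \<le> 1 / \<nu> ^ n * Phi n g \<nu> *
            exp (1 / \<nu> * Psi n g \<nu> + 1 / \<nu> ^ n * Phi n g \<nu>))) \<and>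
    \<comment> \<open>order of the error terms, pointwise and uniformly where the bounding integrals are bounded\<close>
    (\<forall>j\<in>{- 1, 0, 1}. \<forall>z\<in>LG_Z n j. (\<lambda>\<nu>. \<eta> j \<nu> z) \<in> O[at_top](\<lambda>\<nu>. 1 / of_real \<nu> ^ n)) \<and>
    (\<forall>j\<in>{- 1, 0, 1}. \<forall>S. \<forall>B \<nu>0.
       (\<forall>\<nu>\<ge>\<nu>0. \<forall>z\<in>S. \<exists>g. admissible_path n j g z \<and> Phi n g \<nu> \<le> B \<and> Psi n g \<nu> \<le> B) \<longrightarrow>
       (\<exists>C. \<forall>\<^sub>F \<nu> in at_top. \<forall>z\<in>S. cmod (\<eta> j \<nu> z) \<le> C / \<nu> ^ n)) \<and>
    (\<forall>\<nu>>0.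
       \<comment> \<open>the reflection relations\<close>
       (\<forall>z. z \<noteq> 0 \<longrightarrow>
          value_at_conjugate (\<lambda>w. besselI (\<i> * of_real \<nu>) (of_real \<nu> * w)) z
            (cnj (besselI (- (\<i> * of_real \<nu>)) (of_real \<nu> * z))) \<and>
          value_at_conjugate (\<lambda>w. besselI (- (\<i> * of_real \<nu>)) (of_real \<nu> * w)) z
            (cnj (besselI (\<i> * of_real \<nu>) (of_real \<nu> * z))) \<and>
          value_at_conjugate (\<lambda>w. besselK (\<i> * of_real \<nu>) (of_real \<nu> * w)) z
            (cnj (besselK (\<i> * of_real \<nu>) (of_real \<nu> * z)))) \<and>
       \<comment> \<open>the resulting expansions in the conjugate domains\<close>
       (\<forall>z\<in>LG_Z n 0. value_at_conjugate (\<lambda>w. besselK (\<i> * of_real \<nu>) (of_real \<nu> * w)) z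
          (cnj (K_approx n \<nu> z * (1 + \<eta> 0 \<nu> z)))) \<and>
       (\<forall>z\<in>LG_Z n 1. value_at_conjugate (\<lambda>w. besselI (- (\<i> * of_real \<nu>)) (of_real \<nu> * w)) z
          (cnj (Ip_approx n \<nu> z * ((1 + \<eta> 1 \<nu> z) / (1 + \<eta>1_inf \<nu>))))) \<and>
       (\<forall>z\<in>LG_Z n (- 1). value_at_conjugate (\<lambda>w. besselI (\<i> * of_real \<nu>) (of_real \<nu> * w)) z
          (cnj (Im_approx n \<nu> z * ((1 + \<eta> (- 1) \<nu> z) / (1 + \<eta>m1_inf \<nu>))))))"
proof -
  \<comment> \<open>Guarding by \<nu> > 0 gives a claim for every real \<nu>, from which choice
    produces total functions.\<close>
  have "\<forall>\<nu>. \<exists>\<eta> a b. \<nu> > 0 \<longrightarrow> LG_expansions n \<nu> \<eta> a b"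
    using expansions_fixed_order[OF assms] by blast
  then obtain \<eta>' a b where P': "\<forall>\<nu>>0. LG_expansions n \<nu> (\<eta>' \<nu>) (a \<nu>) (b \<nu>)"
    unfolding choice_iff by blast
  define \<eta> where "\<eta> j \<nu> = \<eta>' \<nu> j" for j \<nu>
  note P = P'[unfolded LG_expansions_def, folded \<eta>_def]
  have order: "cmod (\<eta> j \<nu> z) \<le> B * exp (2 * B) / \<nu> ^ n"
    if "j \<in> {- 1, 0, 1}" "admissible_path n j g z" "\<nu> \<ge> 1" "Phi n g \<nu> \<le> B" "Psi n g \<nu> \<le> B" for j g z \<nu> B
  proof -
    have "\<nu> > 0" using that(3) by simp
    then have "cmod (\<eta> j \<nu> z) \<le> LG_bound n g \<nu>" using P that(1,2) by blast
    also have "\<dots> \<le> B * exp (2 * B) / \<nu> ^ n" using LG_bound_le[OF that(3-5)] .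
    finally show ?thesis .
  qed
  have bigO: "(\<lambda>\<nu>. \<eta> j \<nu> z) \<in> O[at_top](\<lambda>\<nu>. 1 / of_real \<nu> ^ n)" if j: "j \<in> {- 1, 0, 1}" and z: "z \<in> LG_Z n j" for j z
  proof -
    obtain g where g: "admissible_path n j g z" using z by (auto simp: LG_Z_def)
    define B where "B = max (Phi n g 1) (Psi n g 1)"
    have *: "cmod (\<eta> j \<nu> z) \<le> B * exp (2 * B) * cmod (1 / of_real \<nu> ^ n :: complex)" if "\<nu> \<ge> 1" for \<nu>
    proof -
      have "Phi n g \<nu> \<le> B" "Psi n g \<nu> \<le> B" using Phi_Psi_antimono[OF that, of n g] by (auto simp: B_def)
      from order[OF j g that this] show ?thesis using that by (simp add: norm_divide norm_power)
    qed
    show ?thesis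
    proof (rule bigoI)
      show "\<forall>\<^sub>F \<nu> in at_top. cmod (\<eta> j \<nu> z) \<le> B * exp (2 * B) * cmod (1 / of_real \<nu> ^ n)"
        using eventually_ge_at_top[of 1] by (rule eventually_mono) (fact *)
    qed
  qed
  have uniform: "\<exists>C. \<forall>\<^sub>F \<nu> in at_top. \<forall>z\<in>S. cmod (\<eta> j \<nu> z) \<le> C / \<nu> ^ n"
    if j: "j \<in> {- 1, 0, 1}" and S: "\<forall>\<nu>\<ge>\<nu>0. \<forall>z\<in>S. \<exists>g. admissible_path n j g z \<and> Phi n g \<nu> \<le> B \<and> Psi n g \<nu> \<le> B"
    for j S B and \<nu>0 :: real
  proof (intro exI[of _ "B * exp (2 * B)"] eventually_mono[OF eventually_ge_at_top[of "max 1 \<nu>0"]] ballI)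
    fix \<nu> z assume "max 1 \<nu>0 \<le> \<nu>" "z \<in> S"
    then show "cmod (\<eta> j \<nu> z) \<le> B * exp (2 * B) / \<nu> ^ n" using S order[OF j] by force
  qed
  have nz: "z \<noteq> 0" if "z \<in> LG_Z n j" for z j using LG_Z_domain[OF that] by (simp add: LG_domain_def)
  have conj0: "value_at_conjugate (\<lambda>w. besselK (\<i> * of_real \<nu>) (of_real \<nu> * w)) z (cnj (K_approx n \<nu> z * (1 + \<eta> 0 \<nu> z)))"
    if "\<nu> > 0" "z \<in> LG_Z n 0" for \<nu> z
  proof -
    have "K_approx n \<nu> z * (1 + \<eta> 0 \<nu> z) = besselK (\<i> * of_real \<nu>) (of_real \<nu> * z)" using P that by simp
    then show ?thesis using bessel_reflection(3)[OF that(1) nz[OF that(2)]] by (simp only:)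
  qed
  have conj1: "value_at_conjugate (\<lambda>w. besselI (- (\<i> * of_real \<nu>)) (of_real \<nu> * w)) z
      (cnj (Ip_approx n \<nu> z * ((1 + \<eta> 1 \<nu> z) / (1 + a \<nu>))))" if "\<nu> > 0" "z \<in> LG_Z n 1" for \<nu> z
  proof -
    have "Ip_approx n \<nu> z * ((1 + \<eta> 1 \<nu> z) / (1 + a \<nu>)) = besselI (\<i> * of_real \<nu>) (of_real \<nu> * z)" using P that by simp
    then show ?thesis using bessel_reflection(2)[OF that(1) nz[OF that(2)]] by (simp only:)
  qed
  have conjm1: "value_at_conjugate (\<lambda>w. besselI (\<i> * of_real \<nu>) (of_real \<nu> * w)) z
      (cnj (Im_approx n \<nu> z * ((1 + \<eta> (- 1) \<nu> z) / (1 + b \<nu>))))" if "\<nu> > 0" "z \<in> LG_Z n (- 1)" for \<nu> z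
  proof -
    have "Im_approx n \<nu> z * ((1 + \<eta> (- 1) \<nu> z) / (1 + b \<nu>)) = besselI (- (\<i> * of_real \<nu>)) (of_real \<nu> * z)" using P that by simp
    then show ?thesis using bessel_reflection(1)[OF that(1) nz[OF that(2)]] by (simp only:)
  qed
  have all: "\<forall>\<nu>>0. LG_expansions n \<nu> (\<lambda>j. \<eta> j \<nu>) (a \<nu>) (b \<nu>)"
    using P' by (simp add: \<eta>_def)
  show ?thesis
  proof (rule exI[of _ \<eta>], rule exI[of _ a], rule exI[of _ b], intro conjI, goal_cases)
    case 1
    show ?case using all unfolding LG_expansions_def LG_bound_def .
  next
    case 2
    show ?case using bigO by blast
  next
    case 3
    show ?case using uniform by blast
  next
    case 4
    show ?case by (intro allI impI conjI ballI; fact bessel_reflection conj0 conj1 conjm1)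
  qed
qed

end
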